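(* Let $P=P_{m_1}\times\cdots\times P_{m_n}$ be a product of polygons. If all $m_i$ are odd, then no small cover over $P$ is orientable. Consequently, no small cover over $P$ is symplectic.
   Context: $\mathbb Z_2=\mathbb Z/2\mathbb Z$; $P_k$ denotes the polygon with $k\ge3$ sides, so $P$ is a simple polytope of dimension $2n$ with $m=m_1+\cdots+m_n$ facets. The real moment-angle manifold of a simple polytope $P$ with $m$ facets $F_1,\dots,F_m$ is $\mathbb R\mathcal Z_P=(\mathbb Z_2^m\times P)/\sim$, where $(g,p)\sim(h,p)$ iff $g+h$ lies in the span of the standard basis vectors $e_i$ with $p\in F_i$; $\mathbb Z_2^m$ acts by $h\cdot[g,p]=[h+g,p]$. With its canonical smooth structure it is a closed smooth manifold with smooth $\mathbb Z_2^m$-action. A mod 2 characteristic map over $P$ (with $\dim P=d$) is a linear map $\lambda:\mathbb Z_2^m\to\mathbb Z_2^d$ such that whenever $F_{i_1}\cap\cdots\cap F_{i_k}\ne\varnothing$, the vectors $\lambda(e_{i_1}),\dots,\lambda(e_{i_k})$ are linearly independent. Then $\ker\lambda$ acts freely on $\mathbb R\mathcal Z_P$ and the small cover over $P$ determined by $\lambda$ is $M(P,\lambda)=\mathbb R\mathcal Z_P/\ker\lambda$; every small cover over $P$ is of this form. A closed smooth manifold is symplectic if it admits a closed nondegenerate 2-form. *)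

theory Defs
  imports "HOL-Analysis.Analysis" "HOL-Library.Z2"
begin

section \<open>Smooth maps between open subsets of Euclidean spaces\<close>

text \<open>
  Only meant for open \<open>S\<close>: derivatives are taken with respect to the ambient space. The Frechet
  derivative of a \<open>C\<^sup>k\<^sup>+\<^sup>1\<close> map is required to be \<open>C\<^sup>k\<close> in every fixed direction \<open>v\<close>.
\<close>

primrec Ck_on :: "nat \<Rightarrow> 'a::euclidean_space set \<Rightarrow> ('a \<Rightarrow> 'b::euclidean_space) \<Rightarrow> bool" where
  "Ck_on 0 S f \<longleftrightarrow> continuous_on S f"
| "Ck_on (Suc k) S f \<longleftrightarrow>
     (\<forall>x\<in>S. f differentiable (at x)) \<and> (\<forall>v. Ck_on k S (\<lambda>x. frechet_derivative f (at x) v))"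

definition smooth_on :: "'a::euclidean_space set \<Rightarrow> ('a \<Rightarrow> 'b::euclidean_space) \<Rightarrow> bool" where
  "smooth_on S f \<longleftrightarrow> (\<forall>k. Ck_on k S f)"

section \<open>Orientable and symplectic smooth manifolds\<close>

text \<open>
  A smooth manifold of dimension \<open>CARD('k)\<close> is given by a topology \<open>T\<close> and the collection \<open>A\<close> of
  its smooth charts. A chart is a pair \<open>(U, \<phi>)\<close>; the values of \<open>\<phi>\<close> outside \<open>U\<close> are irrelevant.
\<close>

type_synonym ('x, 'k) chart = "'x set \<times> ('x \<Rightarrow> real ^ 'k)"

definition topological_chart :: "'x topology \<Rightarrow> ('x, 'k::finite) chart \<Rightarrow> bool" where
  "topological_chart T c \<longleftrightarrow>
     (case c of (U, \<phi>) \<Rightarrow>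
        openin T U \<and> open (\<phi> ` U) \<and>
        homeomorphic_map (subtopology T U) (top_of_set (\<phi> ` U)) \<phi>)"

definition transition_map :: "('x, 'k) chart \<Rightarrow> ('x, 'k) chart \<Rightarrow> real ^ 'k \<Rightarrow> real ^ 'k" where
  "transition_map c d = snd d \<circ> inv_into (fst c) (snd c)"

definition transition_domain :: "('x, 'k) chart \<Rightarrow> ('x, 'k) chart \<Rightarrow> (real ^ 'k) set" where
  "transition_domain c d = snd c ` (fst c \<inter> fst d)"

definition orientable_manifold :: "'x topology \<Rightarrow> ('x, 'k::finite) chart set \<Rightarrow> bool" where
  "orientable_manifold T A \<longleftrightarrow>
     (\<exists>B\<subseteq>A. (\<Union>c\<in>B. fst c) = topspace T \<and>
        (\<forall>c\<in>B. \<forall>d\<in>B. \<forall>x\<in>transition_domain c d. 0 < det (jacobian (transition_map c d) (at x))))"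

text \<open>
  A differential 2-form is given by its representatives \<open>\<omega> c\<close> on the images of the charts \<open>c \<in> A\<close>;
  these are related by pullback along the transition maps.
\<close>

definition smooth_two_form ::
  "('x, 'k::finite) chart set \<Rightarrow>
   (('x, 'k) chart \<Rightarrow> real ^ 'k \<Rightarrow> real ^ 'k \<Rightarrow> real ^ 'k \<Rightarrow> real) \<Rightarrow> bool" where
  "smooth_two_form A \<omega> \<longleftrightarrow>
     (\<forall>c\<in>A.
        (\<forall>x\<in>snd c ` fst c. bilinear (\<omega> c x) \<and> (\<forall>v. \<omega> c x v v = 0)) \<and>
        (\<forall>v w. smooth_on (snd c ` fst c) (\<lambda>x. \<omega> c x v w))) \<and>
     (\<forall>c\<in>A. \<forall>d\<in>A. \<forall>x\<in>transition_domain c d. \<forall>v w.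
        \<omega> c x v w =
        \<omega> d (transition_map c d x)
          (frechet_derivative (transition_map c d) (at x) v)
          (frechet_derivative (transition_map c d) (at x) w))"

text \<open>
  The exterior derivative of a 2-form, evaluated on the constant vector fields \<open>u\<close>, \<open>v\<close>, \<open>w\<close> of a
  coordinate domain (whose Lie brackets vanish).
\<close>

definition closed_two_form ::
  "('x, 'k::finite) chart set \<Rightarrow>
   (('x, 'k) chart \<Rightarrow> real ^ 'k \<Rightarrow> real ^ 'k \<Rightarrow> real ^ 'k \<Rightarrow> real) \<Rightarrow> bool" where
  "closed_two_form A \<omega> \<longleftrightarrow>
     (\<forall>c\<in>A. \<forall>x\<in>snd c ` fst c. \<forall>u v w.
        frechet_derivative (\<lambda>y. \<omega> c y v w) (at x) u
        - frechet_derivative (\<lambda>y. \<omega> c y u w) (at x) v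
        + frechet_derivative (\<lambda>y. \<omega> c y u v) (at x) w = 0)"

definition nondegenerate_two_form ::
  "('x, 'k::finite) chart set \<Rightarrow>
   (('x, 'k) chart \<Rightarrow> real ^ 'k \<Rightarrow> real ^ 'k \<Rightarrow> real ^ 'k \<Rightarrow> real) \<Rightarrow> bool" where
  "nondegenerate_two_form A \<omega> \<longleftrightarrow>
     (\<forall>c\<in>A. \<forall>x\<in>snd c ` fst c. \<forall>v. v \<noteq> 0 \<longrightarrow> (\<exists>w. \<omega> c x v w \<noteq> 0))"

definition symplectic_manifold :: "('x, 'k::finite) chart set \<Rightarrow> bool" where
  "symplectic_manifold A \<longleftrightarrow>
     (\<exists>\<omega>. smooth_two_form A \<omega> \<and> closed_two_form A \<omega> \<and> nondegenerate_two_form A \<omega>)"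

section \<open>Quotient topology\<close>

definition quotient_topology :: "'x topology \<Rightarrow> ('x \<Rightarrow> 'y) \<Rightarrow> 'y topology" where
  "quotient_topology X f =
     topology (\<lambda>U. U \<subseteq> f ` topspace X \<and> openin X {x \<in> topspace X. f x \<in> U})"

lemma openin_quotient_topology:
  "openin (quotient_topology X f) U \<longleftrightarrow>
     U \<subseteq> f ` topspace X \<and> openin X {x \<in> topspace X. f x \<in> U}"
proof -
  have "istopology (\<lambda>U. U \<subseteq> f ` topspace X \<and> openin X {x \<in> topspace X. f x \<in> U})"
    unfolding istopology_def
  proof (intro conjI allI impI)
    fix S T
    assume S: "S \<subseteq> f ` topspace X \<and> openin X {x \<in> topspace X. f x \<in> S}"
      and T: "T \<subseteq> f ` topspace X \<and> openin X {x \<in> topspace X. f x \<in> T}"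
    show "S \<inter> T \<subseteq> f ` topspace X" using S by blast
    have "{x \<in> topspace X. f x \<in> S \<inter> T} =
            {x \<in> topspace X. f x \<in> S} \<inter> {x \<in> topspace X. f x \<in> T}" by blast
    then show "openin X {x \<in> topspace X. f x \<in> S \<inter> T}" using S T by auto
  next
    fix \<K>
    assume K: "\<forall>K\<in>\<K>. K \<subseteq> f ` topspace X \<and> openin X {x \<in> topspace X. f x \<in> K}"
    show "\<Union>\<K> \<subseteq> f ` topspace X" using K by blast
    have "{x \<in> topspace X. f x \<in> \<Union>\<K>} = (\<Union>K\<in>\<K>. {x \<in> topspace X. f x \<in> K})" by blast
    then show "openin X {x \<in> topspace X. f x \<in> \<Union>\<K>}" using K by auto
  qed
  then show ?thesis
    unfolding quotient_topology_def by (simp add: topology_inverse')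
qed

lemma topspace_quotient_topology [simp]:
  "topspace (quotient_topology X f) = f ` topspace X"
proof
  show "topspace (quotient_topology X f) \<subseteq> f ` topspace X"
    by (rule conjunct1[OF iffD1[OF openin_quotient_topology openin_topspace]])
  have "{x \<in> topspace X. f x \<in> f ` topspace X} = topspace X" by blast
  then have "openin (quotient_topology X f) (f ` topspace X)"
    unfolding openin_quotient_topology by simp
  then show "f ` topspace X \<subseteq> topspace (quotient_topology X f)"
    by (rule openin_subset)
qed

lemma quotient_map_quotient_topology: "quotient_map X (quotient_topology X f) f"
  by (simp add: quotient_map_def openin_quotient_topology)

section \<open>The real moment-angle manifold of a polytope\<close>

text \<open>
  The facets of \<open>P\<close> are indexed by a finite type \<open>'m\<close>, so that \<open>bit ^ 'm\<close> is the group
  \<open>(\<int>/2)\<^sup>m\<close> with standard basis vectors \<open>axis i 1\<close>.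
\<close>

definition facet_enumeration :: "'a::euclidean_space set \<Rightarrow> ('m::finite \<Rightarrow> 'a set) \<Rightarrow> bool" where
  "facet_enumeration P F \<longleftrightarrow> bij_betw F UNIV {S. S facet_of P}"

definition rz_rel ::
  "'a::euclidean_space set \<Rightarrow> ('m::finite \<Rightarrow> 'a set) \<Rightarrow> ((bit ^ 'm) \<times> 'a) rel" where
  "rz_rel P F =
     {((g, p), (h, q)). p \<in> P \<and> q = p \<and> g + h \<in> vec.span {axis i 1 | i. p \<in> F i}}"

definition rz_topology ::
  "'a::euclidean_space set \<Rightarrow> ('m::finite \<Rightarrow> 'a set) \<Rightarrow> ((bit ^ 'm) \<times> 'a) set topology" where
  "rz_topology P F =
     quotient_topology (prod_topology (discrete_topology UNIV) (top_of_set P))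
       (\<lambda>x. rz_rel P F `` {x})"

definition rz_action :: "bit ^ 'm \<Rightarrow> ((bit ^ 'm) \<times> 'a) set \<Rightarrow> ((bit ^ 'm) \<times> 'a) set" where
  "rz_action h X = (\<lambda>(g, p). (h + g, p)) ` X"

text \<open>
  The canonical smooth structure. The distance \<open>l\<^sub>i(p)\<close> of \<open>p \<in> P\<close> to the affine hull of the facet
  \<open>F i\<close> is the restriction to \<open>P\<close> of an affine function, and \<open>P\<close> is cut out of its affine hull by
  the inequalities \<open>l\<^sub>i \<ge> 0\<close>. The map sending \<open>[g, p]\<close> to the vector with entries
  \<open>(-1)\<^bsup>g\<^sub>i\<^esup> \<surd>l\<^sub>i(p)\<close> identifies the real moment-angle manifold of a simple polytope with a
  nondegenerate intersection of real quadrics in \<open>\<real>\<^sup>m\<close>, hence with a smooth submanifold. Its smooth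
  charts are the topological charts whose inverse is a smooth immersion into \<open>\<real>\<^sup>m\<close>.
\<close>

definition rz_coordinates ::
  "('m::finite \<Rightarrow> 'a::euclidean_space set) \<Rightarrow> (bit ^ 'm) \<times> 'a \<Rightarrow> real ^ 'm" where
  "rz_coordinates F = (\<lambda>(g, p).
     (\<chi> i. (if g $ i = 0 then 1 else - 1) * sqrt (infdist p (affine hull (F i)))))"

definition rz_embedding ::
  "('m::finite \<Rightarrow> 'a::euclidean_space set) \<Rightarrow> ((bit ^ 'm) \<times> 'a) set \<Rightarrow> real ^ 'm" where
  "rz_embedding F X = the_elem (rz_coordinates F ` X)"

definition rz_charts ::
  "'a::euclidean_space set \<Rightarrow> ('m::finite \<Rightarrow> 'a set) \<Rightarrow>
   (((bit ^ 'm) \<times> 'a) set, 'k::finite) chart set" where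
  "rz_charts P F =
     {(U, \<phi>). topological_chart (rz_topology P F) (U, \<phi>) \<and>
        smooth_on (\<phi> ` U) (rz_embedding F \<circ> inv_into U \<phi>) \<and>
        (\<forall>x\<in>\<phi> ` U. inj (frechet_derivative (rz_embedding F \<circ> inv_into U \<phi>) (at x)))}"

lemma span_axis_bit_iff:
  fixes u :: "bit ^ 'm::finite"
  shows "u \<in> vec.span {axis i 1 | i. i \<in> I} \<longleftrightarrow> (\<forall>i. i \<notin> I \<longrightarrow> u $ i = 0)"
proof
  assume "u \<in> vec.span {axis i 1 | i. i \<in> I}"
  then show "\<forall>i. i \<notin> I \<longrightarrow> u $ i = 0"
    by (induction rule: vec.span_induct_alt) (auto simp: axis_def split: if_splits)
next
  assume u: "\<forall>i. i \<notin> I \<longrightarrow> u $ i = 0"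
  have "u = (\<Sum>i\<in>UNIV. u $ i *s axis i 1)"
    by (simp add: basis_expansion)
  also have "\<dots> = (\<Sum>i\<in>I. u $ i *s axis i 1)"
    using u by (intro sum.mono_neutral_right) auto
  also have "\<dots> \<in> vec.span {axis i 1 | i. i \<in> I}"
    by (intro vec.span_sum vec.span_scale vec.span_base) auto
  finally show "u \<in> vec.span {axis i 1 | i. i \<in> I}" .
qed

lemma bit_add_eq_0_iff: "a + b = 0 \<longleftrightarrow> a = b" for a b :: bit
  by (cases a; cases b) simp_all

lemma rz_rel_iff:
  "((g, p), (h, q)) \<in> rz_rel P F \<longleftrightarrow> p \<in> P \<and> q = p \<and> (\<forall>i. p \<notin> F i \<longrightarrow> g $ i = h $ i)"
proof -
  have "g + h \<in> vec.span {axis i 1 | i. p \<in> F i} \<longleftrightarrow> (\<forall>i. p \<notin> F i \<longrightarrow> g $ i = h $ i)"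
    using span_axis_bit_iff[of "g + h" "{i. p \<in> F i}"]
    by (simp only: mem_Collect_eq vector_add_component bit_add_eq_0_iff)
  then show ?thesis
    unfolding rz_rel_def by (simp only: mem_Collect_eq prod.case)
qed

lemma equiv_rz_rel: "equiv (UNIV \<times> P) (rz_rel P F)"
proof (rule equivI)
  show "rz_rel P F \<subseteq> (UNIV \<times> P) \<times> (UNIV \<times> P)"
    by (auto simp: rz_rel_def)
  show "refl_on (UNIV \<times> P) (rz_rel P F)"
    by (rule refl_onI) (clarsimp simp: rz_rel_iff)
  show "sym (rz_rel P F)"
    by (rule symI) (clarsimp simp: rz_rel_iff)
  show "trans (rz_rel P F)"
    by (rule transI) (clarsimp simp: rz_rel_iff)
qed

lemma rz_embedding_class:
  assumes "p \<in> P"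
  shows "rz_embedding F (rz_rel P F `` {(g, p)}) = rz_coordinates F (g, p)"
proof -
  have eq: "rz_coordinates F x = rz_coordinates F (g, p)" if "x \<in> rz_rel P F `` {(g, p)}" for x
  proof -
    obtain h q where x: "x = (h, q)" by (cases x)
    with that have q: "q = p" and gh: "\<And>i. p \<notin> F i \<Longrightarrow> g $ i = h $ i"
      by (auto simp: rz_rel_iff)
    have "infdist p (affine hull (F i)) = 0" if "p \<in> F i" for i
      using that by (simp add: hull_inc)
    then have "(if h $ i = 0 then 1 else - 1) * sqrt (infdist p (affine hull (F i))) =
        (if g $ i = 0 then 1 else - 1) * sqrt (infdist p (affine hull (F i)))" for i
      using gh[of i] by (cases "p \<in> F i") simp_all
    then show ?thesis unfolding x q rz_coordinates_def
      by (simp add: vec_eq_iff)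
  qed
  have "(g, p) \<in> rz_rel P F `` {(g, p)}" using assms by (simp add: rz_rel_iff)
  with eq have "rz_coordinates F ` (rz_rel P F `` {(g, p)}) = {rz_coordinates F (g, p)}"
    by blast
  then show ?thesis by (simp add: rz_embedding_def)
qed

lemma rz_action_class:
  "rz_action h (rz_rel P F `` {(g, p)}) = rz_rel P F `` {(h + g, p)}"
proof (rule set_eqI)
  fix x :: "(bit ^ 'a) \<times> 'b"
  obtain k q where x: "x = (k, q)" by (cases x)
  have twice: "a + (a + b) = b" for a b :: bit
    by (cases a; cases b) simp_all
  have "x \<in> rz_action h (rz_rel P F `` {(g, p)}) \<longleftrightarrow> (h + k, q) \<in> rz_rel P F `` {(g, p)}"
  proof
    assume "x \<in> rz_action h (rz_rel P F `` {(g, p)})"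
    then obtain l where "k = h + l" "(l, q) \<in> rz_rel P F `` {(g, p)}"
      by (auto simp: rz_action_def x)
    moreover from this have "h + k = l"
      by (simp only: vec_eq_iff vector_add_component twice) simp
    ultimately show "(h + k, q) \<in> rz_rel P F `` {(g, p)}" by simp
  next
    assume "(h + k, q) \<in> rz_rel P F `` {(g, p)}"
    moreover have "x = (\<lambda>(g, p). (h + g, p)) (h + k, q)"
      by (simp only: x vec_eq_iff vector_add_component twice prod.case prod.inject) simp
    ultimately show "x \<in> rz_action h (rz_rel P F `` {(g, p)})"
      unfolding rz_action_def by blast
  qed
  also have "\<dots> \<longleftrightarrow> x \<in> rz_rel P F `` {(h + g, p)}"
  proof -
    have "a = b + c \<longleftrightarrow> b + a = c" for a b c :: bit
      by (cases a; cases b; cases c) simp_all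
    then have "g $ i = (h + k) $ i \<longleftrightarrow> (h + g) $ i = k $ i" for i
      by (simp only: vector_add_component)
    then show ?thesis by (simp only: x rz_rel_iff Image_singleton_iff)
  qed
  finally show "x \<in> rz_action h (rz_rel P F `` {(g, p)}) \<longleftrightarrow> x \<in> rz_rel P F `` {(h + g, p)}" .
qed

section \<open>Small covers\<close>

definition mod2_characteristic_map ::
  "'a::euclidean_space set \<Rightarrow> ('m::finite \<Rightarrow> 'a set) \<Rightarrow> (bit ^ 'm \<Rightarrow> bit ^ 'k::finite) \<Rightarrow> bool" where
  "mod2_characteristic_map P F lam \<longleftrightarrow>
     aff_dim P = int CARD('k) \<and>
     Vector_Spaces.linear (*s) (*s) lam \<and>
     (\<forall>I. I \<noteq> {} \<and> (\<Inter>i\<in>I. F i) \<noteq> {} \<longrightarrow>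
        inj_on (\<lambda>i. lam (axis i 1)) I \<and> vec.independent ((\<lambda>i. lam (axis i 1)) ` I))"

definition kernel_orbit ::
  "(bit ^ 'm \<Rightarrow> bit ^ 'k) \<Rightarrow> ((bit ^ 'm) \<times> 'a) set \<Rightarrow> ((bit ^ 'm) \<times> 'a) set set" where
  "kernel_orbit lam X = {rz_action h X | h. lam h = 0}"

definition small_cover_topology ::
  "'a::euclidean_space set \<Rightarrow> ('m::finite \<Rightarrow> 'a set) \<Rightarrow> (bit ^ 'm \<Rightarrow> bit ^ 'k::finite) \<Rightarrow>
   ((bit ^ 'm) \<times> 'a) set set topology" where
  "small_cover_topology P F lam = quotient_topology (rz_topology P F) (kernel_orbit lam)"

text \<open>
  The smooth structure of the quotient by the free action of the kernel, i.e. the one for which the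
  quotient map is a local diffeomorphism: a chart is smooth iff its local lifts are.
\<close>

definition small_cover_charts ::
  "'a::euclidean_space set \<Rightarrow> ('m::finite \<Rightarrow> 'a set) \<Rightarrow> (bit ^ 'm \<Rightarrow> bit ^ 'k::finite) \<Rightarrow>
   (((bit ^ 'm) \<times> 'a) set set, 'k) chart set" where
  "small_cover_charts P F lam =
     {(U, \<phi>). topological_chart (small_cover_topology P F lam) (U, \<phi>) \<and>
        (\<forall>W. openin (rz_topology P F) W \<and> inj_on (kernel_orbit lam) W \<and>
             kernel_orbit lam ` W \<subseteq> U \<longrightarrow>
             (W, \<phi> \<circ> kernel_orbit lam) \<in> rz_charts P F)}"

section \<open>Products of polygons\<close>

definition polygon :: "nat \<Rightarrow> (real ^ 2) set \<Rightarrow> bool" where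
  "polygon k Q \<longleftrightarrow> k \<ge> 3 \<and> polytope Q \<and> aff_dim Q = 2 \<and> card {E. E facet_of Q} = k"

definition polygon_product :: "('n::finite \<Rightarrow> (real ^ 2) set) \<Rightarrow> ((real ^ 2) ^ 'n) set" where
  "polygon_product Q = {x. \<forall>j. x $ j \<in> Q j}"

end

theory Submission
  imports Defs
begin

text \<open>
  Write \<open>M\<close> for the small cover, the quotient of the real moment-angle manifold by the kernel of
  \<open>\<lambda>\<close>. The proof plays two facts about vectors of odd weight in this kernel against each other.

  The geometric fact holds over every polytope \<open>P\<close> (lemma
  \<open>even_kernel_if_orientable_or_symplectic\<close>): if \<open>M\<close> is orientable or symplectic, then every
  \<open>h\<close> with \<open>\<lambda> h = 0\<close> has even weight. Both structures give a sign field, that is, a locally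
  constant sign in every chart that changes by the sign of the Jacobian determinant under a change
  of charts; for a symplectic form it is the sign of the Pfaffian, which a linear substitution
  \<open>J\<close> multiplies by \<open>det J\<close> (lemmas \<open>sign_field_if_orientable\<close>, \<open>sign_field_if_symplectic\<close>).
  The real moment-angle manifold is glued from one copy of \<open>P\<close>, a chamber, for every vector \<open>g\<close>,
  and comparing the sign field with a fixed orientation of the affine space around \<open>P\<close> gives one
  sign \<open>\<sigma> g\<close> per chamber. The chambers \<open>g\<close> and \<open>g + e\<^sub>i\<close> meet along the facet \<open>F\<^sub>i\<close>. In a chart
  around this wall, whose transverse coordinate is a signed square root of the distance to
  \<open>F\<^sub>i\<close>, the two copies of \<open>P\<close> are mirror images, so \<open>\<sigma> (g + e\<^sub>i) = - \<sigma> g\<close>. Since \<open>\<sigma>\<close> is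
  defined on \<open>M\<close>, it is also invariant under adding \<open>h\<close> with \<open>\<lambda> h = 0\<close>, and the weight of \<open>h\<close>
  must be even (lemma \<open>even_kernel_if_sign_field\<close>).

  The combinatorial fact is that a product of odd polygons always has a kernel vector of odd weight
  (lemma \<open>odd_kernel_vector_polygon_product\<close>). At a vertex of \<open>P\<close> there are two edges of every
  polygon, and the values of \<open>\<lambda>\<close> on the corresponding facets form a basis. Hence the determinants of
  these bases, summed over all vertices, give the number of vertices modulo 2, which is 1. If
  a fixed vector \<open>u\<close> is added to all values of \<open>\<lambda>\<close> the sum does not change: for one polygon the new
  terms form a sum over pairs of an edge and one of its vertices, and every edge has two vertices.
  With \<open>u = \<lambda> e\<^sub>0\<close> for some basis vector \<open>e\<^sub>0\<close>, one of the new determinants is therefore nonzero,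
  so the vectors \<open>\<lambda> (e\<^sub>F + e\<^sub>0)\<close> span. In particular \<open>\<lambda> e\<^sub>0 = \<lambda> h\<close> for some \<open>h\<close> of even weight, and
  \<open>e\<^sub>0 + h\<close> is a kernel vector of odd weight.
\<close>

section \<open>Vertices and edges of a polygon\<close>

lemma facet_eq_if_subset:
  assumes "polytope Q" "E facet_of Q" "E' facet_of Q" "E \<subseteq> E'"
  shows "E = E'"
proof (rule ccontr)
  assume "E \<noteq> E'"
  moreover have "E face_of E'"
    using assms face_of_subset facet_of_imp_face_of facet_of_imp_subset by metis
  moreover have "convex E'"
    using assms facet_of_imp_face_of face_of_imp_convex by blast
  ultimately have "aff_dim E < aff_dim E'" by (simp add: face_of_aff_dim_lt)
  then show False using assms by (simp add: facet_of_def)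
qed

lemma edge_is_segment:
  fixes Q :: "'a::euclidean_space set"
  assumes "polytope Q" "aff_dim Q = 2" "E facet_of Q"
  obtains u v where "u \<noteq> v" "E = closed_segment u v"
proof -
  have E: "E face_of Q" "E \<noteq> {}" "aff_dim E = 1"
    using assms by (auto simp: facet_of_def)
  have "polytope E" using face_of_polytope_polytope assms(1) E(1) by blast
  then have "compact E" "convex E" by (auto simp: polytope_imp_compact polytope_imp_convex)
  moreover have "collinear E" using E(3) by (simp add: collinear_aff_dim)
  ultimately obtain u v where uv: "E = closed_segment u v"
    using compact_convex_collinear_segment E(2) by metis
  moreover have "u \<noteq> v" using uv E(3) by auto
  ultimately show ?thesis using that by blast
qed

lemma card_vertices_of_edge:
  fixes Q :: "'a::euclidean_space set"
  assumes "polytope Q" "aff_dim Q = 2" "E facet_of Q"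
  shows "card {x. x extreme_point_of Q \<and> x \<in> E} = 2"
proof -
  obtain u v where uv: "u \<noteq> v" "E = closed_segment u v"
    using edge_is_segment assms by blast
  have "{x. x extreme_point_of Q \<and> x \<in> E} = {x. x extreme_point_of E}"
    using extreme_point_of_face[OF facet_of_imp_face_of[OF assms(3)]] by blast
  also have "\<dots> = {u, v}" by (auto simp: uv(2) extreme_point_of_segment)
  finally show ?thesis using uv(1) by simp
qed

text \<open>
  The vectors \<open>d\<^sub>i\<close> are the directions in which edges leave a vertex, the \<open>a\<^sub>i\<close> their outer normals.
  Three vectors in the plane satisfy a linear relation; pairing it with each normal shows that any
  two of its three coefficients have opposite signs.
\<close>

lemma no_three_edges_at_vertex:
  fixes a1 a2 a3 d1 d2 d3 :: "real ^ 2"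
  assumes eq: "a1 \<bullet> d1 = 0" "a2 \<bullet> d2 = 0" "a3 \<bullet> d3 = 0" and "d1 \<noteq> 0"
    and neg: "a1 \<bullet> d2 < 0" "a1 \<bullet> d3 < 0" "a2 \<bullet> d1 < 0" "a2 \<bullet> d3 < 0" "a3 \<bullet> d1 < 0" "a3 \<bullet> d2 < 0"
  shows False
proof -
  define \<alpha> where "\<alpha> = d2$1 * d3$2 - d2$2 * d3$1"
  define \<beta> where "\<beta> = d3$1 * d1$2 - d3$2 * d1$1"
  define \<gamma> where "\<gamma> = d1$1 * d2$2 - d1$2 * d2$1"
  have dep: "\<alpha> *\<^sub>R d1 + \<beta> *\<^sub>R d2 + \<gamma> *\<^sub>R d3 = 0"
    by (simp add: vec_eq_iff forall_2 \<alpha>_def \<beta>_def \<gamma>_def algebra_simps)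
  have 0: "\<alpha> * (a \<bullet> d1) + \<beta> * (a \<bullet> d2) + \<gamma> * (a \<bullet> d3) = 0" for a
    using arg_cong[OF dep, of "\<lambda>x. a \<bullet> x"] by (simp add: inner_add_right)
  have 1: "\<beta> * (a1 \<bullet> d2) = - \<gamma> * (a1 \<bullet> d3)"
    and 2: "\<alpha> * (a2 \<bullet> d1) = - \<gamma> * (a2 \<bullet> d3)"
    and 3: "\<alpha> * (a3 \<bullet> d1) = - \<beta> * (a3 \<bullet> d2)"
    using 0[of a1] 0[of a2] 0[of a3] eq by simp_all
  have "\<gamma> \<noteq> 0"
  proof
    assume "\<gamma> = 0"
    then have c: "d1$1 * d2$2 = d1$2 * d2$1" by (simp add: \<gamma>_def)
    have s: "a1$1 * d1$1 = - a1$2 * d1$2" "a1$1 * d2$1 + a1$2 * d2$2 < 0"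
      using eq(1) neg(1) by (simp_all add: inner_vec_def sum_2)
    have "d1$1 \<noteq> 0 \<or> d1$2 \<noteq> 0" using \<open>d1 \<noteq> 0\<close> by (auto simp: vec_eq_iff forall_2)
    moreover have "d1$1 * (a1$1 * d2$1 + a1$2 * d2$2) = 0"
      using s(1) c by algebra
    moreover have "d1$2 * (a1$1 * d2$1 + a1$2 * d2$2) = 0"
      using s(1) c by algebra
    ultimately show False using s(2) by auto
  qed
  have opp: "x * y < 0" if "x * p = - y * q" "p < 0" "q < 0" "y \<noteq> 0" for x y p q :: real
  proof -
    have "x * y * p = - (y * y) * q" using that(1) by algebra
    moreover have "0 < - (y * y) * q" using that(3,4) by (auto simp: mult_less_0_iff zero_less_mult_iff)
    ultimately have "0 < x * y * p" by simp
    then show ?thesis using that(2) by (simp add: zero_less_mult_iff)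
  qed
  have b: "\<beta> * \<gamma> < 0" and a: "\<alpha> * \<gamma> < 0"
    using opp 1 2 neg \<open>\<gamma> \<noteq> 0\<close> by blast+
  have "\<beta> \<noteq> 0" using b by auto
  then have "\<alpha> * \<beta> < 0" using opp[OF 3] neg by blast
  then show False using a b by (auto simp: mult_less_0_iff)
qed

text \<open>
  A vertex is the intersection of the edges through it, and a single edge is more than a point.
\<close>

lemma card_edges_at_vertex:
  fixes Q :: "(real ^ 2) set"
  assumes Q: "polytope Q" "aff_dim Q = 2" and x: "x extreme_point_of Q"
  shows "card {E. E facet_of Q \<and> x \<in> E} = 2"
proof -
  let ?S = "{E. E facet_of Q \<and> x \<in> E}"
  have fin: "finite ?S"
    using finite_polytope_facets[OF Q(1)] by (rule finite_subset[rotated]) auto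
  have poly: "polyhedron Q" using Q(1) by (simp add: polytope_imp_polyhedron)
  have dir: "\<exists>d. d \<noteq> 0 \<and> E = closed_segment x (x + d)" if "E \<in> ?S" for E
  proof -
    have "E facet_of Q" using that by simp
    then obtain u v where uv: "u \<noteq> v" "E = closed_segment u v"
      by (rule edge_is_segment[OF Q])
    have "x extreme_point_of E"
      using extreme_point_of_face[OF facet_of_imp_face_of] that x by blast
    then consider "x = u" | "x = v" by (auto simp: uv(2) extreme_point_of_segment)
    then show ?thesis
    proof cases
      case 1 then show ?thesis using uv by (intro exI[of _ "v - u"]) auto
    next
      case 2 then show ?thesis using uv
        by (intro exI[of _ "u - v"]) (auto simp: closed_segment_commute)
    qed
  qed
  have "\<exists>a b. Q \<subseteq> {y. a \<bullet> y \<le> b} \<and> E = Q \<inter> {y. a \<bullet> y = b}" if "E \<in> ?S" for E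
    using facet_of_polyhedron[OF poly, of E] that by blast
  then obtain a b where ab: "\<And>E. E \<in> ?S \<Longrightarrow> Q \<subseteq> {y. a E \<bullet> y \<le> b E} \<and> E = Q \<inter> {y. a E \<bullet> y = b E}"
    by metis
  obtain d where d: "\<And>E. E \<in> ?S \<Longrightarrow> d E \<noteq> 0 \<and> E = closed_segment x (x + d E)"
    using dir by metis
  have mem: "y \<in> E \<longleftrightarrow> y \<in> Q \<and> a E \<bullet> y = b E" if "E \<in> ?S" for E y
    using ab[OF that] by blast
  have b: "b E = a E \<bullet> x" if "E \<in> ?S" for E
    using mem[OF that, of x] that by simp
  have in': "x + d E \<in> E" if "E \<in> ?S" for E
    using d[OF that] by (metis ends_in_segment(2))
  have eq: "a E \<bullet> d E = 0" if "E \<in> ?S" for E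
  proof -
    have "a E \<bullet> (x + d E) = b E" using mem[OF that] in'[OF that] by simp
    then show ?thesis using b[OF that] by (simp add: inner_add_right)
  qed
  have neg: "a E \<bullet> d E' < 0" if "E \<in> ?S" "E' \<in> ?S" "E \<noteq> E'" for E E'
  proof -
    have q: "x + d E' \<in> Q" using mem[OF that(2)] in'[OF that(2)] by simp
    then have "a E \<bullet> (x + d E') \<le> b E" using ab[OF that(1)] by auto
    then have "a E \<bullet> d E' \<le> 0" using b[OF that(1)] by (simp add: inner_add_right)
    moreover have "a E \<bullet> d E' \<noteq> 0"
    proof
      assume "a E \<bullet> d E' = 0"
      then have "x + d E' \<in> E"
        using q mem[OF that(1)] b[OF that(1)] by (simp add: inner_add_right)
      moreover have "convex E" using that(1) face_of_imp_convex facet_of_imp_face_of by blast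
      ultimately have "E' \<subseteq> E"
        using d[OF that(2)] that(1) by (metis (no_types, lifting) closed_segment_subset mem_Collect_eq)
      then show False using facet_eq_if_subset[OF Q(1)] that by blast
    qed
    ultimately show ?thesis by simp
  qed
  have "card ?S \<le> 2"
  proof (rule ccontr)
    assume "\<not> card ?S \<le> 2"
    then have "3 \<le> card ?S" by linarith
    then obtain T where T: "T \<subseteq> ?S" "card T = 3"
      by (rule obtain_subset_with_card_n)
    then obtain E1 E2 E3 where T3: "T = {E1, E2, E3}" and ne: "E1 \<noteq> E2" "E1 \<noteq> E3" "E2 \<noteq> E3"
      by (metis card_3_iff)
    have E: "E1 \<in> ?S" "E2 \<in> ?S" "E3 \<in> ?S" using T(1) by (simp_all add: T3)
    show False
      using no_three_edges_at_vertex[OF eq[OF E(1)] eq[OF E(2)] eq[OF E(3)] conjunct1[OF d[OF E(1)]]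
          neg[OF E(1,2) ne(1)] neg[OF E(1,3) ne(2)] neg[OF E(2,1) ne(1)[symmetric]]
          neg[OF E(2,3) ne(3)] neg[OF E(3,1) ne(2)[symmetric]] neg[OF E(3,2) ne(3)[symmetric]]] .
  qed
  moreover have "2 \<le> card ?S"
  proof -
    have face: "{x} face_of Q" using x by (simp add: face_of_singleton)
    have "{x} \<noteq> Q" using Q(2) by auto
    then have inter: "{x} = \<Inter>?S"
      using face_of_polyhedron[OF poly face] by simp
    have "card ?S \<noteq> 0"
    proof
      assume "card ?S = 0"
      then have "?S = {}" using fin by simp
      then have "{x} = \<Inter>{}" using inter by (simp only:)
      then have "x + axis 1 1 = x" by blast
      then show False by (simp add: axis_eq_0_iff)
    qed
    moreover have "card ?S \<noteq> 1"
    proof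
      assume "card ?S = 1"
      then obtain E where S: "?S = {E}" by (auto simp: card_1_singleton_iff)
      then have "E = {x}" "E \<in> ?S" using inter by auto
      then show False using in' d by fastforce
    qed
    ultimately show ?thesis by linarith
  qed
  ultimately show ?thesis by simp
qed

lemma bit_double [simp]: "a + a = (0::bit)"
  by (cases a) simp_all

text \<open>
  The sum counts every edge twice, once for each of its vertices. The same double count with
  natural numbers shows that there are as many vertices as edges.
\<close>

lemma polygon_incidence:
  assumes "polygon k Q"
  obtains e\<^sub>0 e\<^sub>1 where
    "\<And>x. x extreme_point_of Q \<Longrightarrow> e\<^sub>0 x \<noteq> e\<^sub>1 x \<and> {E. E facet_of Q \<and> x \<in> E} = {e\<^sub>0 x, e\<^sub>1 x}"
    "card {x. x extreme_point_of Q} = k"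
    "\<And>f. (\<Sum>x | x extreme_point_of Q. f (e\<^sub>0 x) + f (e\<^sub>1 x)) = (0::bit)"
proof -
  have Q: "polytope Q" "aff_dim Q = 2" "card {E. E facet_of Q} = k"
    using assms by (auto simp: polygon_def)
  let ?V = "{x. x extreme_point_of Q}" and ?E = "{E. E facet_of Q}"
  have fV: "finite ?V" by (simp add: Q(1) finite_polyhedron_extreme_points polytope_imp_polyhedron)
  have fE: "finite ?E" by (rule finite_polytope_facets[OF Q(1)])
  have "\<exists>E E'. E \<noteq> E' \<and> {E. E facet_of Q \<and> x \<in> E} = {E, E'}" if "x extreme_point_of Q" for x
    using card_edges_at_vertex[OF Q(1,2) that] by (auto simp: card_2_iff)
  then obtain e\<^sub>0 e\<^sub>1 where e:
    "\<And>x. x extreme_point_of Q \<Longrightarrow> e\<^sub>0 x \<noteq> e\<^sub>1 x \<and> {E. E facet_of Q \<and> x \<in> E} = {e\<^sub>0 x, e\<^sub>1 x}"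
    by metis
  have swap: "(\<Sum>x\<in>?V. g (e\<^sub>0 x) + g (e\<^sub>1 x)) = (\<Sum>E\<in>?E. of_nat 2 * g E)"
    for g :: "_ \<Rightarrow> 'b::comm_semiring_1"
  proof -
    have "(\<Sum>x\<in>?V. g (e\<^sub>0 x) + g (e\<^sub>1 x)) = (\<Sum>x\<in>?V. \<Sum>E | E \<in> ?E \<and> x \<in> E. g E)"
      using e by (intro sum.cong) auto
    also have "\<dots> = (\<Sum>E\<in>?E. \<Sum>x | x \<in> ?V \<and> x \<in> E. g E)"
      using fV fE by (rule sum.swap_restrict)
    also have "\<dots> = (\<Sum>E\<in>?E. of_nat 2 * g E)"
      using card_vertices_of_edge[OF Q(1,2)] by (intro sum.cong) auto
    finally show ?thesis .
  qed
  have "card ?V = k"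
    using swap[of "\<lambda>_. 1::nat"] Q(3) by simp
  moreover have "(\<Sum>x\<in>?V. f (e\<^sub>0 x) + f (e\<^sub>1 x)) = (0::bit)" for f
    using swap[of f] by simp
  ultimately show ?thesis using that e by blast
qed

section \<open>Determinants over the vertices of a product of polygons\<close>

text \<open>
  The terms by which the two sides differ are \<open>B (w (e\<^sub>0 x)) u + B (w (e\<^sub>1 x)) u\<close>, because \<open>B\<close> is
  symmetric in characteristic 2. Their sum is of the form that vanishes by assumption.
\<close>

lemma sum_shift_invariant:
  fixes B :: "'v::ab_semigroup_add \<Rightarrow> 'v \<Rightarrow> bit"
  assumes addl: "\<And>x y z. B (x + y) z = B x z + B y z"
    and addr: "\<And>x y z. B x (y + z) = B x y + B x z"
    and alt: "\<And>x. B x x = 0"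
    and even: "\<And>f. (\<Sum>x\<in>V. f (e\<^sub>0 x) + f (e\<^sub>1 x)) = (0::bit)"
  shows "(\<Sum>x\<in>V. B (w (e\<^sub>0 x) + u) (w (e\<^sub>1 x) + u)) = (\<Sum>x\<in>V. B (w (e\<^sub>0 x)) (w (e\<^sub>1 x)))"
proof -
  have sym: "B x y = B y x" for x y
  proof -
    have "(B x x + B y x) + (B x y + B y y) = 0"
      using alt[of "x + y"] by (simp only: addl addr)
    then have "B y x + B x y = 0" by (simp only: alt add_0 add_0_right)
    then show ?thesis by (simp only: bit_add_eq_0_iff)
  qed
  have expand: "B (p + u) (q + u) = B p q + (B p u + B q u)" for p q
    by (simp only: addl addr alt sym[of u q] add_0_right) (simp only: add_ac)
  have "(\<Sum>x\<in>V. B (w (e\<^sub>0 x) + u) (w (e\<^sub>1 x) + u))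
      = (\<Sum>x\<in>V. B (w (e\<^sub>0 x)) (w (e\<^sub>1 x)) + (B (w (e\<^sub>0 x)) u + B (w (e\<^sub>1 x)) u))"
    by (simp only: expand)
  also have "\<dots> = (\<Sum>x\<in>V. B (w (e\<^sub>0 x)) (w (e\<^sub>1 x)))"
    unfolding sum.distrib[of "\<lambda>x. B (w (e\<^sub>0 x)) (w (e\<^sub>1 x))"] by (subst even) simp
  finally show ?thesis .
qed

lemma sum_fun_coordinate:
  fixes V :: "'n::finite \<Rightarrow> 'v set"
  assumes "\<And>j. finite (V j)"
  shows "(\<Sum>v\<in>Pi\<^sub>E UNIV V. f v) = (\<Sum>g\<in>Pi\<^sub>E (UNIV - {j}) V. \<Sum>x\<in>V j. f (g(j := x)))"
proof -
  have *: "Pi\<^sub>E UNIV V = (\<lambda>(x, g). g(j := x)) ` (V j \<times> Pi\<^sub>E (UNIV - {j}) V)"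
    using PiE_insert_eq[of j "UNIV - {j}" V] by (simp add: insert_UNIV)
  have "inj_on (\<lambda>(x, g). g(j := x)) (V j \<times> Pi\<^sub>E (UNIV - {j}) V)"
    by (rule inj_combinator) simp
  then have "(\<Sum>v\<in>Pi\<^sub>E UNIV V. f v) = (\<Sum>(x,g)\<in>V j \<times> Pi\<^sub>E (UNIV - {j}) V. f (g(j := x)))"
    unfolding * by (subst sum.reindex) (auto simp: case_prod_unfold o_def)
  also have "\<dots> = (\<Sum>x\<in>V j. \<Sum>g\<in>Pi\<^sub>E (UNIV - {j}) V. f (g(j := x)))"
    by (simp add: sum.cartesian_product)
  finally show ?thesis by (subst sum.swap)
qed

text \<open>
  The two rows with indices \<open>(j, False)\<close> and \<open>(j, True)\<close> belong to the two edges of the \<open>j\<close>-th polygon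
  that meet in the chosen vertex.
\<close>

definition pair_det ::
  "('k \<Rightarrow> 'n \<times> bool) \<Rightarrow> ('n \<Rightarrow> bool \<Rightarrow> bit ^ 'k) \<Rightarrow> bit" where
  "pair_det \<beta> z = det (\<chi> r. z (fst (\<beta> r)) (snd (\<beta> r)))"

lemma pair_det_add:
  assumes "bij \<beta>"
  shows "pair_det \<beta> (z(j := (z j)(c := x + y))) =
    pair_det \<beta> (z(j := (z j)(c := x))) + pair_det \<beta> (z(j := (z j)(c := y)))"
proof -
  obtain r0 where r0: "\<beta> r0 = (j, c)" using assms by (metis bij_pointE)
  have r: "r = r0 \<longleftrightarrow> \<beta> r = (j, c)" for r
    using assms r0 by (metis bij_pointE)
  have *: "(\<chi> r. (z(j := (z j)(c := w))) (fst (\<beta> r)) (snd (\<beta> r))) =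
      (\<chi> r. if r = r0 then w else z (fst (\<beta> r)) (snd (\<beta> r)))" for w
    by (auto simp: vec_eq_iff r prod_eq_iff)
  show ?thesis unfolding pair_det_def * by (rule det_row_add)
qed

lemma pair_det_alternating:
  assumes "bij \<beta>" "z j False = z j True"
  shows "pair_det \<beta> z = 0"
proof -
  obtain r0 r1 where "\<beta> r0 = (j, False)" "\<beta> r1 = (j, True)" using assms by (metis bij_pointE)
  then show ?thesis unfolding pair_det_def
    by (intro det_identical_rows[of r0 r1]) (auto simp: row_def assms(2))
qed

text \<open>
  The shift is performed in one polygon after another. As a function of the two rows of the \<open>j\<close>-th
  polygon the determinant is an alternating bilinear form, so that \<open>sum_shift_invariant\<close> applies to
  the sum over the vertices of this polygon.
\<close>

lemma sum_pair_det_shift: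
  fixes V :: "'n::finite \<Rightarrow> 'v set" and e :: "'n \<Rightarrow> bool \<Rightarrow> 'v \<Rightarrow> 'w"
  assumes \<beta>: "bij (\<beta> :: 'k::finite \<Rightarrow> 'n \<times> bool)"
    and fin: "\<And>j. finite (V j)"
    and even: "\<And>j f. (\<Sum>x\<in>V j. f (e j False x) + f (e j True x)) = (0::bit)"
  shows "(\<Sum>v\<in>Pi\<^sub>E UNIV V. pair_det \<beta> (\<lambda>j c. w j (e j c (v j)) + u)) =
         (\<Sum>v\<in>Pi\<^sub>E UNIV V. pair_det \<beta> (\<lambda>j c. w j (e j c (v j))))"
proof -
  define s where "s J v j c = (if j \<in> J then w j (e j c (v j)) + u else w j (e j c (v j)))"
    for J :: "'n set" and v :: "'n \<Rightarrow> 'v" and j c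
  have "(\<Sum>v\<in>Pi\<^sub>E UNIV V. pair_det \<beta> (s J v)) = (\<Sum>v\<in>Pi\<^sub>E UNIV V. pair_det \<beta> (s {} v))"
    if "finite J" for J
    using that
  proof (induction J)
    case (insert j J)
    have "(\<Sum>x\<in>V j. pair_det \<beta> (s (insert j J) (g(j := x)))) =
          (\<Sum>x\<in>V j. pair_det \<beta> (s J (g(j := x))))" for g
    proof -
      define h where "h = s J g j"
      define B where "B x y = pair_det \<beta> ((s J g)(j := h(False := x, True := y)))" for x y
      have addr: "B z (x + y) = B z x + B z y" for x y z
        using pair_det_add[OF \<beta>, of "(s J g)(j := h(False := z))" j True x y]
        unfolding B_def by (simp only: fun_upd_same fun_upd_upd)
      have addl: "B (x + y) z = B x z + B y z" for x y z
        using pair_det_add[OF \<beta>, of "(s J g)(j := h(True := z))" j False x y]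
        unfolding B_def fun_upd_twist[of False True h, OF False_not_True]
        by (simp only: fun_upd_same fun_upd_upd)
      have alt: "B x x = 0" for x
        unfolding B_def by (rule pair_det_alternating[OF \<beta>, of _ j]) simp
      have 1: "s (insert j J) (g(j := x)) =
          (s J g)(j := h(False := w j (e j False x) + u, True := w j (e j True x) + u))" for x
        by (auto simp: s_def fun_eq_iff)
      have 2: "s J (g(j := x)) =
          (s J g)(j := h(False := w j (e j False x), True := w j (e j True x)))" for x
        using insert(2) by (auto simp: s_def fun_eq_iff)
      have "(\<Sum>x\<in>V j. B (w j (e j False x) + u) (w j (e j True x) + u)) =
          (\<Sum>x\<in>V j. B (w j (e j False x)) (w j (e j True x)))"
        by (rule sum_shift_invariant[OF addl addr alt even])
      then show ?thesis by (simp only: 1 2 B_def)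
    qed
    then have "(\<Sum>v\<in>Pi\<^sub>E UNIV V. pair_det \<beta> (s (insert j J) v)) =
          (\<Sum>v\<in>Pi\<^sub>E UNIV V. pair_det \<beta> (s J v))"
      by (simp only: sum_fun_coordinate[where V = V and j = j, OF fin])
    then show ?case using insert by simp
  qed simp
  from this[of UNIV] show ?thesis by (simp add: s_def[abs_def])
qed

lemma det_nonzero_if_rows_independent:
  fixes A :: "'a::field ^ 'k ^ 'k"
  assumes inj: "inj (\<lambda>r. A $ r)" and ind: "vec.independent (range (\<lambda>r. A $ r))"
  shows "det A \<noteq> 0"
proof -
  have "c r = 0" if "(\<Sum>r\<in>UNIV. c r *s row r A) = 0" for c r
  proof -
    define d where "d = c \<circ> inv (\<lambda>r. A $ r)"
    have dr: "d (A $ r) = c r" for r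
      using inv_f_f[OF inj, of r] by (simp add: d_def)
    have "(\<Sum>v\<in>range (\<lambda>r. A $ r). d v *s v) = (\<Sum>r\<in>UNIV. d (A $ r) *s A $ r)"
      using sum.reindex[OF inj, of "\<lambda>v. d v *s v"] by (simp add: o_def)
    also have "\<dots> = 0" using that by (simp add: dr row_def vec_nth_inverse)
    finally have "d (A $ r) = 0"
      using vec.independentD[OF ind, of "range (\<lambda>r. A $ r)" d "A $ r"] by simp
    then show ?thesis by (simp add: dr)
  qed
  then have "\<exists>B. A ** B = mat 1"
    unfolding matrix_right_invertible_independent_rows by blast
  then show ?thesis by (metis invertible_det_nz invertible_right_inverse)
qed

definition parity :: "bit ^ 'm::finite \<Rightarrow> bit" where
  "parity h = (\<Sum>j\<in>UNIV. h $ j)"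

lemma parity_add: "parity (g + h) = parity g + parity h"
  unfolding parity_def sum.distrib[symmetric]
  by (rule sum.cong[OF refl]) (rule vector_add_component)

lemma parity_scale: "parity (c *s h) = c * parity h"
  unfolding parity_def sum_distrib_left
  by (rule sum.cong[OF refl]) (rule vector_smult_component)

lemma parity_zero: "parity 0 = 0"
  by (simp add: parity_def)

lemma parity_axis: "parity (axis k 1) = 1"
  by (simp add: parity_def axis_def)

text \<open>
  Summed over the odd number of vertices, the determinants, all equal to 1, give 1. They still do so after
  a shift by \<open>u = lam (axis i\<^sub>0 1)\<close>, so that the shifted rows of some vertex span the whole space. Each of
  them is the image of a sum of two basis vectors, hence \<open>u\<close> is the image of a vector of even
  weight.
\<close>

lemma exists_odd_kernel_vector:
  fixes lam :: "bit ^ 'm::finite \<Rightarrow> bit ^ 'k::finite" and V :: "'n::finite \<Rightarrow> 'v set"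
    and i :: "'n \<Rightarrow> 'w \<Rightarrow> 'm" and e :: "'n \<Rightarrow> bool \<Rightarrow> 'v \<Rightarrow> 'w"
  assumes lin: "Vector_Spaces.linear (*s) (*s) lam"
    and \<beta>: "bij (\<beta> :: 'k \<Rightarrow> 'n \<times> bool)"
    and fin: "\<And>j. finite (V j)" and odd: "\<And>j. odd (card (V j))"
    and even: "\<And>j f. (\<Sum>x\<in>V j. f (e j False x) + f (e j True x)) = (0::bit)"
    and vertex: "\<And>v. v \<in> Pi\<^sub>E UNIV V \<Longrightarrow>
      inj (\<lambda>(j, c). lam (axis (i j (e j c (v j))) 1)) \<and>
      vec.independent (range (\<lambda>(j, c). lam (axis (i j (e j c (v j))) 1)))"
  shows "\<exists>h. lam h = 0 \<and> parity h = 1"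
proof -
  interpret lam: Vector_Spaces.linear "(*s)" "(*s)" lam by (rule lin)
  define i\<^sub>0 :: 'm where "i\<^sub>0 = undefined"
  define w where "w j E = lam (axis (i j E) 1)" for j E
  define u where "u = lam (axis i\<^sub>0 1)"
  have one: "pair_det \<beta> (\<lambda>j c. w j (e j c (v j))) = 1" if "v \<in> Pi\<^sub>E UNIV V" for v
  proof -
    let ?A = "(\<chi> r. w (fst (\<beta> r)) (e (fst (\<beta> r)) (snd (\<beta> r)) (v (fst (\<beta> r))))) :: bit ^ 'k ^ 'k"
    have *: "(\<lambda>r. ?A $ r) = (\<lambda>(j, c). lam (axis (i j (e j c (v j))) 1)) \<circ> \<beta>"
      by (auto simp: w_def fun_eq_iff split_beta)
    have "inj (\<lambda>r. ?A $ r)"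
      unfolding * using vertex[OF that] \<beta> by (intro inj_compose) (auto simp: bij_def)
    moreover have "range (\<lambda>r. ?A $ r) = range (\<lambda>(j, c). lam (axis (i j (e j c (v j))) 1))"
      unfolding * image_comp[symmetric] using \<beta> by (simp add: bij_def)
    ultimately have "det ?A \<noteq> 0"
      using det_nonzero_if_rows_independent[of ?A] vertex[OF that] by metis
    then show ?thesis by (simp add: pair_det_def)
  qed
  have "(\<Sum>v\<in>Pi\<^sub>E UNIV V. pair_det \<beta> (\<lambda>j c. w j (e j c (v j)) + u)) =
      (\<Sum>v\<in>Pi\<^sub>E UNIV V. pair_det \<beta> (\<lambda>j c. w j (e j c (v j))))"
    by (rule sum_pair_det_shift[OF \<beta> fin even])
  also have "\<dots> = of_nat (card (Pi\<^sub>E UNIV V))" using one by simp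
  also have "\<dots> = 1"
  proof -
    have "odd (card (Pi\<^sub>E UNIV V))"
      by (simp add: card_PiE even_prod_iff odd)
    then show ?thesis by (auto elim!: oddE)
  qed
  finally have "(\<Sum>v\<in>Pi\<^sub>E UNIV V. pair_det \<beta> (\<lambda>j c. w j (e j c (v j)) + u)) \<noteq> 0" by simp
  then obtain v where v: "pair_det \<beta> (\<lambda>j c. w j (e j c (v j)) + u) \<noteq> 0"
    by (metis (mono_tags, lifting) sum.neutral)
  define A where "A = ((\<chi> r. w (fst (\<beta> r)) (e (fst (\<beta> r)) (snd (\<beta> r)) (v (fst (\<beta> r)))) + u) :: bit ^ 'k ^ 'k)"
  have "det A \<noteq> 0" using v by (simp add: pair_det_def A_def)
  then have "\<exists>B. B ** A = mat 1" by (metis invertible_det_nz invertible_left_inverse)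
  then have span: "vec.span (rows A) = UNIV" by (simp add: matrix_left_invertible_span_rows_gen)
  let ?T = "lam ` {h. parity h = 0}"
  have "vec.subspace {h :: bit ^ 'm. parity h = 0}"
    by (rule vec.subspaceI) (simp_all only: mem_Collect_eq parity_zero parity_add parity_scale
        add_0 mult_zero_right)
  then have sub: "vec.subspace ?T" by (rule lam.subspace_image)
  have "rows A \<subseteq> ?T"
  proof
    fix y assume "y \<in> rows A"
    then obtain r where "y = A $ r" by (auto simp: rows_def row_def)
    then obtain k where y: "y = lam (axis k 1 + axis i\<^sub>0 1)"
      by (auto simp: A_def w_def u_def lam.add)
    have "parity (axis k 1 + axis i\<^sub>0 1 :: bit ^ 'm) = 0"
      by (simp only: parity_add parity_axis bit_double)
    then show "y \<in> ?T" using y by blast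
  qed
  then have "u \<in> ?T" using vec.span_minimal[OF _ sub] span by blast
  then obtain h where h: "lam h = u" "parity h = 0" by auto
  have "u + u = 0" by (simp add: vec_eq_iff)
  then have "lam (axis i\<^sub>0 1 + h) = 0" by (simp only: lam.add h(1) u_def)
  moreover have "parity (axis i\<^sub>0 1 + h) = 1"
    by (simp only: parity_add parity_axis h(2) add_0_right)
  ultimately show ?thesis by blast
qed

section \<open>Pfaffians of alternating forms\<close>

text \<open>
  Up to the factor \<open>2\<^sup>n n!\<close> this is the Pfaffian of the Gram matrix of \<open>\<omega>\<close>; the bijection \<open>\<iota>\<close>
  arranges the standard basis in pairs.
\<close>

definition pfaffian ::
  "('n \<times> bool \<Rightarrow> 'k::finite) \<Rightarrow> (real ^ 'k \<Rightarrow> real ^ 'k \<Rightarrow> real) \<Rightarrow> real" where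
  "pfaffian \<iota> \<omega> = (\<Sum>p | p permutes UNIV. of_int (sign p) *
     (\<Prod>j\<in>UNIV. \<omega> (axis (p (\<iota> (j, False))) 1) (axis (p (\<iota> (j, True))) 1)))"

lemma prod_pairs:
  fixes \<iota> :: "'n::finite \<times> bool \<Rightarrow> 'k::finite" and f :: "'k \<Rightarrow> 'b::comm_monoid_mult"
  assumes "bij \<iota>"
  shows "(\<Prod>k\<in>UNIV. f k) = (\<Prod>j\<in>UNIV. f (\<iota> (j, False)) * f (\<iota> (j, True)))"
proof -
  have "(\<Prod>k\<in>UNIV. f k) = (\<Prod>x\<in>UNIV. f (\<iota> x))"
    using prod.reindex_bij_betw[OF assms, of f] by simp
  also have "\<dots> = (\<Prod>(j, c)\<in>UNIV \<times> UNIV. f (\<iota> (j, c)))" by (simp add: case_prod_unfold)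
  also have "\<dots> = (\<Prod>j\<in>UNIV. \<Prod>c\<in>UNIV. f (\<iota> (j, c)))" by (simp add: prod.cartesian_product)
  finally show ?thesis by (simp add: UNIV_bool)
qed

lemma det_rows_function:
  fixes A :: "'a::comm_ring_1 ^ 'k::finite ^ 'k"
  shows "det (\<chi> k. A $ \<rho> k) = (if \<rho> permutes UNIV then of_int (sign \<rho>) * det A else 0)"
proof (cases "inj \<rho>")
  case True
  then have "\<rho> permutes UNIV"
    by (intro bij_imp_permutes) (simp_all add: bij_def finite_UNIV_inj_surj)
  then show ?thesis using det_permute_rows[of \<rho> A] by simp
next
  case False
  then obtain x y where "\<rho> x = \<rho> y" "x \<noteq> y" by (auto simp: inj_def)
  then have "det (\<chi> k. A $ \<rho> k) = 0" by (intro det_identical_rows[of x y]) (auto simp: row_def)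
  moreover have "\<not> \<rho> permutes UNIV" using False permutes_inj by blast
  ultimately show ?thesis by simp
qed

text \<open>
  Expanding every entry by bilinearity gives a sum over all maps \<open>\<rho>\<close> of the index set into itself
  of \<open>det (\<chi> k. A $ \<rho> k)\<close> times the term of \<open>\<rho>\<close>. Only the permutations contribute.
\<close>

lemma pfaffian_pullback:
  fixes \<iota> :: "'n::finite \<times> bool \<Rightarrow> 'k::finite"
  assumes \<iota>: "bij \<iota>" and bil: "bilinear \<omega>"
  shows "pfaffian \<iota> (\<lambda>v w. \<omega> (A *v v) (A *v w)) = det A * pfaffian \<iota> \<omega>"
proof -
  define ent where "ent r s = \<omega> (axis r 1) (axis s 1)" for r s
  define M where "M \<rho> = (\<Prod>j\<in>UNIV. ent (\<rho> (\<iota> (j, False))) (\<rho> (\<iota> (j, True))))" for \<rho> :: "'k \<Rightarrow> 'k"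
  have col: "A *v axis a 1 = (\<Sum>r\<in>UNIV. A $ r $ a *\<^sub>R axis r 1)" for a
    unfolding matrix_vector_mult_basis
    by (simp add: vec_eq_iff column_def axis_def if_distrib cong: if_cong)
  have expand: "\<omega> (A *v axis a 1) (A *v axis b 1) = (\<Sum>(r, s)\<in>UNIV. A $ r $ a * A $ s $ b * ent r s)" for a b
    unfolding col bilinear_sum[OF bil] ent_def
    by (simp add: bilinear_lmul[OF bil] bilinear_rmul[OF bil] mult_ac case_prod_unfold)
  define \<Phi> where "\<Phi> \<rho> = (\<lambda>j. (\<rho> (\<iota> (j, False)), \<rho> (\<iota> (j, True))))" for \<rho> :: "'k \<Rightarrow> 'k"
  have \<Phi>: "bij \<Phi>"
  proof (rule bijI)
    show "inj \<Phi>"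
    proof (rule injI)
      fix \<rho> \<rho>' assume "\<Phi> \<rho> = \<Phi> \<rho>'"
      then have "\<rho> (\<iota> (j, c)) = \<rho>' (\<iota> (j, c))" for j c
        by (cases c) (auto simp: \<Phi>_def fun_eq_iff)
      then have "\<rho> (\<iota> x) = \<rho>' (\<iota> x)" for x by (cases x) simp
      then show "\<rho> = \<rho>'" using \<iota> by (metis bij_pointE ext)
    qed
    show "surj \<Phi>"
    proof (rule surjI)
      fix f :: "'n \<Rightarrow> 'k \<times> 'k"
      show "\<Phi> (\<lambda>x. if snd (inv \<iota> x) then snd (f (fst (inv \<iota> x))) else fst (f (fst (inv \<iota> x)))) = f"
        using \<iota> by (simp add: \<Phi>_def fun_eq_iff bij_is_inj inv_f_f)
    qed
  qed
  have pullback: "(\<Prod>j\<in>UNIV. \<omega> (A *v axis (p (\<iota> (j, False))) 1) (A *v axis (p (\<iota> (j, True))) 1))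
      = (\<Sum>\<rho>\<in>UNIV. (\<Prod>k\<in>UNIV. A $ \<rho> k $ p k) * M \<rho>)" for p
  proof -
    define g where "g j = (\<lambda>(r, s). A $ r $ p (\<iota> (j, False)) * A $ s $ p (\<iota> (j, True)) * ent r s)" for j
    have "(\<Prod>j\<in>UNIV. \<omega> (A *v axis (p (\<iota> (j, False))) 1) (A *v axis (p (\<iota> (j, True))) 1))
        = (\<Prod>j\<in>UNIV. \<Sum>x\<in>UNIV. g j x)"
      by (simp only: expand g_def)
    also have "\<dots> = (\<Sum>f\<in>UNIV. \<Prod>j\<in>UNIV. g j (f j))"
      using prod_sum_PiE[of "UNIV :: 'n set" "\<lambda>_. UNIV" g] by (simp add: PiE_UNIV_domain)
    also have "\<dots> = (\<Sum>\<rho>\<in>UNIV. \<Prod>j\<in>UNIV. g j (\<Phi> \<rho> j))"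
      using sum.reindex_bij_betw[OF \<Phi>, of "\<lambda>f. \<Prod>j\<in>UNIV. g j (f j)"] by simp
    also have "\<dots> = (\<Sum>\<rho>\<in>UNIV. (\<Prod>k\<in>UNIV. A $ \<rho> k $ p k) * M \<rho>)"
      unfolding M_def prod_pairs[OF \<iota>] prod.distrib[symmetric] by (simp add: \<Phi>_def g_def)
    finally show ?thesis .
  qed
  have "pfaffian \<iota> (\<lambda>v w. \<omega> (A *v v) (A *v w)) =
      (\<Sum>p | p permutes UNIV. \<Sum>\<rho>\<in>UNIV. of_int (sign p) * ((\<Prod>k\<in>UNIV. A $ \<rho> k $ p k) * M \<rho>))"
    unfolding pfaffian_def pullback sum_distrib_left ..
  also have "\<dots> = (\<Sum>\<rho>\<in>UNIV. \<Sum>p | p permutes UNIV. of_int (sign p) * ((\<Prod>k\<in>UNIV. A $ \<rho> k $ p k) * M \<rho>))"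
    by (rule sum.swap)
  also have "\<dots> = (\<Sum>\<rho>\<in>UNIV. det (\<chi> k. A $ \<rho> k) * M \<rho>)"
    by (simp add: det_def sum_distrib_right mult.assoc)
  also have "\<dots> = (\<Sum>\<rho>\<in>UNIV. if \<rho> permutes UNIV then of_int (sign \<rho>) * det A * M \<rho> else 0)"
    by (intro sum.cong refl) (simp add: det_rows_function)
  also have "\<dots> = (\<Sum>\<rho> | \<rho> permutes UNIV. of_int (sign \<rho>) * det A * M \<rho>)"
    by (simp add: sum.If_cases)
  also have "\<dots> = det A * pfaffian \<iota> \<omega>"
    by (simp add: pfaffian_def M_def ent_def sum_distrib_left mult_ac)
  finally show ?thesis .
qed

text \<open>
  The symplectic Gram-Schmidt process. For the next pair, a vector \<open>v\<close> that is orthogonal to the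
  pairs found so far exists by counting dimensions; a partner \<open>w\<close> of \<open>v\<close> is made orthogonal to
  them by subtracting its projection.
\<close>

lemma symplectic_pairs:
  fixes \<omega> :: "real ^ 'k \<Rightarrow> real ^ 'k \<Rightarrow> real" and \<iota> :: "'n::finite \<times> bool \<Rightarrow> 'k::finite"
  assumes \<iota>: "bij \<iota>" and bil: "bilinear \<omega>" and alt: "\<And>v. \<omega> v v = 0"
    and nondeg: "\<And>v. v \<noteq> 0 \<Longrightarrow> \<exists>w. \<omega> v w \<noteq> 0"
    and "finite T"
  shows "\<exists>a b. \<forall>i\<in>T. \<forall>j\<in>T. \<omega> (a i) (a j) = 0 \<and> \<omega> (b i) (b j) = 0 \<and>
    \<omega> (a i) (b j) = of_bool (i = (j::'n))"
  using \<open>finite T\<close>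
proof (induction T)
  case (insert t T)
  then obtain a b where ab: "\<forall>i\<in>T. \<forall>j\<in>T. \<omega> (a i) (a j) = 0 \<and> \<omega> (b i) (b j) = 0 \<and>
    \<omega> (a i) (b j) = of_bool (i = j)" by blast
  note bilin = bilinear_ladd[OF bil] bilinear_radd[OF bil] bilinear_lmul[OF bil] bilinear_rmul[OF bil]
    bilinear_lsub[OF bil] bilinear_rsub[OF bil]
  have skew: "\<omega> x y = - \<omega> y x" for x y
    using alt[of "x + y"] alt[of x] alt[of y] by (simp add: bilin(1,2))
  \<comment> \<open>The components of \<open>L v\<close> are the products of \<open>v\<close> with the vectors found so far, and 0 for the
    indices that are still free.\<close>
  define L where "L v = (\<chi> k. let (j, c) = inv \<iota> k in
      if j \<in> T then \<omega> v (if c then b j else a j) else 0)" for v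
  have linL: "linear L"
    by (rule linearI) (auto simp: L_def vec_eq_iff bilin split_beta Let_def)
  have Lt: "L v $ \<iota> (t, False) = 0" for v
    using insert(2) \<iota> by (simp add: L_def bij_is_inj)
  have "\<not> surj L"
  proof
    assume "surj L"
    then obtain v where "L v = axis (\<iota> (t, False)) 1" by (metis surjD)
    then show False using Lt[of v] by simp
  qed
  then have "\<not> inj L" using linear_injective_imp_surjective[OF linL] by blast
  then obtain v where v: "v \<noteq> 0" "L v = 0"
    using linear_injective_0[OF linL] by blast
  have va: "\<omega> v (a j) = 0" if "j \<in> T" for j
    using arg_cong[OF v(2), of "\<lambda>x. x $ \<iota> (j, False)"] that \<iota> by (simp add: L_def bij_is_inj)
  have vb: "\<omega> v (b j) = 0" if "j \<in> T" for j
    using arg_cong[OF v(2), of "\<lambda>x. x $ \<iota> (j, True)"] that \<iota> by (simp add: L_def bij_is_inj)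
  obtain w where w: "\<omega> v w \<noteq> 0" using nondeg v(1) by blast
  define w' where "w' = w - (\<Sum>j\<in>T. \<omega> (a j) w *\<^sub>R b j) + (\<Sum>j\<in>T. \<omega> (b j) w *\<^sub>R a j)"
  have lin: "linear (\<omega> x)" for x using bil by (simp add: bilinear_def)
  have w'_eq: "\<omega> x w' = \<omega> x w - (\<Sum>j\<in>T. \<omega> (a j) w * \<omega> x (b j)) + (\<Sum>j\<in>T. \<omega> (b j) w * \<omega> x (a j))" for x
    unfolding w'_def by (simp add: bilin linear_sum[OF lin])
  have aw': "\<omega> (a i) w' = 0" if "i \<in> T" for i
  proof -
    have "(\<Sum>j\<in>T. \<omega> (a j) w * \<omega> (a i) (b j)) = (\<Sum>j\<in>T. if i = j then \<omega> (a j) w else 0)"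
      using ab that by (intro sum.cong) auto
    moreover have "(\<Sum>j\<in>T. \<omega> (b j) w * \<omega> (a i) (a j)) = 0"
      using ab that by (intro sum.neutral) auto
    ultimately show ?thesis using that insert(1) by (simp add: w'_eq)
  qed
  have bw': "\<omega> (b i) w' = 0" if "i \<in> T" for i
  proof -
    have "\<omega> (b i) (a j) = - of_bool (i = j)" if "j \<in> T" for j
      using ab that \<open>i \<in> T\<close> skew[of "b i" "a j"] by auto
    then have "(\<Sum>j\<in>T. \<omega> (b j) w * \<omega> (b i) (a j)) = (\<Sum>j\<in>T. if i = j then - \<omega> (b j) w else 0)"
      by (intro sum.cong) auto
    moreover have "(\<Sum>j\<in>T. \<omega> (a j) w * \<omega> (b i) (b j)) = 0"
      using ab that by (intro sum.neutral) auto
    ultimately show ?thesis using that insert(1) by (simp add: w'_eq)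
  qed
  have vw': "\<omega> v w' = \<omega> v w" by (simp add: w'_eq va vb)
  define a' where "a' = a(t := v)"
  define b' where "b' = b(t := w' /\<^sub>R \<omega> v w)"
  have ne: "j \<noteq> t" if "j \<in> T" for j using that insert(2) by blast
  have "\<omega> (a i) v = 0" "\<omega> (b i) v = 0" "\<omega> w' (b i) = 0" if "i \<in> T" for i
    using va[OF that] vb[OF that] bw'[OF that] skew[of "a i" v] skew[of "b i" v] skew[of w' "b i"]
    by simp_all
  then have "\<forall>i\<in>insert t T. \<forall>j\<in>insert t T. \<omega> (a' i) (a' j) = 0 \<and> \<omega> (b' i) (b' j) = 0 \<and>
    \<omega> (a' i) (b' j) = of_bool (i = j)"
    using ab va vb aw' bw' vw' w alt insert.hyps(2) by (auto simp: a'_def b'_def bilin)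
  then show ?case by blast
qed simp

lemma permutation_finite: "bij p \<Longrightarrow> permutation (p :: 'a::finite \<Rightarrow> 'a)"
  unfolding permutation_permutes by (intro exI[of _ UNIV]) (auto intro: bij_imp_permutes)

text \<open>
  The permutation acts on the two copies of \<open>'n\<close> by conjugate permutations, so its sign is a square.
\<close>

lemma sign_on_pairs_of_lift:
  fixes r :: "'n::finite \<Rightarrow> 'n"
  assumes "bij r"
  shows "sign (\<lambda>(j, c :: bool). (r j, c)) = 1"
proof -
  define \<rho> where "\<rho> b = (\<lambda>(j, c). (if c = b then r j else j, c))" for b :: bool
  define flip :: "'n \<times> bool \<Rightarrow> 'n \<times> bool" where "flip = (\<lambda>(j, c). (j, \<not> c))"
  have "inj (\<rho> b)" for b
  proof (rule injI, clarify)
    fix j c j' c' assume "\<rho> b (j, c) = \<rho> b (j', c')"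
    then show "j = j' \<and> c = c'"
      using injD[OF bij_is_inj[OF assms], of j j'] by (simp add: \<rho>_def split: if_splits)
  qed
  then have \<rho>: "permutation (\<rho> b)" for b
    by (intro permutation_finite) (simp add: bij_def finite_UNIV_inj_surj)
  have "inj flip" by (auto simp: inj_def flip_def)
  then have flip: "permutation flip"
    by (intro permutation_finite) (simp add: bij_def finite_UNIV_inj_surj)
  have 1: "(\<lambda>(j, c :: bool). (r j, c)) = \<rho> False \<circ> \<rho> True"
    by (auto simp: \<rho>_def fun_eq_iff)
  have "\<rho> True = flip \<circ> (\<rho> False \<circ> flip)"
    by (auto simp: \<rho>_def flip_def fun_eq_iff)
  then have "sign (\<rho> True) = sign flip * (sign (\<rho> False) * sign flip)"
    by (simp add: sign_compose flip \<rho> permutation_compose)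
  also have "\<dots> = sign (\<rho> False)"
    by (simp add: mult.left_commute mult.commute)
  finally show ?thesis unfolding 1 by (simp add: sign_compose \<rho>)
qed

lemma sign_of_flips:
  assumes "finite C"
  shows "sign (\<lambda>(j :: 'n::finite, c). (j, c \<noteq> (j \<in> C))) = (- 1) ^ card C \<and>
    permutation (\<lambda>(j :: 'n, c). (j, c \<noteq> (j \<in> C)))"
  using assms
proof (induction C)
  case empty
  have "(\<lambda>(j :: 'n, c). (j, c \<noteq> (j \<in> {}))) = id" by auto
  then show ?case by simp
next
  case (insert i C)
  have *: "(\<lambda>(j, c). (j, c \<noteq> (j \<in> insert i C))) =
      Transposition.transpose (i, False) (i, True) \<circ> (\<lambda>(j, c). (j, c \<noteq> (j \<in> C)))"
    using insert(2) by (auto simp: fun_eq_iff Transposition.transpose_def)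
  show ?case
    unfolding * using insert
    by (auto simp del: o_apply simp: sign_compose[OF permutation_swap_id]
        permutation_compose[OF permutation_swap_id] sign_swap_id)
qed

text \<open>
  Such a permutation maps pairs to pairs. It is the composition of swaps inside some of the pairs
  with a permutation of the pairs, and the latter is even.
\<close>

lemma sign_commuting_with_flip:
  fixes \<tau> :: "'n::finite \<times> bool \<Rightarrow> 'n \<times> bool"
  assumes \<tau>: "bij \<tau>" and pair: "\<And>j. fst (\<tau> (j, False)) = fst (\<tau> (j, True)) \<and> snd (\<tau> (j, False)) \<noteq> snd (\<tau> (j, True))"
  shows "sign \<tau> = (\<Prod>j\<in>UNIV. if snd (\<tau> (j, False)) then - 1 else 1)"
proof -
  define r where "r j = fst (\<tau> (j, False))" for j
  define C where "C = {j. snd (\<tau> (j, False))}"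
  have eq: "\<tau> = (\<lambda>(j, c). (r j, c)) \<circ> (\<lambda>(j, c). (j, c \<noteq> (j \<in> C)))"
  proof (rule ext, clarify)
    fix j c
    show "\<tau> (j, c) = ((\<lambda>(j, c). (r j, c)) \<circ> (\<lambda>(j, c). (j, c \<noteq> (j \<in> C)))) (j, c)"
      using pair[of j] by (cases c) (auto simp: r_def C_def prod_eq_iff)
  qed
  have "surj r"
  proof (rule surjI)
    fix j
    obtain i c where ic: "inv \<tau> (j, False) = (i, c)" by fastforce
    then have "\<tau> (i, c) = (j, False)" using \<tau> by (metis bij_inv_eq_iff)
    then have "r i = j" using pair[of i] by (cases c) (auto simp: r_def)
    then show "r (fst (inv \<tau> (j, False))) = j" by (simp add: ic)
  qed
  then have r: "bij r" by (simp add: bij_def finite_UNIV_surj_inj)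
  have "inj (\<lambda>(j, c :: bool). (r j, c))"
    by (rule injI) (use injD[OF bij_is_inj[OF r]] in auto)
  then have "permutation (\<lambda>(j, c :: bool). (r j, c))"
    by (intro permutation_finite) (simp add: bij_def finite_UNIV_inj_surj)
  then have "sign \<tau> = (- 1) ^ card C"
    using sign_of_flips[of C] sign_on_pairs_of_lift[OF r] unfolding eq by (subst sign_compose) auto
  also have "\<dots> = (\<Prod>j\<in>UNIV. if snd (\<tau> (j, False)) then - 1 else 1)"
    by (simp add: prod.If_cases C_def)
  finally show ?thesis .
qed

text \<open>
  In a symplectic basis the nonzero terms belong to permutations that map pairs to pairs, and the sign of
  the permutation cancels the signs of the entries. So every nonzero term is 1, and the identity
  contributes one.
\<close>

lemma pfaffian_nonzero:
  fixes \<omega> :: "real ^ 'k \<Rightarrow> real ^ 'k \<Rightarrow> real" and \<iota> :: "'n::finite \<times> bool \<Rightarrow> 'k::finite"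
  assumes \<iota>: "bij \<iota>" and bil: "bilinear \<omega>" and alt: "\<And>v. \<omega> v v = 0"
    and nondeg: "\<And>v. v \<noteq> 0 \<Longrightarrow> \<exists>w. \<omega> v w \<noteq> 0"
  shows "pfaffian \<iota> \<omega> \<noteq> 0"
proof -
  obtain a b where "\<forall>i\<in>UNIV. \<forall>j\<in>UNIV. \<omega> (a i) (a j) = 0 \<and> \<omega> (b i) (b j) = 0 \<and>
      \<omega> (a i) (b j) = of_bool (i = (j::'n))"
    using symplectic_pairs[OF assms finite] by blast
  then have ab: "\<omega> (a i) (a j) = 0" "\<omega> (b i) (b j) = 0" "\<omega> (a i) (b j) = of_bool (i = j)" for i j
    by simp_all
  have ba: "\<omega> (b i) (a j) = - of_bool (i = j)" for i j
  proof -
    have "\<omega> (b i) (a j) + \<omega> (a j) (b i) = 0"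
      using alt[of "b i + a j"] alt[of "b i"] alt[of "a j"]
      by (simp add: bilinear_ladd[OF bil] bilinear_radd[OF bil])
    then show ?thesis unfolding ab(3) by (cases "i = j") auto
  qed
  define A :: "real ^ 'k ^ 'k" where
    "A = (\<chi> r k. (if snd (inv \<iota> k) then b else a) (fst (inv \<iota> k)) $ r)"
  have col: "A *v axis k 1 = (if snd (inv \<iota> k) then b else a) (fst (inv \<iota> k))" for k
    unfolding matrix_vector_mult_basis by (simp add: vec_eq_iff column_def A_def)
  let ?t = "\<lambda>p. of_int (sign p) *
     (\<Prod>j\<in>UNIV. \<omega> (A *v axis (p (\<iota> (j, False))) 1) (A *v axis (p (\<iota> (j, True))) 1))"
  have id: "?t id = 1"
    using \<iota> by (simp add: col ab bij_is_inj)
  have nonneg: "?t p \<ge> 0" if p: "p permutes UNIV" for p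
  proof (cases "(\<Prod>j\<in>UNIV. \<omega> (A *v axis (p (\<iota> (j, False))) 1) (A *v axis (p (\<iota> (j, True))) 1)) = 0")
    case False
    define \<tau> where "\<tau> = inv \<iota> \<circ> p \<circ> \<iota>"
    have \<tau>: "bij \<tau>" unfolding \<tau>_def using \<iota> permutes_bij[OF p] by (intro bij_comp) (simp_all add: bij_imp_bij_inv)
    have s: "sign \<tau> = sign p"
    proof -
      have "map_permutation UNIV \<iota> \<tau> = p"
        using \<iota> by (auto simp: map_permutation_def \<tau>_def fun_eq_iff bij_def surj_f_inv_f restrict_id_def)
      moreover have "\<tau> permutes UNIV" using \<tau> by (auto intro: bij_imp_permutes)
      ultimately show ?thesis
        using sign_map_permutation[of \<iota> UNIV \<tau>] \<iota> by (simp add: bij_def)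
    qed
    define f where "f j = \<omega> (A *v axis (p (\<iota> (j, False))) 1) (A *v axis (p (\<iota> (j, True))) 1)" for j
    have f0: "f j \<noteq> 0" for j using False by (auto simp: f_def)
    have f: "f j = \<omega> ((if snd (\<tau> (j, False)) then b else a) (fst (\<tau> (j, False))))
        ((if snd (\<tau> (j, True)) then b else a) (fst (\<tau> (j, True))))" for j
      by (simp add: f_def col \<tau>_def)
    have pair: "fst (\<tau> (j, False)) = fst (\<tau> (j, True)) \<and> snd (\<tau> (j, False)) \<noteq> snd (\<tau> (j, True))" for j
      using f0[of j] by (auto simp: f ab ba split: if_splits)
    then have "f j = (if snd (\<tau> (j, False)) then - 1 else 1)" for j
      using pair[of j] by (simp add: f ab ba)
    then have "(\<Prod>j\<in>UNIV. f j) = of_int (sign p)"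
      unfolding s[symmetric] sign_commuting_with_flip[OF \<tau> pair] of_int_prod by (intro prod.cong) auto
    then have "?t p = of_int (sign p * sign p)" unfolding of_int_mult by (simp add: f_def)
    then show ?thesis by simp
  next
    case True
    then show ?thesis by (simp only: mult_zero_right)
  qed
  have "1 \<le> (\<Sum>p | p permutes UNIV. ?t p)"
  proof -
    have "?t id \<le> (\<Sum>p | p permutes UNIV. ?t p)"
    proof (rule member_le_sum)
      show "id \<in> {p. p permutes UNIV}" by (simp only: mem_Collect_eq permutes_id)
      show "0 \<le> ?t p" if "p \<in> {p. p permutes UNIV} - {id}" for p using nonneg that by blast
    qed simp
    then show ?thesis unfolding id .
  qed
  also have "\<dots> = det A * pfaffian \<iota> \<omega>"
    using pfaffian_pullback[OF \<iota> bil, of A] by (simp add: pfaffian_def)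
  finally show ?thesis by auto
qed

section \<open>Maps of class C^k\<close>

text \<open>
  Derivatives at the points of \<open>S\<close> only depend on the map near these points.
\<close>

lemma Ck_on_local:
  assumes "\<And>x. x \<in> S \<Longrightarrow> \<exists>T g. open T \<and> x \<in> T \<and> Ck_on k T g \<and> (\<forall>y\<in>T. f y = g y)"
  shows "Ck_on k S f"
  using assms
proof (induction k arbitrary: f)
  case 0
  have "isCont f x" if "x \<in> S" for x
  proof -
    obtain T g where T: "open T" "x \<in> T" "continuous_on T g" "\<And>y. y \<in> T \<Longrightarrow> f y = g y"
      using 0[OF \<open>x \<in> S\<close>] by auto
    then have "continuous_on T f" by (metis continuous_on_cong)
    then show ?thesis using T(1,2) by (simp add: continuous_on_eq_continuous_at)
  qed
  then show ?case by (simp add: continuous_at_imp_continuous_on)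
next
  case (Suc k)
  have deriv: "f differentiable at x \<and> frechet_derivative f (at x) = frechet_derivative g (at x)"
    if T: "open T" "x \<in> T" "Ck_on (Suc k) T g" "\<forall>y\<in>T. f y = g y" for x T g
  proof -
    have "g differentiable at x" using T by simp
    then have "(g has_derivative frechet_derivative g (at x)) (at x)"
      by (simp add: frechet_derivative_works)
    then have "(f has_derivative frechet_derivative g (at x)) (at x)"
      by (rule has_derivative_transform_within_open[OF _ T(1,2)]) (use T(4) in simp)
    then show ?thesis using frechet_derivative_at differentiableI by metis
  qed
  have "Ck_on k S (\<lambda>x. frechet_derivative f (at x) v)" for v
  proof (rule Suc.IH)
    fix x assume "x \<in> S"
    then obtain T g where T: "open T" "x \<in> T" "Ck_on (Suc k) T g" "\<forall>y\<in>T. f y = g y"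
      using Suc.prems by blast
    then show "\<exists>T g. open T \<and> x \<in> T \<and> Ck_on k T g \<and> (\<forall>y\<in>T. frechet_derivative f (at y) v = g y)"
      using deriv[OF T(1) _ T(3,4)]
      by (intro exI[of _ T] exI[of _ "\<lambda>x. frechet_derivative g (at x) v"]) auto
  qed
  moreover have "f differentiable at x" if "x \<in> S" for x
    using Suc.prems[OF that] deriv by blast
  ultimately show ?case by simp
qed

lemma Ck_on_cong:
  assumes "open S" "Ck_on k S g" "\<And>x. x \<in> S \<Longrightarrow> f x = g x"
  shows "Ck_on k S f"
  by (rule Ck_on_local) (use assms in blast)

lemma Ck_on_subset: "Ck_on k S f \<Longrightarrow> T \<subseteq> S \<Longrightarrow> Ck_on k T f"
  by (induction k arbitrary: f) (auto intro: continuous_on_subset)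

lemma Ck_on_Suc_imp: "Ck_on (Suc k) S f \<Longrightarrow> Ck_on k S f"
proof (induction k arbitrary: f)
  case 0
  then show ?case
    by (auto intro!: continuous_at_imp_continuous_on differentiable_imp_continuous_within)
next
  case (Suc k)
  then show ?case by (metis Ck_on.simps(2))
qed

lemma Ck_on_derivI:
  assumes S: "open S" and "\<And>x. x \<in> S \<Longrightarrow> (f has_derivative f' x) (at x)"
    and "\<And>v. Ck_on k S (\<lambda>x. f' x v)"
  shows "Ck_on (Suc k) S f"
proof -
  have "f' x = frechet_derivative f (at x)" if "x \<in> S" for x
    using assms(2)[OF that] by (rule frechet_derivative_at)
  then have "Ck_on k S (\<lambda>x. frechet_derivative f (at x) v)" for v
    by (intro Ck_on_cong[OF S assms(3)[of v]]) simp
  then show ?thesis using assms(2) by (auto simp: differentiable_def)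
qed

lemma Ck_on_derivD:
  assumes "Ck_on (Suc k) S f" "x \<in> S"
  shows "(f has_derivative frechet_derivative f (at x)) (at x)"
  using assms by (simp add: frechet_derivative_works)

lemma Ck_on_const: "open S \<Longrightarrow> Ck_on k S (\<lambda>x. c)"
proof (induction k arbitrary: c)
  case (Suc k)
  then show ?case by (intro Ck_on_derivI[of S _ "\<lambda>_ _. 0"]) auto
qed simp

lemma Ck_on_linear:
  assumes "open S" "bounded_linear f"
  shows "Ck_on k S f"
proof (cases k)
  case 0
  then show ?thesis using assms by (simp add: linear_continuous_on)
next
  case (Suc k')
  show ?thesis unfolding Suc
    by (rule Ck_on_derivI[of S f "\<lambda>_. f"]) (use assms in \<open>auto intro: bounded_linear_imp_has_derivative Ck_on_const\<close>)
qed

lemma Ck_on_add: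
  assumes "open S" "Ck_on k S f" "Ck_on k S g"
  shows "Ck_on k S (\<lambda>x. f x + g x)"
  using assms(2,3)
proof (induction k arbitrary: f g)
  case 0
  then show ?case by (auto intro: continuous_intros)
next
  case (Suc k)
  note has_derivative_add[OF Ck_on_derivD[OF Suc.prems(1)] Ck_on_derivD[OF Suc.prems(2)]]
  then show ?case
    by (rule Ck_on_derivI[OF assms(1)]) (use Suc in auto)
qed

lemma Ck_on_mult:
  fixes f g :: "'a::euclidean_space \<Rightarrow> real"
  assumes "open S" "Ck_on k S f" "Ck_on k S g"
  shows "Ck_on k S (\<lambda>x. f x * g x)"
  using assms(2,3)
proof (induction k arbitrary: f g)
  case 0
  then show ?case by (auto intro: continuous_intros)
next
  case (Suc k)
  note has_derivative_mult[OF Ck_on_derivD[OF Suc.prems(1)] Ck_on_derivD[OF Suc.prems(2)]]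
  moreover have "Ck_on k S (\<lambda>x. f x * frechet_derivative g (at x) v + frechet_derivative f (at x) v * g x)" for v
  proof -
    have "Ck_on k S f" "Ck_on k S g" using Suc.prems by (auto intro: Ck_on_Suc_imp simp del: Ck_on.simps)
    moreover have "Ck_on k S (\<lambda>x. frechet_derivative f (at x) v)"
      "Ck_on k S (\<lambda>x. frechet_derivative g (at x) v)" using Suc.prems by auto
    ultimately show ?thesis by (intro Ck_on_add[OF assms(1)] Suc.IH)
  qed
  ultimately show ?case
    by (rule Ck_on_derivI[OF assms(1)])
qed

lemma Ck_on_powr:
  fixes f :: "'a::euclidean_space \<Rightarrow> real"
  assumes "open S" "Ck_on k S f" "\<And>x. x \<in> S \<Longrightarrow> 0 < f x"
  shows "Ck_on k S (\<lambda>x. f x powr r)"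
  using assms(2)
proof (induction k arbitrary: r)
  case 0
  have "f x \<noteq> 0" if "x \<in> S" for x using assms(3)[OF that] by simp
  then show ?case using 0 by (auto intro!: continuous_intros)
next
  case (Suc k)
  have "((\<lambda>x. f x powr r) has_derivative (\<lambda>v. r * (f x powr (r - 1) * frechet_derivative f (at x) v))) (at x)"
    if x: "x \<in> S" for x
  proof -
    have "((\<lambda>y. y powr r) has_derivative (*) (r * f x powr (r - 1))) (at (f x))"
      using has_real_derivative_powr[OF assms(3)[OF x], of r] by (simp add: has_field_derivative_def)
    from has_derivative_compose[OF Ck_on_derivD[OF Suc.prems x] this]
    show ?thesis by (simp add: mult.assoc)
  qed
  moreover have "Ck_on k S (\<lambda>x. r * (f x powr (r - 1) * frechet_derivative f (at x) v))" for v
    using Suc.prems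
    by (intro Ck_on_mult Ck_on_const assms(1) Suc.IH) (auto intro: Ck_on_Suc_imp[OF Suc.prems])
  ultimately show ?case by (rule Ck_on_derivI[OF assms(1)])
qed

lemma has_derivative_vec:
  fixes f :: "'a::euclidean_space \<Rightarrow> real ^ 'm::finite"
  assumes "\<And>j. ((\<lambda>x. f x $ j) has_derivative (\<lambda>v. f' v $ j)) (at x)"
  shows "(f has_derivative f') (at x)"
  unfolding has_derivative_componentwise_within[of f]
  using assms by (auto simp: Basis_vec_def inner_axis)

lemma Ck_on_compose_linear:
  assumes "open S" "bounded_linear l" "Ck_on k S f"
  shows "Ck_on k S (\<lambda>x. l (f x))"
  using assms(3)
proof (induction k arbitrary: f)
  case 0
  then show ?case using assms(2) by (auto intro: bounded_linear.continuous_on)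
next
  case (Suc k)
  show ?case
    by (rule Ck_on_derivI[OF assms(1) bounded_linear.has_derivative[OF assms(2) Ck_on_derivD[OF Suc.prems]]])
      (use Suc in auto)
qed

lemma Ck_on_vec:
  fixes f :: "'a::euclidean_space \<Rightarrow> real ^ 'm::finite"
  assumes "open S" "\<And>j. Ck_on k S (\<lambda>x. f x $ j)"
  shows "Ck_on k S f"
  using assms(2)
proof (induction k arbitrary: f)
  case 0
  have "continuous_on S (\<lambda>x. \<chi> j. f x $ j)" using 0 by (intro continuous_on_vec_lambda) simp
  then show ?case by simp
next
  case (Suc k)
  have "(f has_derivative (\<lambda>v. \<chi> j. frechet_derivative (\<lambda>x. f x $ j) (at x) v)) (at x)" if "x \<in> S" for x
    using Ck_on_derivD[OF Suc.prems that] by (intro has_derivative_vec) simp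
  then show ?case
    by (rule Ck_on_derivI[OF assms(1)]) (use Suc in auto)
qed

section \<open>Maps that factor through an immersion\<close>

text \<open>
  Let \<open>h\<close> be a left inverse of \<open>f'\<close>. The map \<open>h \<circ> f\<close> has the identity as derivative at \<open>\<tau> x\<close>, so by
  the continuity of \<open>\<tau>\<close> the increment of \<open>\<tau>\<close> agrees with the increment of \<open>h \<circ> g\<close> up to an error that is small
  relative to the increment of \<open>\<tau>\<close> itself. This bounds the increment of \<open>\<tau>\<close> linearly, and then the
  error is small relative to the increment of the argument.
\<close>

lemma has_derivative_factor_through_immersion:
  fixes f :: "'b::euclidean_space \<Rightarrow> 'c::euclidean_space" and \<tau> :: "'a::euclidean_space \<Rightarrow> 'b"
  assumes f: "(f has_derivative f') (at (\<tau> x))" and inj: "inj f'"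
    and g: "(g has_derivative g') (at x)" and cont: "isCont \<tau> x"
    and S: "open S" "x \<in> S" and eq: "\<And>z. z \<in> S \<Longrightarrow> g z = f (\<tau> z)"
  shows "\<exists>\<tau>'. (\<tau> has_derivative \<tau>') (at x) \<and> g' = f' \<circ> \<tau>'"
proof -
  have "linear f'" using f has_derivative_linear by blast
  then obtain h where h: "linear h" "h \<circ> f' = id"
    using inj linear_injective_left_inverse by blast
  then have bh: "bounded_linear h" by (simp add: linear_conv_bounded_linear)
  have F: "((\<lambda>y. h (f y)) has_derivative (\<lambda>v. v)) (at (\<tau> x))"
    using bounded_linear.has_derivative[OF bh f] pointfree_idE[OF h(2)] by simp
  have G: "((\<lambda>y. h (g y)) has_derivative (\<lambda>v. h (g' v))) (at x)"
    using bounded_linear.has_derivative[OF bh g] .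
  have bl: "bounded_linear (\<lambda>v. h (g' v))" using G has_derivative_bounded_linear by blast
  then obtain K where K: "K > 0" "\<And>v. norm (h (g' v)) \<le> norm v * K"
    using bounded_linear.pos_bounded by blast
  have small: "\<exists>d>0. \<forall>z. norm (z - x) < d \<longrightarrow> z \<in> S \<and>
      norm ((\<tau> z - \<tau> x) - (h (g z) - h (g x))) \<le> e * norm (\<tau> z - \<tau> x)" if "e > 0" for e
  proof -
    obtain d1 where d1: "d1 > 0" "\<And>y. norm (y - \<tau> x) < d1 \<Longrightarrow>
        norm (h (f y) - h (f (\<tau> x)) - (y - \<tau> x)) \<le> e * norm (y - \<tau> x)"
      using F \<open>e > 0\<close> unfolding has_derivative_at_alt by blast
    obtain d2 where d2: "d2 > 0" "\<And>z. norm (z - x) < d2 \<Longrightarrow> norm (\<tau> z - \<tau> x) < d1"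
      using cont d1(1) unfolding continuous_at_eps_delta dist_norm by blast
    obtain d3 where d3: "d3 > 0" "\<And>z. norm (z - x) < d3 \<Longrightarrow> z \<in> S"
      using S unfolding open_dist dist_norm by blast
    show ?thesis
    proof (intro exI[of _ "min d2 d3"] conjI allI impI)
      fix z assume z: "norm (z - x) < min d2 d3"
      then show zS: "z \<in> S" using d3(2) by simp
      have "norm (h (f (\<tau> z)) - h (f (\<tau> x)) - (\<tau> z - \<tau> x)) \<le> e * norm (\<tau> z - \<tau> x)"
        using z d2(2) d1(2) by simp
      then show "norm ((\<tau> z - \<tau> x) - (h (g z) - h (g x))) \<le> e * norm (\<tau> z - \<tau> x)"
        by (simp only: eq[OF zS] eq[OF S(2)] norm_minus_commute)
    qed (use d2 d3 in auto)
  qed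
  have "(\<tau> has_derivative (\<lambda>v. h (g' v))) (at x)"
    unfolding has_derivative_at_alt
  proof (intro conjI allI impI bl)
    fix e :: real assume e: "e > 0"
    \<comment> \<open>With these constants the error in terms of the increment of \<open>\<tau>\<close>, which is at most
      \<open>2 * (K + 1)\<close> times the increment of the argument, and the error of the derivative of \<open>h \<circ> g\<close>
      both contribute at most \<open>e / 2\<close>.\<close>
    define e1 where "e1 = min (1/2) (e / (4 * (K + 1)))"
    have K4: "0 < 4 * (K + 1)" using K(1) by simp
    then have e1: "0 < e1" "e1 \<le> 1/2" "e1 \<le> e / (4 * (K + 1))" using e by (auto simp only: e1_def min_less_iff_conj min.cobounded1 min.cobounded2 divide_pos_pos)
    then have e1': "e1 * (4 * (K + 1)) \<le> e" by (simp only: pos_le_divide_eq[OF K4])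
    define e2 where "e2 = min 1 (e / 2)"
    have e2: "0 < e2" "e2 \<le> 1" "e2 \<le> e / 2" using e by (auto simp: e2_def)
    obtain d1 where d1: "d1 > 0" "\<And>z. norm (z - x) < d1 \<Longrightarrow>
        norm ((\<tau> z - \<tau> x) - (h (g z) - h (g x))) \<le> e1 * norm (\<tau> z - \<tau> x)"
      using small[OF e1(1)] by blast
    obtain d2 where d2: "d2 > 0" "\<And>z. norm (z - x) < d2 \<Longrightarrow>
        norm (h (g z) - h (g x) - h (g' (z - x))) \<le> e2 * norm (z - x)"
      using G e2(1) unfolding has_derivative_at_alt by blast
    show "\<exists>d>0. \<forall>y. norm (y - x) < d \<longrightarrow> norm (\<tau> y - \<tau> x - h (g' (y - x))) \<le> e * norm (y - x)"
    proof (intro exI[of _ "min d1 d2"] conjI allI impI)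
      fix z assume z: "norm (z - x) < min d1 d2"
      define T where "T = \<tau> z - \<tau> x"
      define D where "D = h (g z) - h (g x)"
      define L where "L = h (g' (z - x))"
      have 1: "norm (T - D) \<le> e1 * norm T" using d1(2) z by (simp add: T_def D_def)
      have 2: "norm (D - L) \<le> e2 * norm (z - x)" using d2(2) z by (simp add: L_def D_def)
      have 3: "norm L \<le> norm (z - x) * K" using K(2) by (simp add: L_def)
      have "e1 * norm T \<le> 1/2 * norm T" using e1(2) by (intro mult_right_mono) auto
      moreover have "norm T \<le> norm (T - D) + norm D"
        using norm_triangle_ineq[of "T - D" D] by simp
      ultimately have "norm T \<le> 2 * norm D" using 1 by linarith
      also have "norm D \<le> norm (D - L) + norm L"
        using norm_triangle_ineq[of "D - L" L] by simp
      also have "\<dots> \<le> 1 * norm (z - x) + norm (z - x) * K"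
        using 2 3 mult_right_mono[OF e2(2) norm_ge_zero[of "z - x"]] by linarith
      finally have T: "norm T \<le> 2 * (K + 1) * norm (z - x)" by (simp add: algebra_simps)
      have "norm (T - L) \<le> norm (T - D) + norm (D - L)"
        using norm_triangle_ineq[of "T - D" "D - L"] by simp
      also have "\<dots> \<le> e1 * (2 * (K + 1) * norm (z - x)) + e / 2 * norm (z - x)"
        using 1 2 mult_left_mono[OF T, of e1] e1(1) mult_right_mono[OF e2(3) norm_ge_zero[of "z - x"]]
        by linarith
      also have "\<dots> = (e1 * (4 * (K + 1)) / 2 + e / 2) * norm (z - x)"
        by (simp add: algebra_simps)
      also have "\<dots> \<le> e * norm (z - x)"
        using e1' by (intro mult_right_mono) auto
      finally show "norm (\<tau> z - \<tau> x - h (g' (z - x))) \<le> e * norm (z - x)"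
        by (simp add: T_def L_def)
    qed (use d1 d2 in auto)
  qed
  moreover from this have "((\<lambda>z. f (\<tau> z)) has_derivative (\<lambda>v. f' (h (g' v)))) (at x)"
    using has_derivative_compose f by blast
  then have "(g has_derivative (\<lambda>v. f' (h (g' v)))) (at x)"
    by (rule has_derivative_transform_within_open[OF _ S]) (simp add: eq)
  then have "g' = (\<lambda>v. f' (h (g' v)))" using g has_derivative_unique by blast
  ultimately show ?thesis by (intro exI[of _ "\<lambda>v. h (g' v)"]) (auto simp: fun_eq_iff)
qed

lemma continuous_on_det:
  fixes A :: "'a::topological_space \<Rightarrow> real ^ 'k ^ 'k::finite"
  assumes "\<And>i j. continuous_on S (\<lambda>x. A x $ i $ j)"
  shows "continuous_on S (\<lambda>x. det (A x))"
  unfolding det_def by (intro continuous_intros assms)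

text \<open>
  A left inverse \<open>h\<close> of the derivative of \<open>f\<close> at the single point \<open>\<tau> x\<close> turns the derivatives of \<open>f\<close> and
  \<open>g\<close> into square matrices that depend continuously on the point. The quotient of their determinants is the
  Jacobian determinant of \<open>\<tau>\<close>, and the determinant for \<open>f\<close> is positive near \<open>x\<close>, where it is 1.
\<close>

lemma sign_det_factor_through_immersion:
  fixes f g :: "real ^ 'k::finite \<Rightarrow> 'c::euclidean_space" and \<tau> :: "real ^ 'k \<Rightarrow> real ^ 'k"
  assumes S: "open S" and S': "open S'" and \<tau>: "continuous_on S \<tau>" "\<tau> ` S \<subseteq> S'"
    and f: "Ck_on 1 S' f" "\<And>y. y \<in> S' \<Longrightarrow> inj (frechet_derivative f (at y))"
    and g: "Ck_on 1 S g" "\<And>y. y \<in> S \<Longrightarrow> inj (frechet_derivative g (at y))"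
    and eq: "\<And>z. z \<in> S \<Longrightarrow> g z = f (\<tau> z)"
    and x: "x \<in> S"
  shows "\<tau> differentiable at x" "det (jacobian \<tau> (at x)) \<noteq> 0"
    "isCont (\<lambda>y. sgn (det (jacobian \<tau> (at y)))) x"
proof -
  define Df where "Df y = frechet_derivative f (at y)" for y
  define Dg where "Dg y = frechet_derivative g (at y)" for y
  have Df: "(f has_derivative Df y) (at y)" if "y \<in> S'" for y
    using Ck_on_derivD[of 0 S' f] f(1) that by (simp add: Df_def)
  have Dg: "(g has_derivative Dg y) (at y)" if "y \<in> S" for y
    using Ck_on_derivD[of 0 S g] g(1) that by (simp add: Dg_def)
  have \<tau>': "(\<tau> has_derivative (\<lambda>v. jacobian \<tau> (at y) *v v)) (at y) \<and>
      Dg y = Df (\<tau> y) \<circ> (\<lambda>v. jacobian \<tau> (at y) *v v)" if y: "y \<in> S" for y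
  proof -
    have "\<tau> y \<in> S'" using \<tau>(2) y by blast
    moreover have "isCont \<tau> y" using \<tau>(1) S y by (simp add: continuous_on_eq_continuous_at)
    ultimately obtain \<tau>' where *: "(\<tau> has_derivative \<tau>') (at y)" "Dg y = Df (\<tau> y) \<circ> \<tau>'"
      using has_derivative_factor_through_immersion[OF Df _ Dg _ S y eq] y f(2) Df_def by metis
    then have "(\<tau> has_derivative (\<lambda>v. jacobian \<tau> (at y) *v v)) (at y)"
      using jacobian_works differentiableI by blast
    then show ?thesis using * has_derivative_unique by blast
  qed
  show "\<tau> differentiable at x" using \<tau>'[OF x] differentiableI by blast
  have nz: "det (jacobian \<tau> (at y)) \<noteq> 0" if y: "y \<in> S" for y
  proof -
    have "inj (Dg y)" using g(2)[OF y] by (simp add: Dg_def)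
    then have "inj (\<lambda>v. jacobian \<tau> (at y) *v v)"
      using \<tau>'[OF y] by (metis inj_on_imageI2)
    then show ?thesis using det_nz_iff_inj[of "\<lambda>v. jacobian \<tau> (at y) *v v"]
      by (simp add: matrix_of_matrix_vector_mul)
  qed
  then show "det (jacobian \<tau> (at x)) \<noteq> 0" using x .
  have "\<tau> x \<in> S'" using \<tau>(2) x by blast
  then have "inj (Df (\<tau> x))" "linear (Df (\<tau> x))"
    using f(2) has_derivative_linear[OF Df] by (simp_all add: Df_def)
  then obtain h where h: "linear h" "h \<circ> Df (\<tau> x) = id"
    using linear_injective_left_inverse by blast
  define a where "a y = det (matrix (h \<circ> Df (\<tau> y)))" for y
  define b where "b y = det (matrix (h \<circ> Dg y))" for y
  have ab: "a y * det (jacobian \<tau> (at y)) = b y" if "y \<in> S" for y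
  proof -
    have "linear (h \<circ> Df (\<tau> y))"
      using h(1) has_derivative_linear[OF Df] \<tau>(2) that by (intro linear_compose) auto
    moreover have "h \<circ> Dg y = (h \<circ> Df (\<tau> y)) \<circ> (\<lambda>v. jacobian \<tau> (at y) *v v)"
      using \<tau>'[OF that] by (simp add: o_assoc)
    ultimately show ?thesis
      by (simp add: a_def b_def matrix_compose det_mul matrix_vector_mul_linear matrix_of_matrix_vector_mul)
  qed
  have conth: "continuous_on UNIV h" using h(1) by (simp add: linear_continuous_on linear_conv_bounded_linear)
  have "continuous_on S' (\<lambda>y. Df y v)" for v using f(1) by (simp add: Df_def)
  then have "continuous_on S (\<lambda>y. Df (\<tau> y) v)" for v
    by (rule continuous_on_compose2[OF _ \<tau>])
  then have "continuous_on S (\<lambda>y. h (Df (\<tau> y) v))" for v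
    by (rule continuous_on_compose2[OF conth]) simp
  then have "continuous_on S a"
    unfolding a_def by (intro continuous_on_det) (simp add: matrix_def continuous_on_component)
  then have ca: "isCont a x" using S x by (simp add: continuous_on_eq_continuous_at)
  have "continuous_on S (\<lambda>y. Dg y v)" for v using g(1) by (simp add: Dg_def)
  then have "continuous_on S (\<lambda>y. h (Dg y v))" for v
    by (rule continuous_on_compose2[OF conth]) simp
  then have "continuous_on S b"
    unfolding b_def by (intro continuous_on_det) (simp add: matrix_def continuous_on_component)
  then have cb: "isCont b x" using S x by (simp add: continuous_on_eq_continuous_at)
  have ax: "a x = 1" by (simp only: a_def h(2) matrix_id)
  then have "b x \<noteq> 0" using ab[OF x] nz[OF x] by simp
  then have "isCont (\<lambda>y. sgn (b y)) x" using cb by (intro isCont_sgn)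
  moreover have "eventually (\<lambda>y. sgn (det (jacobian \<tau> (at y))) = sgn (b y)) (nhds x)"
  proof -
    have "eventually (\<lambda>y. y \<in> S) (nhds x)" using S x by (rule eventually_nhds_in_open)
    moreover have "eventually (\<lambda>y. a y > 0) (nhds x)"
      using ca ax order_tendstoD(1)[of a "a x" "nhds x" 0] by (simp add: tendsto_nhds_iff isCont_def)
    ultimately show ?thesis
    proof eventually_elim
      case (elim y)
      show ?case unfolding ab[OF elim(1), symmetric] using elim(2) by (simp add: sgn_mult)
    qed
  qed
  ultimately show "isCont (\<lambda>y. sgn (det (jacobian \<tau> (at y)))) x"
    by (simp only: isCont_cong)
qed

section \<open>Orientations and symplectic forms as sign fields\<close>

abbreviation jac ::
  "('x, 'k::finite) chart \<Rightarrow> ('x, 'k) chart \<Rightarrow> real ^ 'k \<Rightarrow> real ^ 'k ^ 'k" where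
  "jac c d x \<equiv> jacobian (transition_map c d) (at x)"

text \<open>
  The part of the smooth compatibility of charts that gives the signs of Jacobian determinants a
  meaning: the chain rule holds, the signs are nonzero, and they are locally constant.
\<close>

definition regular_atlas :: "'x topology \<Rightarrow> ('x, 'k::finite) chart set \<Rightarrow> bool" where
  "regular_atlas T A \<longleftrightarrow>
     (\<forall>c\<in>A. topological_chart T c) \<and>
     (\<forall>c\<in>A. \<forall>d\<in>A. \<forall>x\<in>transition_domain c d.
        transition_map c d differentiable at x \<and> det (jac c d x) \<noteq> 0 \<and>
        isCont (\<lambda>y. sgn (det (jac c d y))) x)"

text \<open>
  A section of the orientation double covering, written out in the charts.
\<close>

definition sign_field ::
  "('x, 'k::finite) chart set \<Rightarrow> (('x, 'k) chart \<Rightarrow> real ^ 'k \<Rightarrow> real) \<Rightarrow> bool" where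
  "sign_field A s \<longleftrightarrow>
     (\<forall>c\<in>A. continuous_on (snd c ` fst c) (s c) \<and> (\<forall>x\<in>snd c ` fst c. s c x \<in> {1, - 1}) \<and>
        (\<forall>d\<in>A. \<forall>x\<in>transition_domain c d.
           s c x = sgn (det (jac c d x)) * s d (transition_map c d x)))"

lemma topological_chartD:
  assumes "topological_chart T c"
  shows "openin T (fst c)" "inj_on (snd c) (fst c)" "open (snd c ` fst c)"
    "homeomorphic_map (subtopology T (fst c)) (top_of_set (snd c ` fst c)) (snd c)"
    "fst c \<subseteq> topspace T"
proof -
  show "openin T (fst c)" "open (snd c ` fst c)" and
    h: "homeomorphic_map (subtopology T (fst c)) (top_of_set (snd c ` fst c)) (snd c)"
    using assms by (auto simp: topological_chart_def split_beta)
  then show sub: "fst c \<subseteq> topspace T" by (simp add: openin_subset)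
  show "inj_on (snd c) (fst c)"
    using homeomorphic_imp_injective_map[OF h] sub by (simp add: Int_absorb1)
qed

lemma chart_image_open:
  assumes c: "topological_chart T c" and V: "openin T V" "V \<subseteq> fst c"
  shows "open (snd c ` V)"
proof -
  have "openin (subtopology T (fst c)) V"
    using V by (metis inf.absorb_iff2 openin_subtopology_Int2)
  then have "openin (top_of_set (snd c ` fst c)) (snd c ` V)"
    using topological_chartD(4)[OF c] homeomorphic_map_openness_eq by blast
  then show ?thesis using topological_chartD(3)[OF c] openin_open_trans by blast
qed

lemma open_transition_domain:
  assumes "topological_chart T c" "topological_chart T d"
  shows "open (transition_domain c d)"
  unfolding transition_domain_def
  using assms topological_chartD(1) by (intro chart_image_open[OF assms(1)]) (blast intro: openin_Int)+

lemma transition_map_apply: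
  assumes "topological_chart T c" "z \<in> fst c"
  shows "transition_map c d (snd c z) = snd d z"
  using topological_chartD(2)[OF assms(1)] assms(2) by (simp add: transition_map_def)

lemma regular_atlasD:
  assumes "regular_atlas T A"
  shows "c \<in> A \<Longrightarrow> topological_chart T c"
    "\<And>x. c \<in> A \<Longrightarrow> d \<in> A \<Longrightarrow> x \<in> transition_domain c d \<Longrightarrow>
      (transition_map c d has_derivative (\<lambda>v. jac c d x *v v)) (at x)"
    "\<And>x. c \<in> A \<Longrightarrow> d \<in> A \<Longrightarrow> x \<in> transition_domain c d \<Longrightarrow> det (jac c d x) \<noteq> 0"
    "\<And>x. c \<in> A \<Longrightarrow> d \<in> A \<Longrightarrow> x \<in> transition_domain c d \<Longrightarrow>
      isCont (\<lambda>y. sgn (det (jac c d y))) x"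
  using assms jacobian_works unfolding regular_atlas_def by blast+

lemma transition_det_chain:
  assumes A: "regular_atlas T A" "c \<in> A" "d \<in> A" "e \<in> A"
    and z: "z \<in> fst c" "z \<in> fst d" "z \<in> fst e"
  shows "det (jac c e (snd c z)) =
    det (jac d e (snd d z)) * det (jac c d (snd c z))"
proof -
  note ch = regular_atlasD(1)[OF A(1)]
  define x where "x = snd c z"
  have x: "x \<in> transition_domain c d" "x \<in> transition_domain c e"
    using z by (auto simp: transition_domain_def x_def)
  have dz: "snd d z \<in> transition_domain d e" using z by (auto simp: transition_domain_def)
  have cd: "transition_map c d x = snd d z" using transition_map_apply[OF ch[OF A(2)] z(1)] by (simp add: x_def)
  have D1: "(transition_map c d has_derivative (\<lambda>v. jac c d x *v v)) (at x)"
    by (rule regular_atlasD(2)[OF A(1,2,3) x(1)])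
  have D2: "(transition_map d e has_derivative (\<lambda>v. jac d e (snd d z) *v v)) (at (transition_map c d x))"
    unfolding cd by (rule regular_atlasD(2)[OF A(1,3,4) dz])
  have "((\<lambda>y. transition_map d e (transition_map c d y)) has_derivative
      (\<lambda>v. jac d e (snd d z) *v (jac c d x *v v))) (at x)"
    using has_derivative_compose[OF D1 D2] .
  moreover have "open (snd c ` (fst c \<inter> fst d \<inter> fst e))"
    by (rule chart_image_open[OF ch[OF A(2)]])
      (intro openin_Int topological_chartD(1) ch A, blast)
  moreover have "x \<in> snd c ` (fst c \<inter> fst d \<inter> fst e)" using z by (auto simp: x_def)
  moreover have "transition_map d e (transition_map c d y) = transition_map c e y"
    if y: "y \<in> snd c ` (fst c \<inter> fst d \<inter> fst e)" for y
  proof -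
    obtain w where "y = snd c w" "w \<in> fst c" "w \<in> fst d" using y by blast
    then show ?thesis
      using transition_map_apply[OF ch[OF A(2)], of w] transition_map_apply[OF ch[OF A(3)], of w] by simp
  qed
  ultimately have "(transition_map c e has_derivative
      (\<lambda>v. jac d e (snd d z) *v (jac c d x *v v))) (at x)"
    using has_derivative_transform_within_open by blast
  then have "(\<lambda>v. jac c e x *v v) = (\<lambda>v. (jac d e (snd d z) ** jac c d x) *v v)"
    using has_derivative_unique[OF regular_atlasD(2)[OF A(1,2,4) x(2)]]
    by (simp add: matrix_vector_mul_assoc)
  then have "jac c e x = jac d e (snd d z) ** jac c d x" by (metis matrix_of_matrix_vector_mul)
  then show ?thesis by (simp add: det_mul x_def)
qed

text \<open>
  The sign at a point of a chart \<open>c\<close> is that of the Jacobian determinant of the change from \<open>c\<close> to a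
  chart of the oriented atlas. By the chain rule it does not depend on the choice of the latter.
\<close>

lemma sign_field_if_orientable:
  assumes A: "regular_atlas T A" and "orientable_manifold T A"
  shows "\<exists>s. sign_field A s"
proof -
  obtain B where B: "B \<subseteq> A" "(\<Union>c\<in>B. fst c) = topspace T"
    and pos': "\<forall>c\<in>B. \<forall>d\<in>B. \<forall>x\<in>transition_domain c d. 0 < det (jac c d x)"
    using assms(2) unfolding orientable_manifold_def by (elim exE conjE)
  note pos = pos'[rule_format]
  note ch = regular_atlasD(1)[OF A]
  have "\<forall>z\<in>topspace T. \<exists>b\<in>B. z \<in> fst b" using B(2) by blast
  then obtain b where b: "\<And>z. z \<in> topspace T \<Longrightarrow> b z \<in> B \<and> z \<in> fst (b z)" by metis
  let ?j = "\<lambda>c d x. sgn (det (jac c d x))"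
  define s where "s c x = (let z = inv_into (fst c) (snd c) x in ?j c (b z) x)" for c :: "('a, 'b) chart" and x
  have s_eq: "s c (snd c z) = ?j c d (snd c z)" if c: "c \<in> A" "z \<in> fst c" and d: "d \<in> B" "z \<in> fst d" for c d z
  proof -
    have z: "z \<in> topspace T" using topological_chartD(5)[OF ch[OF c(1)]] c(2) by blast
    have dA: "d \<in> A" and bA: "b z \<in> A" using d(1) b[OF z] B(1) by auto
    have "s c (snd c z) = ?j c (b z) (snd c z)"
      using topological_chartD(2)[OF ch[OF c(1)]] c(2) by (simp add: s_def)
    also have "\<dots> = ?j d (b z) (snd d z) * ?j c d (snd c z)"
      using transition_det_chain[OF A c(1) dA bA c(2) d(2) conjunct2[OF b[OF z]]] by (simp add: sgn_mult)
    also have "?j d (b z) (snd d z) = 1"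
      using pos[OF d(1), of "b z" "snd d z"] b[OF z] d(2) by (auto simp: transition_domain_def)
    finally show ?thesis by simp
  qed
  have "continuous_on (snd c ` fst c) (s c) \<and> (\<forall>x\<in>snd c ` fst c. s c x \<in> {1, - 1}) \<and>
        (\<forall>d\<in>A. \<forall>x\<in>transition_domain c d. s c x = ?j c d x * s d (transition_map c d x))"
    if c: "c \<in> A" for c
  proof (intro conjI ballI)
    note tc = ch[OF c]
    have B': "\<exists>d\<in>B. z \<in> fst d" if "z \<in> fst c" for z
      using that b topological_chartD(5)[OF tc] by blast
    show "s c x \<in> {1, - 1}" if "x \<in> snd c ` fst c" for x
    proof -
      obtain z d where z: "x = snd c z" "z \<in> fst c" "d \<in> B" "z \<in> fst d" using \<open>x \<in> _\<close> B' by blast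
      then have "x \<in> transition_domain c d" by (auto simp: transition_domain_def)
      then show ?thesis
        using s_eq[OF c z(2-4)] regular_atlasD(3)[OF A c, of d] z B(1) by (auto simp: sgn_if)
    qed
    have "isCont (s c) x" if "x \<in> snd c ` fst c" for x
    proof -
      obtain z d where z: "x = snd c z" "z \<in> fst c" "d \<in> B" "z \<in> fst d" using \<open>x \<in> _\<close> B' by blast
      then have x: "x \<in> transition_domain c d" by (auto simp: transition_domain_def)
      have dA: "d \<in> A" using z B(1) by blast
      have "eventually (\<lambda>y. y \<in> transition_domain c d) (nhds x)"
        using open_transition_domain[OF tc ch[OF dA]] x by (rule eventually_nhds_in_open)
      then have "eventually (\<lambda>y. s c y = ?j c d y) (nhds x)"
      proof eventually_elim
        case (elim y)
        then obtain w where "y = snd c w" "w \<in> fst c" "w \<in> fst d" by (auto simp: transition_domain_def)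
        then show ?case using s_eq[OF c _ z(3)] by blast
      qed
      then show ?thesis using regular_atlasD(4)[OF A c dA x] by (simp only: isCont_cong)
    qed
    then show "continuous_on (snd c ` fst c) (s c)" by (simp add: continuous_at_imp_continuous_on)
    show "s c x = ?j c d x * s d (transition_map c d x)" if d: "d \<in> A" and x: "x \<in> transition_domain c d" for d x
    proof -
      obtain z where z: "x = snd c z" "z \<in> fst c" "z \<in> fst d" using x by (auto simp: transition_domain_def)
      obtain e where e: "e \<in> B" "z \<in> fst e" using B' z(2) by blast
      have "transition_map c d x = snd d z" using transition_map_apply[OF tc z(2)] z(1) by simp
      then show ?thesis
        using s_eq[OF c z(2) e] s_eq[OF d z(3) e] transition_det_chain[OF A c d _ z(2,3) e(2)] e(1) B(1)
        by (auto simp: z(1) sgn_mult)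
    qed
  qed
  then show ?thesis unfolding sign_field_def by blast
qed

text \<open>
  The sign of the Pfaffian of the form; it changes as required by \<open>pfaffian_pullback\<close>.
\<close>

lemma sign_field_if_symplectic:
  fixes A :: "('x, 'k::finite) chart set" and \<iota> :: "'n::finite \<times> bool \<Rightarrow> 'k"
  assumes A: "regular_atlas T A" and \<iota>: "bij \<iota>" and "symplectic_manifold A"
  shows "\<exists>s. sign_field A s"
proof -
  obtain \<omega> where sm: "smooth_two_form A \<omega>" and nd: "nondegenerate_two_form A \<omega>"
    using assms(3) unfolding symplectic_manifold_def by blast
  have bil: "bilinear (\<omega> c x)" and alt: "\<omega> c x v v = 0"
    and cont: "continuous_on (snd c ` fst c) (\<lambda>x. \<omega> c x v w)"
    and nondeg: "u \<noteq> 0 \<Longrightarrow> \<exists>w. \<omega> c x u w \<noteq> 0"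
    if "c \<in> A" "x \<in> snd c ` fst c" for c x v w u
  proof -
    have "smooth_on (snd c ` fst c) (\<lambda>x. \<omega> c x v w)" using sm that by (simp add: smooth_two_form_def)
    then show "continuous_on (snd c ` fst c) (\<lambda>x. \<omega> c x v w)" by (metis smooth_on_def Ck_on.simps(1))
    show "bilinear (\<omega> c x)" "\<omega> c x v v = 0" using sm that unfolding smooth_two_form_def by blast+
    show "u \<noteq> 0 \<Longrightarrow> \<exists>w. \<omega> c x u w \<noteq> 0" using nd that unfolding nondegenerate_two_form_def by blast
  qed
  define s where "s c x = sgn (pfaffian \<iota> (\<omega> c x))" for c x
  have nz: "pfaffian \<iota> (\<omega> c x) \<noteq> 0" if "c \<in> A" "x \<in> snd c ` fst c" for c x
    using bil[OF that] alt[OF that] nondeg[OF that] by (rule pfaffian_nonzero[OF \<iota>])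
  have "continuous_on (snd c ` fst c) (s c)" if c: "c \<in> A" for c
  proof (cases "fst c = {}")
    case False
    then obtain x where x: "x \<in> snd c ` fst c" by blast
    have "continuous_on (snd c ` fst c) (\<lambda>x. pfaffian \<iota> (\<omega> c x))"
      unfolding pfaffian_def by (intro continuous_intros cont[OF c x])
    then show ?thesis unfolding s_def using nz[OF c] by (intro continuous_on_sgn) auto
  qed simp
  moreover have "s c x \<in> {1, - 1}" if "c \<in> A" "x \<in> snd c ` fst c" for c x
    using nz[OF that] by (auto simp: s_def sgn_if)
  moreover have "s c x = sgn (det (jac c d x)) * s d (transition_map c d x)"
    if c: "c \<in> A" and d: "d \<in> A" and x: "x \<in> transition_domain c d" for c d x
  proof -
    let ?J = "jac c d x"
    have J: "(\<lambda>v. ?J *v v) = frechet_derivative (transition_map c d) (at x)"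
      using regular_atlasD(2)[OF A c d x] by (rule frechet_derivative_at)
    then have Jv: "?J *v v = frechet_derivative (transition_map c d) (at x) v" for v by (rule fun_cong)
    obtain z where z: "x = snd c z" "z \<in> fst c" "z \<in> fst d" using x by (auto simp: transition_domain_def)
    have "transition_map c d x = snd d z"
      using transition_map_apply[OF regular_atlasD(1)[OF A c] z(2)] z(1) by simp
    then have y: "transition_map c d x \<in> snd d ` fst d" using z(3) by blast
    have "\<omega> c x = (\<lambda>v w. \<omega> d (transition_map c d x) (?J *v v) (?J *v w))"
      using sm c d x unfolding smooth_two_form_def Jv by (intro ext) blast
    then have "pfaffian \<iota> (\<omega> c x) = det ?J * pfaffian \<iota> (\<omega> d (transition_map c d x))"
      using pfaffian_pullback[OF \<iota> bil[OF d y], of ?J] by simp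
    then show ?thesis by (simp add: s_def sgn_mult)
  qed
  ultimately show ?thesis unfolding sign_field_def by blast
qed

section \<open>The quotient by the kernel of a characteristic map\<close>

lemma bit_vec_double [simp]: "h + h = (0 :: bit ^ 'm)"
  by (simp only: vec_eq_iff vector_add_component bit_double zero_index) simp

lemma bit_vec_cancel [simp]: "h + (h + g) = (g :: bit ^ 'm)"
  by (simp only: add.assoc[symmetric] bit_vec_double add_0)

lemma openin_prod_discrete:
  "openin (prod_topology (discrete_topology UNIV) X) S \<longleftrightarrow> (\<forall>g. openin X {p. (g, p) \<in> S})"
proof
  assume S: "openin (prod_topology (discrete_topology UNIV) X) S"
  show "\<forall>g. openin X {p. (g, p) \<in> S}"
  proof
    fix g
    show "openin X {p. (g, p) \<in> S}"
    proof (subst openin_subopen, clarify)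
      fix p assume "(g, p) \<in> S"
      then obtain U V where "openin X V" "g \<in> U" "p \<in> V" "U \<times> V \<subseteq> S"
        using S[unfolded openin_prod_topology_alt, rule_format, of g p] by blast
      then show "\<exists>T. openin X T \<and> p \<in> T \<and> T \<subseteq> {p. (g, p) \<in> S}" by blast
    qed
  qed
next
  assume *: "\<forall>g. openin X {p. (g, p) \<in> S}"
  show "openin (prod_topology (discrete_topology UNIV) X) S"
    unfolding openin_prod_topology_alt
  proof (intro allI impI)
    fix g p assume "(g, p) \<in> S"
    then show "\<exists>U V. openin (discrete_topology UNIV) U \<and> openin X V \<and> g \<in> U \<and> p \<in> V \<and> U \<times> V \<subseteq> S"
      using * by (intro exI[of _ "{g}"] exI[of _ "{p. (g, p) \<in> S}"]) auto
  qed
qed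

lemma continuous_on_transition_map:
  fixes c d :: "('x, 'k::finite) chart"
  assumes c: "topological_chart T c" and d: "topological_chart T d"
  shows "continuous_on (transition_domain c d) (transition_map c d)"
  unfolding continuous_on_open_vimage[OF open_transition_domain[OF c d]]
proof (intro allI impI)
  fix B :: "(real ^ 'k) set" assume B: "open B"
  let ?U = "{z \<in> topspace (subtopology T (fst d)). snd d z \<in> snd d ` fst d \<inter> B}"
  have "continuous_map (subtopology T (fst d)) (top_of_set (snd d ` fst d)) (snd d)"
    by (rule homeomorphic_imp_continuous_map[OF topological_chartD(4)[OF d]])
  then have "openin (subtopology T (fst d)) ?U"
    by (rule openin_continuous_map_preimage) (use B in auto)
  then have "openin T ?U"
    using openin_trans_full topological_chartD(1)[OF d] by blast
  then have "openin T (fst c \<inter> ?U)"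
    using topological_chartD(1)[OF c] by (rule openin_Int[rotated])
  then have "open (snd c ` (fst c \<inter> ?U))"
    by (rule chart_image_open[OF c]) blast
  also have "snd c ` (fst c \<inter> ?U) =
      transition_map c d -` B \<inter> transition_domain c d"
  proof (intro set_eqI iffI)
    fix x assume "x \<in> snd c ` (fst c \<inter> ?U)"
    then obtain z where z: "x = snd c z" "z \<in> fst c" "z \<in> fst d" "snd d z \<in> B" by auto
    then show "x \<in> transition_map c d -` B \<inter> transition_domain c d"
      using transition_map_apply[OF c z(2), of d] by (auto simp: transition_domain_def)
  next
    fix x assume x: "x \<in> transition_map c d -` B \<inter> transition_domain c d"
    then obtain z where z: "x = snd c z" "z \<in> fst c" "z \<in> fst d" by (auto simp: transition_domain_def)
    then have "snd d z \<in> B" using x transition_map_apply[OF c z(2), of d] by simp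
    then have "z \<in> (fst c \<inter> ?U)" using z topological_chartD(5)[OF d] by auto
    then show "x \<in> snd c ` (fst c \<inter> ?U)" using z(1) by blast
  qed
  finally show "open (transition_map c d -` B \<inter> transition_domain c d)" .
qed

text \<open>
  The stabiliser of a point over \<open>p\<close> is spanned by the basis vectors \<open>e\<^sub>j\<close> with \<open>p \<in> F j\<close>. The second
  assumption says that the kernel of \<open>lam\<close> meets it trivially, i.e. that the kernel acts freely.
\<close>

locale small_cover =
  fixes P :: "'a::euclidean_space set" and F :: "'m::finite \<Rightarrow> 'a set"
    and lam :: "bit ^ 'm \<Rightarrow> bit ^ 'k::finite"
  assumes lin: "Vector_Spaces.linear (*s) (*s) lam"
    and free: "\<And>p h. p \<in> P \<Longrightarrow> lam h = 0 \<Longrightarrow> h \<noteq> 0 \<Longrightarrow> \<exists>j. h $ j = 1 \<and> p \<notin> F j"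
    and closed_facet: "\<And>i. closed (F i)"
begin

sublocale lam: Vector_Spaces.linear "(*s)" "(*s)" lam by (rule lin)

abbreviation "RZ \<equiv> rz_topology P F"
abbreviation "M \<equiv> small_cover_topology P F lam"
abbreviation "q \<equiv> kernel_orbit lam"

definition cell :: "bit ^ 'm \<Rightarrow> 'a \<Rightarrow> ((bit ^ 'm) \<times> 'a) set" where
  "cell g p = rz_rel P F `` {(g, p)}"

lemma cell_eq_iff:
  assumes "p \<in> P" "p' \<in> P"
  shows "cell g p = cell g' p' \<longleftrightarrow> p = p' \<and> (\<forall>i. p \<notin> F i \<longrightarrow> g $ i = g' $ i)"
proof -
  have "cell g p = cell g' p' \<longleftrightarrow> ((g, p), (g', p')) \<in> rz_rel P F"
    unfolding cell_def by (rule eq_equiv_class_iff[OF equiv_rz_rel]) (use assms in auto)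
  then show ?thesis using assms by (auto simp: rz_rel_iff)
qed

lemma topspace_RZ: "topspace RZ = {cell g p |g p. p \<in> P}"
  by (auto simp: rz_topology_def cell_def image_def)

lemma topspace_M: "topspace M = q ` topspace RZ"
  by (simp add: small_cover_topology_def)

lemma rz_action_cell: "rz_action h (cell g p) = cell (h + g) p"
  unfolding cell_def by (rule rz_action_class)

lemma openin_RZ: "openin RZ W \<longleftrightarrow> W \<subseteq> topspace RZ \<and> (\<forall>g. openin (top_of_set P) {p \<in> P. cell g p \<in> W})"
  unfolding topspace_RZ rz_topology_def openin_quotient_topology openin_prod_discrete
  by (auto simp: cell_def image_def)

lemma cell_in_RZ: "p \<in> P \<Longrightarrow> cell g p \<in> topspace RZ"
  unfolding topspace_RZ by blast

lemma openin_M: "openin M U \<longleftrightarrow> U \<subseteq> topspace M \<and> (\<forall>g. openin (top_of_set P) {p \<in> P. q (cell g p) \<in> U})"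
proof -
  have "{p \<in> P. cell g p \<in> {X \<in> topspace RZ. q X \<in> U}} = {p \<in> P. q (cell g p) \<in> U}" for g
    using cell_in_RZ by blast
  then show ?thesis
    unfolding topspace_M small_cover_topology_def openin_quotient_topology openin_RZ by auto
qed

lemma continuous_q: "continuous_map RZ M q"
  unfolding small_cover_topology_def using quotient_map_quotient_topology quotient_imp_continuous_map by blast

lemma continuous_cell: "continuous_map (top_of_set P) RZ (cell g)"
  unfolding continuous_map by (auto simp: openin_RZ cell_in_RZ)

lemma q_cell_eq_iff:
  assumes p: "p \<in> P" "p' \<in> P"
  shows "q (cell g p) = q (cell g' p') \<longleftrightarrow> p = p' \<and> (\<exists>h. lam h = 0 \<and> (\<forall>i. p \<notin> F i \<longrightarrow> h $ i = g $ i + g' $ i))"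
proof
  have "rz_action 0 (cell g' p') = cell g' p'" by (simp add: rz_action_cell)
  then have "cell g' p' \<in> q (cell g' p')" unfolding kernel_orbit_def using lam.zero by force
  moreover assume "q (cell g p) = q (cell g' p')"
  ultimately have "cell g' p' \<in> q (cell g p)" by simp
  then obtain h where h: "lam h = 0" "cell g' p' = cell (h + g) p"
    unfolding kernel_orbit_def rz_action_cell by blast
  then have "p = p'" and *: "\<forall>i. p \<notin> F i \<longrightarrow> g' $ i = (h + g) $ i"
    using cell_eq_iff[OF p(2,1)] by auto
  have "h $ i = g $ i + g' $ i" if "p \<notin> F i" for i
    using *[rule_format, OF that] unfolding vector_add_component
    by (cases "h $ i"; cases "g $ i") simp_all
  then show "p = p' \<and> (\<exists>h. lam h = 0 \<and> (\<forall>i. p \<notin> F i \<longrightarrow> h $ i = g $ i + g' $ i))"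
    using h(1) \<open>p = p'\<close> by blast
next
  assume "p = p' \<and> (\<exists>h. lam h = 0 \<and> (\<forall>i. p \<notin> F i \<longrightarrow> h $ i = g $ i + g' $ i))"
  then obtain h where h: "p' = p" "lam h = 0" "\<And>i. p \<notin> F i \<Longrightarrow> h $ i = g $ i + g' $ i" by blast
  have sum: "g' $ i = (h + g) $ i" if "p \<notin> F i" for i
    using h(3)[OF that] unfolding vector_add_component by (cases "g' $ i"; cases "g $ i") simp_all
  have c: "cell g' p' = cell (h + g) p"
    unfolding h(1) cell_eq_iff[OF p(1) p(1)] using sum by blast
  have "rz_action l (cell g p) = rz_action (l + h) (cell g' p')" for l
  proof -
    have "l + h + (h + g) = l + g" by (simp add: add.assoc)
    then show ?thesis by (simp add: rz_action_cell c)
  qed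
  moreover have "rz_action l (cell g' p') = rz_action (l + h) (cell g p)" for l
    unfolding c rz_action_cell by (simp only: add.assoc)
  moreover have "lam (l + h) = 0" if "lam l = 0" for l
    using that h(2) by (simp only: lam.add add_0)
  ultimately show "q (cell g p) = q (cell g' p')" unfolding kernel_orbit_def by blast
qed

lemma q_shift: "p \<in> P \<Longrightarrow> lam h = 0 \<Longrightarrow> q (cell (h + g) p) = q (cell g p)"
  by (subst q_cell_eq_iff) (auto intro!: exI[of _ h] simp: add.assoc)

lemma open_map_q:
  assumes W: "openin RZ W"
  shows "openin M (q ` W)"
proof -
  have "{p \<in> P. q (cell g p) \<in> q ` W} = (\<Union>h\<in>{h. lam h = 0}. {p \<in> P. cell (h + g) p \<in> W})" for g
  proof (intro set_eqI iffI)
    fix p assume "p \<in> {p \<in> P. q (cell g p) \<in> q ` W}"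
    then obtain X where X: "X \<in> W" "q (cell g p) = q X" "p \<in> P" by blast
    then obtain g' p' where X': "X = cell g' p'" "p' \<in> P"
      using openin_subset[OF W] topspace_RZ by blast
    then obtain h where h: "p = p'" "lam h = 0" "\<And>i. p \<notin> F i \<Longrightarrow> h $ i = g $ i + g' $ i"
      using X q_cell_eq_iff[of p p' g g'] by auto
    have "(h + g) $ i = g' $ i" if "p \<notin> F i" for i
      unfolding vector_add_component h(3)[OF that] by (cases "g' $ i"; cases "g $ i") simp_all
    then have "cell (h + g) p = X"
      using X' X(3) h(1) by (simp add: cell_eq_iff)
    then show "p \<in> (\<Union>h\<in>{h. lam h = 0}. {p \<in> P. cell (h + g) p \<in> W})" using X h(2) by blast
  next
    fix p assume "p \<in> (\<Union>h\<in>{h. lam h = 0}. {p \<in> P. cell (h + g) p \<in> W})"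
    then obtain h where h: "lam h = 0" "p \<in> P" "cell (h + g) p \<in> W" by blast
    have "q (cell g p) = q (cell (h + g) p)" using q_shift[OF h(2,1)] by simp
    then show "p \<in> {p \<in> P. q (cell g p) \<in> q ` W}" using h by blast
  qed
  moreover have "openin (top_of_set P) (\<Union>h\<in>{h. lam h = 0}. {p \<in> P. cell (h + g) p \<in> W})" for g
    using W by (intro openin_Union) (auto simp: openin_RZ)
  moreover have "q ` W \<subseteq> topspace M" using openin_subset[OF W] by (auto simp: topspace_M)
  ultimately show ?thesis by (simp add: openin_M)
qed

text \<open>
  Around the class of \<open>(g, p)\<close> the coordinates \<open>g $ j\<close> with \<open>p \<notin> F j\<close> are well defined and constant,
  while a nonzero kernel element changes one of them.
\<close>

lemma locally_injective_q:
  assumes N: "openin RZ N" "X \<in> N"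
  shows "\<exists>W. openin RZ W \<and> X \<in> W \<and> W \<subseteq> N \<and> inj_on q W"
proof -
  obtain g p where X: "X = cell g p" "p \<in> P"
    using openin_subset[OF N(1)] N(2) topspace_RZ by blast
  \<comment> \<open>The condition only involves coordinates of \<open>g'\<close> that are constant on the class of \<open>(g', p')\<close>.\<close>
  define good where "good g' p' \<longleftrightarrow> (\<forall>j. p \<notin> F j \<longrightarrow> p' \<notin> F j \<and> g' $ j = g $ j)" for g' :: "bit ^ 'm" and p'
  define W where "W = {cell g' p' |g' p'. p' \<in> P \<and> good g' p'}"
  have W_iff: "cell g' p' \<in> W \<longleftrightarrow> good g' p'" if p': "p' \<in> P" for g' p'
  proof
    assume "cell g' p' \<in> W"
    then obtain h p2 where h: "cell g' p' = cell h p2" "p2 \<in> P" "good h p2"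
      unfolding W_def by blast
    then have "p' = p2" "\<forall>i. p' \<notin> F i \<longrightarrow> g' $ i = h $ i" using cell_eq_iff[OF p' h(2)] by blast+
    then show "good g' p'" using h(3) by (simp add: good_def)
  qed (use p' in \<open>auto simp: W_def\<close>)
  have "openin (top_of_set P) {p' \<in> P. cell g' p' \<in> W}" for g'
  proof (cases "\<forall>j. p \<notin> F j \<longrightarrow> g' $ j = g $ j")
    case True
    then have "{p' \<in> P. cell g' p' \<in> W} = P \<inter> (\<Inter>j\<in>{j. p \<notin> F j}. - F j)"
      using W_iff by (auto simp: good_def)
    moreover have "open (\<Inter>j\<in>{j. p \<notin> F j}. - F j)"
      using closed_facet by (intro open_INT) auto
    ultimately show ?thesis by auto
  next
    case False
    then have empty: "{p' \<in> P. cell g' p' \<in> W} = {}" using W_iff by (auto simp: good_def)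
    show ?thesis unfolding empty by simp
  qed
  then have W: "openin RZ W" by (auto simp: openin_RZ W_def topspace_RZ)
  have "inj_on q W"
  proof (rule inj_onI)
    fix Y Z assume YZ: "Y \<in> W" "Z \<in> W" "q Y = q Z"
    obtain g1 p1 g2 p2 where Y: "Y = cell g1 p1" "p1 \<in> P" and Z: "Z = cell g2 p2" "p2 \<in> P"
      using YZ(1,2) unfolding W_def by blast
    then obtain h where h: "p1 = p2" "lam h = 0" "\<And>i. p1 \<notin> F i \<Longrightarrow> h $ i = g1 $ i + g2 $ i"
      using YZ(3) q_cell_eq_iff[of p1 p2 g1 g2] by auto
    have "h = 0"
    proof (rule ccontr)
      assume "h \<noteq> 0"
      then obtain j where j: "h $ j = 1" "p \<notin> F j" using free[OF X(2) h(2)] by blast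
      then have "g1 $ j = g $ j" "g2 $ j = g $ j" "p1 \<notin> F j"
        using YZ(1,2) W_iff Y Z by (auto simp: good_def)
      then have "h $ j = 0" using h(3) by (metis bit_double)
      then show False using j(1) by simp
    qed
    then have "g1 $ i = g2 $ i" if "p1 \<notin> F i" for i
      using h(3)[OF that] by (metis bit_add_eq_0_iff zero_index)
    then show "Y = Z" using Y Z h(1) by (simp add: cell_eq_iff)
  qed
  moreover have "X \<in> W" using W_iff[OF X(2)] by (simp add: X(1) good_def)
  ultimately show ?thesis
    using W N by (intro exI[of _ "W \<inter> N"]) (auto intro: inj_on_subset)
qed

lemma topological_chart_lift:
  assumes c: "topological_chart M c" and W: "openin RZ W" "inj_on q W" "q ` W \<subseteq> fst c"
  shows "topological_chart RZ (W, snd c \<circ> q)"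
proof -
  have op: "open ((snd c \<circ> q) ` S)" if "openin RZ S" "S \<subseteq> W" for S
    using chart_image_open[OF c open_map_q[OF that(1)]] that(2) W(3) by (auto simp: image_comp)
  have "homeomorphic_map (subtopology RZ W) (top_of_set ((snd c \<circ> q) ` W)) (snd c \<circ> q)"
  proof (rule bijective_open_imp_homeomorphic_map)
    have WRZ: "W \<subseteq> topspace RZ" using W(1) openin_subset by blast
    have "continuous_map (subtopology RZ W) (subtopology M (fst c)) q"
      using continuous_map_from_subtopology[OF continuous_q] W(3) by (auto simp: continuous_map_in_subtopology)
    moreover have "continuous_map (subtopology M (fst c)) (top_of_set (snd c ` fst c)) (snd c)"
      using topological_chartD(4)[OF c] by (rule homeomorphic_imp_continuous_map)
    ultimately have "continuous_map (subtopology RZ W) (top_of_set (snd c ` fst c)) (snd c \<circ> q)"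
      by (rule continuous_map_compose)
    then show "continuous_map (subtopology RZ W) (top_of_set ((snd c \<circ> q) ` W)) (snd c \<circ> q)"
      by (auto simp: continuous_map_in_subtopology)
    show im: "(snd c \<circ> q) ` topspace (subtopology RZ W) = topspace (top_of_set ((snd c \<circ> q) ` W))"
      using WRZ by (simp add: Int_absorb1)
    show "inj_on (snd c \<circ> q) (topspace (subtopology RZ W))"
      using comp_inj_on[OF W(2) inj_on_subset[OF topological_chartD(2)[OF c] W(3)]] WRZ
      by (simp add: Int_absorb1)
    show "open_map (subtopology RZ W) (top_of_set ((snd c \<circ> q) ` W)) (snd c \<circ> q)"
      unfolding open_map_def
    proof (intro allI impI)
      fix S assume "openin (subtopology RZ W) S"
      then have "openin RZ S" "S \<subseteq> W" using W(1) openin_trans_full openin_imp_subset by blast+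
      then show "openin (top_of_set ((snd c \<circ> q) ` W)) ((snd c \<circ> q) ` S)"
        by (metis op image_mono open_subset)
    qed
  qed
  then show ?thesis using W(1) op[OF W(1)] by (simp add: topological_chart_def)
qed

text \<open>
  On a set \<open>W\<close> that the quotient map embeds, both charts lift to charts of the real moment-angle manifold. In
  either of them the embedding into Euclidean space is an immersion, so the transition map factors
  one immersion through the other.
\<close>

lemma regular_atlas_small_cover: "regular_atlas M (small_cover_charts P F lam)"
  unfolding regular_atlas_def
proof (intro conjI ballI)
  let ?A = "small_cover_charts P F lam"
  show ch: "topological_chart M c" if "c \<in> ?A" for c
    using that by (auto simp: small_cover_charts_def)
  fix c d x assume c: "c \<in> ?A" and d: "d \<in> ?A" and x: "x \<in> transition_domain c d"
  obtain z where z: "x = snd c z" "z \<in> fst c" "z \<in> fst d" using x by (auto simp: transition_domain_def)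
  have "z \<in> topspace M" using z(2) topological_chartD(5)[OF ch[OF c]] by blast
  then obtain X where X: "X \<in> topspace RZ" "z = q X" by (auto simp: topspace_M)
  define N where "N = {X \<in> topspace RZ. q X \<in> fst c \<inter> fst d}"
  have "openin M (fst c \<inter> fst d)" using topological_chartD(1) ch c d by (blast intro: openin_Int)
  then have N: "openin RZ N" unfolding N_def by (rule openin_continuous_map_preimage[OF continuous_q])
  obtain W where W: "openin RZ W" "X \<in> W" "W \<subseteq> N" "inj_on q W"
    using locally_injective_q[OF N, of X] X z by (auto simp: N_def)
  have qW: "q ` W \<subseteq> fst c" "q ` W \<subseteq> fst d" using W(3) by (auto simp: N_def)
  define f where "f e = rz_embedding F \<circ> inv_into W (snd e \<circ> q)" for e :: "(((bit ^ 'm) \<times> 'a) set set, 'k) chart"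
  have f: "Ck_on 1 (snd e ` q ` W) (f e)" "\<And>y. y \<in> snd e ` q ` W \<Longrightarrow> inj (frechet_derivative (f e) (at y))"
    "open (snd e ` q ` W)" "\<And>Y. Y \<in> W \<Longrightarrow> f e (snd e (q Y)) = rz_embedding F Y"
    if e: "e \<in> ?A" "q ` W \<subseteq> fst e" for e
  proof -
    have "(W, snd e \<circ> q) \<in> rz_charts P F"
      using e W by (auto simp: small_cover_charts_def)
    then show "Ck_on 1 (snd e ` q ` W) (f e)" "\<And>y. y \<in> snd e ` q ` W \<Longrightarrow> inj (frechet_derivative (f e) (at y))"
      by (auto simp: rz_charts_def smooth_on_def f_def image_comp)
    show "open (snd e ` q ` W)" using chart_image_open[OF ch[OF e(1)] open_map_q[OF W(1)] e(2)] .
    have "inj_on (snd e \<circ> q) W"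
      using W(4) inj_on_subset[OF topological_chartD(2)[OF ch[OF e(1)]] e(2)] by (rule comp_inj_on)
    then show "f e (snd e (q Y)) = rz_embedding F Y" if "Y \<in> W" for Y
      using inv_into_f_f[of "snd e \<circ> q" W Y] that by (simp add: f_def)
  qed
  have \<tau>: "transition_map c d (snd c (q Y)) = snd d (q Y)" if "Y \<in> W" for Y
    using transition_map_apply[OF ch[OF c]] qW that by blast
  have "snd c ` q ` W \<subseteq> transition_domain c d" using qW by (auto simp: transition_domain_def)
  then have cont: "continuous_on (snd c ` q ` W) (transition_map c d)"
    using continuous_on_transition_map[OF ch[OF c] ch[OF d]] continuous_on_subset by blast
  have eq: "f c y = f d (transition_map c d y)" if "y \<in> snd c ` q ` W" for y
    using that f(4)[OF c qW(1)] f(4)[OF d qW(2)] \<tau> by auto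
  have im: "transition_map c d ` snd c ` q ` W \<subseteq> snd d ` q ` W" using \<tau> by auto
  have xW: "x \<in> snd c ` q ` W" using z(1) X(2) W(2) by blast
  note * = sign_det_factor_through_immersion[OF f(3)[OF c qW(1)] f(3)[OF d qW(2)] cont im
      f(1)[OF d qW(2)] f(2)[OF d qW(2)] f(1)[OF c qW(1)] f(2)[OF c qW(1)] eq xW]
  show "transition_map c d differentiable at x" "det (jac c d x) \<noteq> 0"
    "isCont (\<lambda>y. sgn (det (jac c d y))) x"
    using * by blast+
qed

end

section \<open>Charts straddling a facet\<close>

text \<open>
  The polytope is cut out by the inequalities \<open>a i \<bullet> p \<le> b i\<close>, scaled so that \<open>b i - a i \<bullet> p\<close> is the
  distance to the hyperplane of the facet \<open>F i\<close>. For every facet there are linear coordinates \<open>L i\<close>, all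
  of the same orientation, whose component \<open>k\<^sub>0\<close> measures the direction transverse to \<open>F i\<close>.
\<close>

locale facet_charts = small_cover P F lam
  for P :: "'a::euclidean_space set" and F :: "'m::finite \<Rightarrow> 'a set"
    and lam :: "bit ^ 'm \<Rightarrow> bit ^ 'k::finite" +
  fixes a :: "'m \<Rightarrow> 'a" and b :: "'m \<Rightarrow> real"
    and L :: "'m \<Rightarrow> 'a \<Rightarrow> real ^ 'k" and L' :: "'m \<Rightarrow> real ^ 'k \<Rightarrow> 'a" and k\<^sub>0 :: 'k
  assumes P_eq: "P = {p. \<forall>i. a i \<bullet> p \<le> b i}"
    and F_eq: "\<And>i. F i = {p \<in> P. a i \<bullet> p = b i}"
    and infdist_facet: "\<And>i p. p \<in> P \<Longrightarrow> infdist p (affine hull F i) = b i - a i \<bullet> p"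
    and facet_point: "\<And>i. \<exists>p\<in>F i. \<forall>j. j \<noteq> i \<longrightarrow> a j \<bullet> p < b j"
    and interior_point: "\<exists>p. \<forall>j. a j \<bullet> p < b j"
    and spanning: "\<And>w. (\<And>i. a i \<bullet> w = 0) \<Longrightarrow> w = 0"
    and linear_L: "\<And>i. linear (L i)" and linear_L': "\<And>i. linear (L' i)"
    and L_L': "\<And>i z. L i (L' i z) = z" and L'_L: "\<And>i p. L' i (L i p) = p"
    and L_k0: "\<And>i p. L i p $ k\<^sub>0 = - (a i \<bullet> p)"
    and det_L: "\<And>i j. det (matrix (L j \<circ> L' i)) = 1"
begin

definition lev :: "'m \<Rightarrow> 'a \<Rightarrow> real" where
  "lev j p = b j - a j \<bullet> p"

text \<open>
  Squaring the transverse coordinate folds the space along the wall \<open>x $ k\<^sub>0 = 0\<close>, just as the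
  projection to \<open>P\<close> folds the chambers on the two sides of a facet onto each other.
\<close>

definition folding :: "real ^ 'k \<Rightarrow> real ^ 'k" where
  "folding x = (\<chi> k. if k = k\<^sub>0 then (x $ k\<^sub>0)\<^sup>2 else x $ k)"

definition reflect :: "real ^ 'k \<Rightarrow> real ^ 'k" where
  "reflect x = (\<chi> k. if k = k\<^sub>0 then - x $ k\<^sub>0 else x $ k)"

text \<open>
  The point of the ambient space of \<open>P\<close> whose distance to the hyperplane of \<open>F i\<close> is the square of the
  coordinate \<open>x $ k\<^sub>0\<close> and whose remaining coordinates with respect to \<open>L i\<close> are those of \<open>x\<close>.
\<close>

definition pt :: "'m \<Rightarrow> real ^ 'k \<Rightarrow> 'a" where
  "pt i x = L' i (folding x - axis k\<^sub>0 (b i))"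

text \<open>
  The preimage of \<open>p\<close> under \<open>pt i\<close> on the nonnegative side of the wall; the other preimage is its
  reflection.
\<close>

definition coords :: "'m \<Rightarrow> 'a \<Rightarrow> real ^ 'k" where
  "coords i p = (\<chi> k. if k = k\<^sub>0 then sqrt (lev i p) else L i p $ k)"

text \<open>
  For these \<open>x\<close> the point \<open>pt i x\<close> lies in \<open>P\<close> and in no facet except possibly \<open>F i\<close>.
\<close>

definition Dom :: "'m \<Rightarrow> (real ^ 'k) set" where
  "Dom i = {x. \<forall>j. j \<noteq> i \<longrightarrow> 0 < lev j (pt i x)}"

definition side :: "'m \<Rightarrow> real ^ 'k \<Rightarrow> bit ^ 'm" where
  "side i x = (if x $ k\<^sub>0 < 0 then axis i 1 else 0)"

definition lift :: "bit ^ 'm \<Rightarrow> 'm \<Rightarrow> real ^ 'k \<Rightarrow> ((bit ^ 'm) \<times> 'a) set" where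
  "lift g i x = cell (g + side i x) (pt i x)"

definition psi :: "bit ^ 'm \<Rightarrow> 'm \<Rightarrow> real ^ 'k \<Rightarrow> ((bit ^ 'm) \<times> 'a) set set" where
  "psi g i x = q (lift g i x)"

definition chart :: "bit ^ 'm \<Rightarrow> 'm \<Rightarrow> (((bit ^ 'm) \<times> 'a) set set, 'k) chart" where
  "chart g i = (psi g i ` Dom i, inv_into (Dom i) (psi g i))"

lemma L_pt: "L i (pt i x) = folding x - axis k\<^sub>0 (b i)"
  by (simp add: pt_def L_L')

lemma lev_pt [simp]: "lev i (pt i x) = (x $ k\<^sub>0)\<^sup>2"
  using L_k0[of i "pt i x"] by (simp add: L_pt lev_def folding_def axis_def)

lemma P_iff_lev: "p \<in> P \<longleftrightarrow> (\<forall>j. 0 \<le> lev j p)"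
  by (simp add: P_eq lev_def)

lemma F_iff_lev: "p \<in> P \<Longrightarrow> p \<in> F j \<longleftrightarrow> lev j p = 0"
  by (auto simp: F_eq lev_def)

lemma pt_in_P: "x \<in> Dom i \<Longrightarrow> pt i x \<in> P"
  unfolding P_iff_lev Dom_def by (metis (mono_tags, lifting) less_imp_le lev_pt mem_Collect_eq zero_le_power2)

lemma pt_notin_F: "x \<in> Dom i \<Longrightarrow> j \<noteq> i \<Longrightarrow> pt i x \<notin> F j"
  using F_iff_lev[OF pt_in_P, of x i j] by (auto simp: Dom_def)

lemma pt_in_F_iff: "x \<in> Dom i \<Longrightarrow> pt i x \<in> F i \<longleftrightarrow> x $ k\<^sub>0 = 0"
  using F_iff_lev[OF pt_in_P, of x i i] by simp

lemma pt_coords: "0 \<le> lev i p \<Longrightarrow> pt i (coords i p) = p"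
proof -
  assume "0 \<le> lev i p"
  then have "folding (coords i p) - axis k\<^sub>0 (b i) = L i p"
    using L_k0[of i p] by (auto simp: folding_def coords_def axis_def vec_eq_iff lev_def)
  then show ?thesis by (simp add: pt_def L'_L)
qed

lemma folding_reflect [simp]: "folding (reflect x) = folding x"
  by (simp add: folding_def reflect_def vec_eq_iff)

lemma pt_reflect [simp]: "pt i (reflect x) = pt i x"
  by (simp add: pt_def)

lemma reflect_reflect [simp]: "reflect (reflect x) = x"
  by (simp add: reflect_def vec_eq_iff)

lemma reflect_in_Dom [simp]: "reflect x \<in> Dom i \<longleftrightarrow> x \<in> Dom i"
  by (simp add: Dom_def)

lemma coords_pt: "coords i (pt i x) = (if x $ k\<^sub>0 < 0 then reflect x else x)"
  by (auto simp: coords_def reflect_def vec_eq_iff L_pt folding_def axis_def)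

lemma coords_in_Dom: "0 \<le> lev i p \<Longrightarrow> coords i p \<in> Dom i \<longleftrightarrow> (\<forall>j. j \<noteq> i \<longrightarrow> 0 < lev j p)"
  by (simp add: Dom_def pt_coords)

lemma coords_k0: "coords i p $ k\<^sub>0 = sqrt (lev i p)"
  by (simp add: coords_def)

lemma lam_axis: "lam (axis i 1) \<noteq> 0"
proof
  assume 0: "lam (axis i 1) = 0"
  obtain p where p: "p \<in> F i" using facet_point[of i] by blast
  then have "p \<in> P" using F_eq by auto
  moreover have "axis i 1 \<noteq> (0 :: bit ^ 'm)" by (simp add: axis_eq_0_iff)
  ultimately obtain j where "axis i (1 :: bit) $ j = 1" "p \<notin> F j" using free[OF _ 0] by blast
  then show False using p by (auto simp: axis_def split: if_splits)
qed

lemma psi_reflect: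
  assumes "x \<in> Dom i"
  shows "psi (g + axis i 1) i x = psi g i (reflect x)"
proof (cases "x $ k\<^sub>0 = 0")
  case True
  then have "reflect x = x" by (simp add: reflect_def vec_eq_iff)
  moreover have "cell (g + axis i 1 + side i x) (pt i x) = cell (g + side i x) (pt i x)"
    using pt_in_P[OF assms] pt_in_F_iff[OF assms] True
    by (auto simp: cell_eq_iff axis_def)
  ultimately show ?thesis by (simp add: psi_def lift_def)
next
  case False
  then have e: "g + axis i 1 + side i x = g + side i (reflect x)"
    by (auto simp: side_def reflect_def add.assoc)
  show ?thesis unfolding psi_def lift_def e pt_reflect ..
qed

lemma psi_shift: "lam h = 0 \<Longrightarrow> x \<in> Dom i \<Longrightarrow> psi (h + g) i x = psi g i x"
  unfolding psi_def lift_def using q_shift[OF pt_in_P, of x i h "g + side i x"] by (simp add: add.assoc)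

text \<open>
  Over a point \<open>p\<close> in the interior of \<open>P\<close> the chart contains one point of the chamber \<open>g\<close> and one of
  the chamber \<open>g + e\<^sub>i\<close>, with coordinates \<open>coords i p\<close> and its reflection. They coincide for \<open>p \<in> F i\<close>.
\<close>

lemma q_cell_eq_psi_iff:
  assumes p: "p \<in> P" and x: "x \<in> Dom i"
  shows "q (cell g' p) = psi g i x \<longleftrightarrow>
    p = pt i x \<and> (lam (g' + g) = 0 \<and> x = coords i p \<or> lam (g' + g + axis i 1) = 0 \<and> x = reflect (coords i p))"
    (is "_ \<longleftrightarrow> ?R")
proof
  assume "q (cell g' p) = psi g i x"
  then obtain h where h: "p = pt i x" "lam h = 0" "\<And>l. p \<notin> F l \<Longrightarrow> h $ l = g' $ l + (g + side i x) $ l"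
    using q_cell_eq_iff[OF p pt_in_P[OF x]] by (auto simp: psi_def lift_def)
  show ?R
  proof (cases "x $ k\<^sub>0 = 0")
    case False
    then have "p \<notin> F l" for l using pt_notin_F[OF x] pt_in_F_iff[OF x] h(1) by metis
    then have "h = g' + (g + side i x)" using h(3) by (simp add: vec_eq_iff)
    then show ?thesis using h(1,2) False
      by (auto simp: side_def coords_pt add.assoc)
  next
    case True
    then have x_eq: "x = coords i p" "x = reflect (coords i p)"
      using h(1) by (auto simp: coords_pt reflect_def vec_eq_iff)
    have hl: "h $ l = (g' + g) $ l" if "l \<noteq> i" for l
      using h(3)[of l] pt_notin_F[OF x that] True h(1) by (simp add: side_def)
    have "h = g' + g \<or> h = g' + g + axis i 1"
    proof (cases "h $ i = (g' + g) $ i")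
      case True
      then show ?thesis using hl by (metis vec_eq_iff)
    next
      case False
      then have "h $ i = (g' + g) $ i + 1" by (cases "h $ i"; cases "(g' + g) $ i") simp_all
      then have "h $ l = (g' + g + axis i 1) $ l" for l
        using hl[of l]
        by (cases "l = i") (simp_all only: vector_add_component axis_def vec_lambda_beta add_0_right
            simp_thms if_True if_False)
      then show ?thesis by (simp add: vec_eq_iff)
    qed
    then have "lam (g' + g) = 0 \<or> lam (g' + g + axis i 1) = 0" using h(2) by blast
    then show ?thesis using x_eq h(1) by blast
  qed
next
  assume asm: ?R
  have r: "coords i p $ k\<^sub>0 \<ge> 0" using p by (simp add: coords_k0 P_iff_lev)
  have pr: "pt i (coords i p) = p" using p by (simp add: pt_coords P_iff_lev)
  have psi_coords: "psi g i (coords i p) = q (cell g p)" for g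
    using r pr by (simp add: psi_def lift_def side_def)
  have sh: "q (cell g' p) = q (cell g p)" if "lam (g' + g) = 0" for g
    using q_shift[OF p that, of g] by (simp add: add.assoc)
  from asm consider (A) "lam (g' + g) = 0" "x = coords i p"
    | (B) "lam (g' + (g + axis i 1)) = 0" "x = reflect (coords i p)" by (auto simp: add.assoc)
  then show "q (cell g' p) = psi g i x"
  proof cases
    case A
    show ?thesis unfolding A(2) psi_coords using sh[OF A(1)] .
  next
    case B
    have "coords i p \<in> Dom i" using x unfolding B(2) by simp
    from psi_reflect[OF this, of g] show ?thesis
      unfolding B(2) psi_coords using sh[OF B(1)] by simp
  qed
qed

lemma inj_psi: "inj_on (psi g i) (Dom i)"
proof (rule inj_onI)
  fix x y assume x: "x \<in> Dom i" and y: "y \<in> Dom i" and eq: "psi g i x = psi g i y"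
  have "q (cell (g + side i x) (pt i x)) = psi g i y" unfolding eq[symmetric] by (simp add: psi_def lift_def)
  note * = conjunct2[OF iffD1[OF q_cell_eq_psi_iff[OF pt_in_P[OF x] y] this]]
  have gg: "g + side i x + g = side i x" by (metis add.commute bit_vec_cancel)
  show "x = y"
    using * lam_axis[of i] unfolding gg coords_pt by (auto simp: side_def split: if_splits)
qed

lemma continuous_folding: "continuous_on S folding"
  unfolding folding_def
proof (rule continuous_on_vec_lambda)
  show "continuous_on S (\<lambda>x. if k = k\<^sub>0 then (x $ k\<^sub>0)\<^sup>2 else x $ k)" for k
    by (cases "k = k\<^sub>0") (auto intro!: continuous_intros)
qed

lemma continuous_pt: "continuous_on S (pt i)"
proof -
  have "continuous_on UNIV (L' i)"
    using linear_L' by (simp add: linear_continuous_on linear_conv_bounded_linear)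
  moreover have "continuous_on S (\<lambda>x. folding x - axis k\<^sub>0 (b i))"
    by (intro continuous_intros continuous_folding)
  ultimately show ?thesis unfolding pt_def using continuous_on_compose2 by blast
qed

lemma continuous_lev: "continuous_on S (lev j)"
  unfolding lev_def by (intro continuous_intros)

lemma continuous_coords: "continuous_on S (coords i)"
proof -
  have "continuous_on S (L i)"
    using linear_L by (simp add: linear_continuous_on linear_conv_bounded_linear)
  then show ?thesis
    unfolding coords_def
  proof (intro continuous_on_vec_lambda)
    assume "continuous_on S (L i)"
    then show "continuous_on S (\<lambda>p. if k = k\<^sub>0 then sqrt (lev i p) else L i p $ k)" for k
      by (cases "k = k\<^sub>0") (auto intro!: continuous_intros continuous_lev)
  qed
qed

lemma continuous_reflect: "continuous_on S reflect"
  unfolding reflect_def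
proof (rule continuous_on_vec_lambda)
  show "continuous_on S (\<lambda>x. if k = k\<^sub>0 then - x $ k\<^sub>0 else x $ k)" for k
    by (cases "k = k\<^sub>0") (auto intro!: continuous_intros)
qed

lemma open_Dom: "open (Dom i)"
proof -
  have "Dom i = (\<Inter>j\<in>-{i}. {x. 0 < lev j (pt i x)})" by (auto simp: Dom_def)
  moreover have "open {x. 0 < lev j (pt i x)}" for j
    by (intro open_Collect_less continuous_intros continuous_on_compose2[OF continuous_lev[of UNIV j] continuous_pt]) auto
  ultimately show ?thesis by (simp add: open_INT)
qed

lemma continuous_lift: "continuous_map (top_of_set (Dom i)) RZ (lift g i)"
proof -
  have pt: "continuous_map (top_of_set (Dom i)) (top_of_set P) (pt i)"
    using continuous_pt pt_in_P by (auto simp: continuous_map_in_subtopology)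
  have c: "continuous_map (top_of_set (Dom i)) RZ (\<lambda>x. cell h (pt i x))" for h
    using continuous_map_compose[OF pt continuous_cell[of h]] by (simp add: o_def)
  have "continuous_map (top_of_set (Dom i)) RZ
      (\<lambda>x. if 0 \<le> x $ k\<^sub>0 then cell g (pt i x) else cell (g + axis i 1) (pt i x))"
  proof (rule continuous_map_cases_le)
    show "continuous_map (top_of_set (Dom i)) euclideanreal (\<lambda>x. x $ k\<^sub>0)"
      by (simp add: continuous_on_component continuous_on_id)
    show "cell g (pt i x) = cell (g + axis i 1) (pt i x)"
      if "x \<in> topspace (top_of_set (Dom i))" "0 = x $ k\<^sub>0" for x
    proof -
      have x: "x \<in> Dom i" using that by simp
      show ?thesis using pt_in_P[OF x] pt_in_F_iff[OF x] that(2)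
        by (auto simp: cell_eq_iff axis_def)
    qed
  qed (auto intro: continuous_map_from_subtopology c)
  then show ?thesis
    by (rule continuous_map_eq) (auto simp: lift_def side_def)
qed

lemma continuous_psi: "continuous_map (top_of_set (Dom i)) M (psi g i)"
proof -
  have "psi g i = q \<circ> lift g i" by (rule ext) (simp add: psi_def)
  then show ?thesis using continuous_map_compose[OF continuous_lift continuous_q] by metis
qed

lemma open_psi:
  assumes O: "open S" "S \<subseteq> Dom i"
  shows "openin M (psi g i ` S)"
proof -
  have "openin (top_of_set P) {p \<in> P. q (cell g' p) \<in> psi g i ` S}" for g'
  proof -
    have eq: "{p \<in> P. q (cell g' p) \<in> psi g i ` S} =
      {p \<in> P. lam (g' + g) = 0 \<and> coords i p \<in> S} \<union> {p \<in> P. lam (g' + g + axis i 1) = 0 \<and> reflect (coords i p) \<in> S}"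
      (is "_ = ?R")
    proof (intro set_eqI iffI)
      fix p assume "p \<in> {p \<in> P. q (cell g' p) \<in> psi g i ` S}"
      then obtain x where x: "p \<in> P" "x \<in> S" "q (cell g' p) = psi g i x" by blast
      then have "x \<in> Dom i" using O(2) by blast
      then show "p \<in> ?R"
        using q_cell_eq_psi_iff[OF x(1), of x i g' g] x by auto
    next
      fix p assume p: "p \<in> ?R"
      then have pP: "p \<in> P" by blast
      have pr: "pt i (coords i p) = p" using pP by (simp add: pt_coords P_iff_lev)
      have rD: "coords i p \<in> Dom i" using p O(2) reflect_in_Dom by blast
      from p consider (A) "lam (g' + g) = 0" "coords i p \<in> S"
        | (B) "lam (g' + g + axis i 1) = 0" "reflect (coords i p) \<in> S" by blast
      then show "p \<in> {p \<in> P. q (cell g' p) \<in> psi g i ` S}"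
      proof cases
        case A
        then have "q (cell g' p) = psi g i (coords i p)"
          using iffD2[OF q_cell_eq_psi_iff[OF pP rD]] pr by simp
        then show ?thesis using A(2) pP by blast
      next
        case B
        have "reflect (coords i p) \<in> Dom i" using rD by simp
        from iffD2[OF q_cell_eq_psi_iff[OF pP this]]
        have "q (cell g' p) = psi g i (reflect (coords i p))" using B(1) pr by simp
        then show ?thesis using B(2) pP by blast
      qed
    qed
    have 1: "openin (top_of_set P) {p \<in> P. coords i p \<in> S}"
      using continuous_openin_preimage_gen[OF continuous_coords O(1), of P i] by (simp add: vimage_def Int_def)
    have "continuous_on P (\<lambda>p. reflect (coords i p))"
      using continuous_on_compose2[OF continuous_reflect continuous_coords] by blast
    from continuous_openin_preimage_gen[OF this O(1)]
    have 2: "openin (top_of_set P) {p \<in> P. reflect (coords i p) \<in> S}"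
      by (simp add: vimage_def Int_def)
    have guard: "openin (top_of_set P) {p \<in> P. C \<and> B p}" if "openin (top_of_set P) {p \<in> P. B p}" for B C
      using that by (cases C) simp_all
    show ?thesis unfolding eq by (intro openin_Un guard 1 2)
  qed
  moreover have "psi g i ` S \<subseteq> topspace M"
    using continuous_map_image_subset_topspace[OF continuous_psi[of i g]] O(2) by auto
  ultimately show ?thesis by (simp add: openin_M)
qed

lemma psi_Dom_in_M: "psi g i ` Dom i \<subseteq> topspace M"
  using openin_subset[OF open_psi[OF open_Dom order.refl]] .

lemma phi_psi [simp]: "x \<in> Dom i \<Longrightarrow> inv_into (Dom i) (psi g i) (psi g i x) = x"
  using inv_into_f_f[OF inj_psi] .

lemma phi_image: "inv_into (Dom i) (psi g i) ` psi g i ` Dom i = Dom i"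
  by (force simp: image_image)

lemma topological_chart_chart: "topological_chart M (chart g i)"
proof -
  let ?U = "psi g i ` Dom i"
  have "homeomorphic_map (top_of_set (Dom i)) (subtopology M ?U) (psi g i)"
  proof (rule bijective_open_imp_homeomorphic_map)
    show "continuous_map (top_of_set (Dom i)) (subtopology M ?U) (psi g i)"
      using continuous_psi by (simp add: continuous_map_in_subtopology)
    show "psi g i ` topspace (top_of_set (Dom i)) = topspace (subtopology M ?U)"
      using psi_Dom_in_M by auto
    show "inj_on (psi g i) (topspace (top_of_set (Dom i)))" using inj_psi by simp
    show "open_map (top_of_set (Dom i)) (subtopology M ?U) (psi g i)"
      unfolding open_map_def
    proof (intro allI impI)
      fix S assume "openin (top_of_set (Dom i)) S"
      then have S: "open S" "S \<subseteq> Dom i" using open_Dom openin_open_trans openin_imp_subset by blast+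
      then show "openin (subtopology M ?U) (psi g i ` S)"
        unfolding openin_subtopology
        by (intro exI[of _ "psi g i ` S"] conjI open_psi) auto
    qed
  qed
  then obtain f where f: "homeomorphic_maps (top_of_set (Dom i)) (subtopology M ?U) (psi g i) f"
    unfolding homeomorphic_map_maps by blast
  have "homeomorphic_map (subtopology M ?U) (top_of_set (Dom i)) (inv_into (Dom i) (psi g i))"
  proof (rule homeomorphic_map_eq)
    show "homeomorphic_map (subtopology M ?U) (top_of_set (Dom i)) f"
      using f homeomorphic_maps_map homeomorphic_maps_sym by blast
    fix z assume "z \<in> topspace (subtopology M ?U)"
    then obtain x where "x \<in> Dom i" "z = psi g i x" by auto
    then show "f z = inv_into (Dom i) (psi g i) z" using f by (simp add: homeomorphic_maps_def)
  qed
  then show ?thesis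
    unfolding topological_chart_def chart_def prod.case phi_image
    using open_psi[OF open_Dom order.refl] open_Dom by blast
qed

text \<open>
  The embedding of the real moment-angle manifold into Euclidean space in the coordinates of \<open>lift g i\<close>. In the component
  \<open>i\<close> the sign and the square root combine to the smooth function \<open>x $ k\<^sub>0\<close>.
\<close>

definition emb :: "bit ^ 'm \<Rightarrow> 'm \<Rightarrow> real ^ 'k \<Rightarrow> real ^ 'm" where
  "emb g i x = (\<chi> j. (if g $ j = 0 then 1 else - 1) * (if j = i then x $ k\<^sub>0 else sqrt (lev j (pt i x))))"

text \<open>
  The derivative of \<open>folding\<close> at \<open>x\<close> in the direction \<open>v\<close>.
\<close>

definition dfold :: "real ^ 'k \<Rightarrow> real ^ 'k \<Rightarrow> real ^ 'k" where
  "dfold x v = (\<chi> k. if k = k\<^sub>0 then 2 * x $ k\<^sub>0 * v $ k\<^sub>0 else v $ k)"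

lemma rz_embedding_lift:
  assumes x: "x \<in> Dom i"
  shows "rz_embedding F (lift g i x) = emb g i x"
proof -
  have "rz_embedding F (lift g i x) = rz_coordinates F (g + side i x, pt i x)"
    unfolding lift_def cell_def by (rule rz_embedding_class[OF pt_in_P[OF x]])
  also have "\<dots> $ j = emb g i x $ j" for j
  proof (cases "j = i")
    case True
    then show ?thesis
      using pt_in_P[OF x] lev_pt[of i x]
      by (cases "g $ i") (auto simp: rz_coordinates_def infdist_facet lev_def emb_def side_def axis_def)
  next
    case False
    then show ?thesis
      using pt_in_P[OF x]
      by (auto simp: rz_coordinates_def infdist_facet lev_def emb_def side_def axis_def)
  qed
  then show ?thesis using calculation by (simp add: vec_eq_iff)
qed

lemma has_derivative_folding: "(folding has_derivative dfold x) (at x)"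
proof (rule has_derivative_vec)
  fix k
  show "((\<lambda>x. folding x $ k) has_derivative (\<lambda>v. dfold x v $ k)) (at x)"
  proof (cases "k = k\<^sub>0")
    case True
    have "((\<lambda>x. (x $ k\<^sub>0)\<^sup>2) has_derivative (\<lambda>v. 2 * x $ k\<^sub>0 * v $ k\<^sub>0)) (at x)"
      by (auto intro!: derivative_eq_intros bounded_linear_imp_has_derivative bounded_linear_vec_nth)
    then show ?thesis using True by (simp add: folding_def dfold_def)
  next
    case False
    then show ?thesis
      by (simp add: folding_def dfold_def bounded_linear_imp_has_derivative bounded_linear_vec_nth)
  qed
qed

lemma has_derivative_pt: "(pt i has_derivative (\<lambda>v. L' i (dfold x v))) (at x)"
proof -
  have "bounded_linear (L' i)" using linear_L' linear_conv_bounded_linear by blast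
  then have "((\<lambda>x. L' i (folding x - axis k\<^sub>0 (b i))) has_derivative (\<lambda>v. L' i (dfold x v - 0))) (at x)"
    by (rule bounded_linear.has_derivative[OF _ has_derivative_diff[OF has_derivative_folding has_derivative_const]])
  then show ?thesis by (simp add: pt_def[abs_def])
qed

lemma Ck_on_folding: "open S \<Longrightarrow> Ck_on k S folding"
proof (rule Ck_on_vec)
  fix l
  assume S: "open S"
  have n: "Ck_on k S (\<lambda>x. x $ j)" for j :: 'k
    by (intro Ck_on_linear S bounded_linear_vec_nth)
  show "Ck_on k S (\<lambda>x. folding x $ l)"
    using n Ck_on_mult[OF S n n] by (cases "l = k\<^sub>0") (simp_all add: folding_def power2_eq_square)
qed

lemma Ck_on_lev_pt:
  assumes S: "open S"
  shows "Ck_on k S (\<lambda>x. lev j (pt i x))"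
proof -
  have "bounded_linear (L' i)" using linear_L' linear_conv_bounded_linear by blast
  then have "bounded_linear (\<lambda>z. - (a j \<bullet> L' i z))"
    by (intro bounded_linear_minus) (rule bounded_linear_compose[OF bounded_linear_inner_right])
  then have "Ck_on k S (\<lambda>x. (b j + a j \<bullet> L' i (axis k\<^sub>0 (b i))) + - (a j \<bullet> L' i (folding x)))"
    by (intro Ck_on_add S Ck_on_const Ck_on_compose_linear[OF S _ Ck_on_folding[OF S]])
  then show ?thesis
    by (simp add: lev_def pt_def linear_diff[OF linear_L'] inner_diff_right algebra_simps)
qed

lemma Ck_on_emb: "Ck_on k (Dom i) (emb g i)"
proof (rule Ck_on_vec[OF open_Dom])
  fix j
  define \<epsilon> :: real where "\<epsilon> = (if g $ j = 0 then 1 else - 1)"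
  show "Ck_on k (Dom i) (\<lambda>x. emb g i x $ j)"
  proof (cases "j = i")
    case True
    have "Ck_on k (Dom i) (\<lambda>x. \<epsilon> * x $ k\<^sub>0)"
      by (intro Ck_on_mult Ck_on_const Ck_on_linear open_Dom bounded_linear_vec_nth)
    then show ?thesis using True by (simp add: emb_def \<epsilon>_def)
  next
    case False
    then have pos: "0 < lev j (pt i x)" if "x \<in> Dom i" for x using that by (simp add: Dom_def)
    have "Ck_on k (Dom i) (\<lambda>x. \<epsilon> * lev j (pt i x) powr (1/2))"
      by (intro Ck_on_mult Ck_on_const Ck_on_powr open_Dom Ck_on_lev_pt pos)
    then show ?thesis
      by (rule Ck_on_cong[OF open_Dom])
        (use False pos in \<open>simp add: emb_def \<epsilon>_def powr_half_sqrt less_imp_le\<close>)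
  qed
qed

text \<open>
  The squares of the components of \<open>emb g i\<close> are the distances of \<open>pt i x\<close> to the hyperplanes of the
  facets. A direction in which \<open>emb g i\<close> is stationary is thus one in which \<open>pt i\<close> is, and the
  component \<open>i\<close> takes care of the coordinate \<open>k\<^sub>0\<close>, in which \<open>pt i\<close> degenerates on the wall.
\<close>

lemma inj_derivative_emb:
  assumes x: "x \<in> Dom i"
  shows "inj (frechet_derivative (emb g i) (at x))"
proof -
  let ?E = "frechet_derivative (emb g i) (at x)"
  have E: "(emb g i has_derivative ?E) (at x)"
    using Ck_on_derivD[OF Ck_on_emb[of "Suc 0"] x] .
  have Ej: "((\<lambda>y. emb g i y $ j) has_derivative (\<lambda>v. ?E v $ j)) (at x)" for j
    by (rule bounded_linear.has_derivative[OF bounded_linear_vec_nth E])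
  have sq: "(emb g i y $ j)\<^sup>2 = lev j (pt i y)" if "y \<in> Dom i" for y j
    using that by (auto simp: emb_def power_mult_distrib Dom_def less_imp_le)
  have "v = 0" if v: "?E v = 0" for v
  proof -
    have "a j \<bullet> L' i (dfold x v) = 0" for j
    proof -
      have "((\<lambda>y. (emb g i y $ j)\<^sup>2) has_derivative (\<lambda>v. 2 * emb g i x $ j * ?E v $ j)) (at x)"
        by (auto intro!: derivative_eq_intros Ej)
      then have 1: "((\<lambda>y. lev j (pt i y)) has_derivative (\<lambda>v. 2 * emb g i x $ j * ?E v $ j)) (at x)"
        by (rule has_derivative_transform_within_open[OF _ open_Dom x sq])
      have "((\<lambda>y. b j - a j \<bullet> pt i y) has_derivative (\<lambda>v. 0 - a j \<bullet> L' i (dfold x v))) (at x)"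
        by (intro has_derivative_diff has_derivative_const has_derivative_inner_right has_derivative_pt)
      then have 2: "((\<lambda>y. lev j (pt i y)) has_derivative (\<lambda>v. - (a j \<bullet> L' i (dfold x v)))) (at x)"
        by (simp add: lev_def)
      show ?thesis using fun_cong[OF has_derivative_unique[OF 1 2], of v] v by simp
    qed
    then have "L' i (dfold x v) = 0" by (rule spanning)
    then have "dfold x v = 0" using L_L'[of i "dfold x v"] linear_0[OF linear_L] by metis
    then have 3: "v $ k = 0" if "k \<noteq> k\<^sub>0" for k
      using that by (auto simp: dfold_def vec_eq_iff split: if_splits)
    have "((\<lambda>y. (if g $ i = 0 then 1 else - 1) * y $ k\<^sub>0) has_derivative (\<lambda>v. (if g $ i = 0 then 1 else - 1) * v $ k\<^sub>0)) (at x)"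
      by (intro has_derivative_mult_right bounded_linear_imp_has_derivative bounded_linear_vec_nth)
    then have "((\<lambda>y. emb g i y $ i) has_derivative (\<lambda>v. (if g $ i = 0 then 1 else - 1) * v $ k\<^sub>0)) (at x)"
      by (simp add: emb_def)
    from fun_cong[OF has_derivative_unique[OF this Ej], of v]
    have "v $ k\<^sub>0 = 0" using v by (simp split: if_splits)
    then have "v $ k = 0" for k using 3 by (cases "k = k\<^sub>0") auto
    then show ?thesis by (simp add: vec_eq_iff)
  qed
  then show ?thesis using linear_injective_0[OF has_derivative_linear[OF E]] by blast
qed

text \<open>
  A local lift of the chart takes values in a translate of \<open>lift g i\<close> by a kernel element \<open>h\<close>, which is
  constant locally. The embedding is then given by \<open>emb (h + g) i\<close>.
\<close>

lemma chart_in_atlas: "chart g i \<in> small_cover_charts P F lam"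
proof -
  let ?\<phi> = "snd (chart g i)"
  have "(W, ?\<phi> \<circ> q) \<in> rz_charts P F"
    if W: "openin RZ W" "inj_on q W" "q ` W \<subseteq> fst (chart g i)" for W
  proof -
    let ?f = "rz_embedding F \<circ> inv_into W (?\<phi> \<circ> q)"
    have inj: "inj_on (?\<phi> \<circ> q) W"
      using comp_inj_on[OF W(2) inj_on_subset[OF topological_chartD(2)[OF topological_chart_chart] W(3)]] .
    have local: "\<exists>T h. open T \<and> x \<in> T \<and> T \<subseteq> Dom i \<and> (\<forall>y\<in>T. ?f y = emb (h + g) i y)"
      if x: "x \<in> (?\<phi> \<circ> q) ` W" for x
    proof -
      obtain X where X: "X \<in> W" "x = ?\<phi> (q X)" using x by auto
      then obtain x' where x': "x' \<in> Dom i" "q X = psi g i x'" using W(3) by (auto simp: chart_def)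
      then have "x = x'" using X(2) by (simp add: chart_def)
      then have qX: "q X = q (lift g i x)" "x \<in> Dom i" using x' by (simp_all add: psi_def)
      obtain g' p' where "X = cell g' p'" "p' \<in> P"
        using openin_subset[OF W(1)] X(1) topspace_RZ by blast
      then have "X = rz_action 0 X" by (simp add: rz_action_cell)
      then have "X \<in> q X" unfolding kernel_orbit_def using lam.zero by blast
      then have "X \<in> q (lift g i x)" by (simp only: qX(1))
      then obtain h where h: "lam h = 0" "X = rz_action h (lift g i x)"
        unfolding kernel_orbit_def by blast
      then have Xh: "X = lift (h + g) i x" by (simp add: lift_def rz_action_cell add.assoc)
      define T where "T = {y \<in> Dom i. lift (h + g) i y \<in> W}"
      have "openin (top_of_set (Dom i)) T"
        using openin_continuous_map_preimage[OF continuous_lift W(1), of i "h + g"] by (simp add: T_def)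
      then have "open T" using open_Dom openin_open_trans by blast
      moreover have "?f y = emb (h + g) i y" if y: "y \<in> T" for y
      proof -
        have y': "y \<in> Dom i" "lift (h + g) i y \<in> W" using y by (auto simp: T_def)
        have "(?\<phi> \<circ> q) (lift (h + g) i y) = y"
          using psi_shift[OF h(1) y'(1), of g] phi_psi[OF y'(1), of g] by (simp add: chart_def psi_def)
        then have "inv_into W (?\<phi> \<circ> q) y = lift (h + g) i y"
          using inv_into_f_f[OF inj y'(2)] by simp
        then show ?thesis using rz_embedding_lift[OF y'(1)] by simp
      qed
      ultimately show ?thesis using X(1) Xh qX(2) by (intro exI[of _ T] exI[of _ h]) (auto simp: T_def)
    qed
    have "smooth_on ((?\<phi> \<circ> q) ` W) ?f"
      unfolding smooth_on_def
    proof (intro allI Ck_on_local)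
      fix k x assume "x \<in> (?\<phi> \<circ> q) ` W"
      from local[OF this] obtain T h where T: "open T" "x \<in> T" "T \<subseteq> Dom i" "\<forall>y\<in>T. ?f y = emb (h + g) i y"
        by blast
      show "\<exists>T g. open T \<and> x \<in> T \<and> Ck_on k T g \<and> (\<forall>y\<in>T. ?f y = g y)"
        by (intro exI[of _ T] exI[of _ "emb (h + g) i"] conjI T Ck_on_subset[OF Ck_on_emb T(3)])
    qed
    moreover have "inj (frechet_derivative ?f (at x))" if "x \<in> (?\<phi> \<circ> q) ` W" for x
    proof -
      from local[OF that] obtain T h where T: "open T" "x \<in> T" "T \<subseteq> Dom i" "\<forall>y\<in>T. ?f y = emb (h + g) i y"
        by blast
      have "(emb (h + g) i has_derivative frechet_derivative (emb (h + g) i) (at x)) (at x)"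
        using Ck_on_derivD[OF Ck_on_emb[of "Suc 0"]] T by blast
      then have "(?f has_derivative frechet_derivative (emb (h + g) i) (at x)) (at x)"
        by (rule has_derivative_transform_within_open[OF _ T(1,2)]) (use T(4) in simp)
      then have "frechet_derivative ?f (at x) = frechet_derivative (emb (h + g) i) (at x)"
        using frechet_derivative_at by metis
      then show ?thesis using inj_derivative_emb T by (metis subsetD)
    qed
    ultimately show ?thesis
      using topological_chart_lift[OF topological_chart_chart W] by (simp add: rz_charts_def)
  qed
  moreover have "topological_chart M (fst (chart g i), ?\<phi>)" using topological_chart_chart by simp
  ultimately have "(fst (chart g i), ?\<phi>) \<in> small_cover_charts P F lam"
    unfolding small_cover_charts_def by blast
  then show ?thesis by simp
qed

section \<open>Orientation signs of the chambers\<close>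

lemma transition_domain_eq:
  "transition_domain (chart g i) (chart g' j) = {x \<in> Dom i. psi g i x \<in> psi g' j ` Dom j}"
  by (force simp: transition_domain_def chart_def)

lemma transition_map_eq:
  assumes "x \<in> Dom i" "y \<in> Dom j" "psi g i x = psi g' j y"
  shows "transition_map (chart g i) (chart g' j) x = y"
proof -
  have "transition_map (chart g i) (chart g' j) (snd (chart g i) (psi g i x)) = snd (chart g' j) (psi g i x)"
    using assms(1) by (intro transition_map_apply[OF topological_chart_chart]) (simp add: chart_def)
  moreover have "snd (chart g i) (psi g i x) = x" using assms(1) by (simp add: chart_def)
  moreover have "snd (chart g' j) (psi g' j y) = y" using assms(2) by (simp add: chart_def)
  ultimately show ?thesis using assms(3) by simp
qed

lemma transition_reflectection:
  assumes x: "x \<in> Dom i"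
  shows "x \<in> transition_domain (chart g i) (chart (g + axis i 1) i)"
    "transition_map (chart g i) (chart (g + axis i 1) i) x = reflect x"
    "det (jac (chart g i) (chart (g + axis i 1) i) x) = - 1"
proof -
  let ?\<tau> = "transition_map (chart g i) (chart (g + axis i 1) i)"
  have psi: "psi g i y = psi (g + axis i 1) i (reflect y)" if "y \<in> Dom i" for y
    using psi_reflect[of "reflect y" i g] that by simp
  have \<tau>: "?\<tau> y = reflect y" if "y \<in> Dom i" for y
    using transition_map_eq[OF that _ psi[OF that]] that by simp
  show "?\<tau> x = reflect x" using \<tau>[OF x] .
  show "x \<in> transition_domain (chart g i) (chart (g + axis i 1) i)"
    using x psi[OF x] reflect_in_Dom by (auto simp: transition_domain_eq)
  have "linear reflect" by (rule linearI) (auto simp: reflect_def vec_eq_iff)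
  then have "(reflect has_derivative reflect) (at x)"
    by (intro bounded_linear_imp_has_derivative) (simp add: linear_conv_bounded_linear)
  then have "(?\<tau> has_derivative reflect) (at x)"
    by (rule has_derivative_transform_within_open[OF _ open_Dom x]) (simp add: \<tau>)
  then have "jacobian ?\<tau> (at x) = matrix reflect"
    using frechet_derivative_at unfolding jacobian_def by metis
  moreover have "det (matrix reflect) = (\<Prod>l\<in>UNIV. matrix reflect $ l $ l)"
    by (rule det_diagonal) (auto simp: matrix_def reflect_def axis_def)
  moreover have "\<dots> = (\<Prod>l\<in>UNIV. if l = k\<^sub>0 then - 1 else 1)"
    by (rule prod.cong) (auto simp: matrix_def reflect_def axis_def)
  ultimately show "det (jacobian ?\<tau> (at x)) = - 1" by simp
qed

lemma det_dfold: "det (matrix (dfold x)) = 2 * x $ k\<^sub>0"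
proof -
  have "det (matrix (dfold x)) = (\<Prod>l\<in>UNIV. matrix (dfold x) $ l $ l)"
    by (rule det_diagonal) (auto simp: matrix_def dfold_def axis_def)
  also have "\<dots> = (\<Prod>l\<in>UNIV. if l = k\<^sub>0 then 2 * x $ k\<^sub>0 else 1)"
    by (rule prod.cong) (auto simp: matrix_def dfold_def axis_def)
  finally show ?thesis by simp
qed

lemma linear_dfold: "linear (dfold x)"
  using has_derivative_linear[OF has_derivative_folding] .

text \<open>
  The transition map \<open>\<tau>\<close> satisfies \<open>folding (\<tau> y) = L j (pt i y) + const\<close>, where \<open>L j\<close> and \<open>L i\<close> differ by a
  rotation. Taking derivatives, \<open>\<tau> x $ k\<^sub>0\<close> times the Jacobian determinant equals \<open>x $ k\<^sub>0\<close>, and both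
  coordinates are positive.
\<close>

lemma transition_in_cell:
  assumes x: "x \<in> Dom i" "0 < x $ k\<^sub>0"
  shows "x \<in> transition_domain (chart g i) (chart g j)"
    "transition_map (chart g i) (chart g j) x = coords j (pt i x)"
    "0 < det (jac (chart g i) (chart g j) x)"
proof -
  let ?\<tau> = "transition_map (chart g i) (chart g j)"
  define N where "N = Dom i \<inter> {y. 0 < y $ k\<^sub>0}"
  have N: "open N" "x \<in> N" unfolding N_def using x
    by (auto intro!: open_Int open_Dom open_Collect_less continuous_intros)
  have cell: "coords j (pt i y) \<in> Dom j \<and> psi g i y = psi g j (coords j (pt i y)) \<and> 0 < lev j (pt i y)"
    if y: "y \<in> N" for y
  proof -
    have pos: "0 < lev l (pt i y)" for l
      using y by (cases "l = i") (auto simp: N_def Dom_def)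
    have "pt j (coords j (pt i y)) = pt i y" using pos[of j] by (simp add: pt_coords)
    moreover have "0 < coords j (pt i y) $ k\<^sub>0" using pos[of j] by (simp add: coords_k0)
    ultimately show ?thesis using pos y
      by (auto simp: Dom_def psi_def lift_def side_def N_def)
  qed
  have \<tau>: "?\<tau> y = coords j (pt i y)" if "y \<in> N" for y
    using cell[OF that] that by (intro transition_map_eq) (auto simp: N_def)
  show \<tau>x: "?\<tau> x = coords j (pt i x)" using \<tau>[OF N(2)] .
  show td: "x \<in> transition_domain (chart g i) (chart g j)"
    using x cell[OF N(2)] by (auto simp: transition_domain_eq)
  let ?J = "jacobian ?\<tau> (at x)"
  have D\<tau>: "(?\<tau> has_derivative (\<lambda>v. ?J *v v)) (at x)"
    by (rule regular_atlasD(2)[OF regular_atlas_small_cover chart_in_atlas chart_in_atlas td])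
  have 1: "((\<lambda>y. folding (?\<tau> y)) has_derivative (\<lambda>v. dfold (?\<tau> x) (?J *v v))) (at x)"
    using has_derivative_compose[OF D\<tau> has_derivative_folding] .
  have eq: "L j (pt i y) + axis k\<^sub>0 (b j) = folding (?\<tau> y)" if "y \<in> N" for y
  proof -
    have "pt j (coords j (pt i y)) = pt i y" using cell[OF that] by (intro pt_coords) simp
    then have "L j (pt i y) = folding (coords j (pt i y)) - axis k\<^sub>0 (b j)"
      using L_pt[of j "coords j (pt i y)"] by simp
    then show ?thesis by (simp add: \<tau>[OF that])
  qed
  have "bounded_linear (L j)" using linear_L linear_conv_bounded_linear by blast
  then have "((\<lambda>y. L j (pt i y) + axis k\<^sub>0 (b j)) has_derivative (\<lambda>v. L j (L' i (dfold x v)) + 0)) (at x)"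
    by (intro has_derivative_add has_derivative_const) (rule bounded_linear.has_derivative[OF _ has_derivative_pt])
  then have 2: "((\<lambda>y. folding (?\<tau> y)) has_derivative (\<lambda>v. L j (L' i (dfold x v)) + 0)) (at x)"
    by (rule has_derivative_transform_within_open[OF _ N]) (rule eq)
  have comp: "dfold (?\<tau> x) \<circ> (\<lambda>v. ?J *v v) = (L j \<circ> L' i) \<circ> dfold x"
    using has_derivative_unique[OF 1 2] by (simp add: o_def)
  have "det (matrix (dfold (?\<tau> x) \<circ> (\<lambda>v. ?J *v v))) = 2 * ?\<tau> x $ k\<^sub>0 * det ?J"
    by (subst matrix_compose) (simp_all add: linear_dfold matrix_vector_mul_linear det_mul det_dfold)
  moreover have "det (matrix ((L j \<circ> L' i) \<circ> dfold x)) = 2 * x $ k\<^sub>0"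
    by (subst matrix_compose) (simp_all add: linear_dfold linear_compose linear_L linear_L' det_mul det_dfold det_L)
  ultimately have "?\<tau> x $ k\<^sub>0 * det ?J = x $ k\<^sub>0" unfolding comp by simp
  moreover have "0 < ?\<tau> x $ k\<^sub>0" using cell[OF N(2)] by (simp add: \<tau>x coords_k0)
  ultimately show "0 < det ?J" using x(2) by (metis zero_less_mult_pos)
qed

text \<open>
  A segment from \<open>p\<close> to a point of the facet \<open>F i\<close> lifts to a path that starts in \<open>coords i p\<close> and
  ends on the wall, which is fixed by the reflection. The mirror image of the path leads back to the
  reflection of \<open>coords i p\<close>.
\<close>

lemma sign_field_crossing:
  assumes p: "\<And>j. 0 < lev j p"
    and s: "continuous_on (Dom i) s" "\<And>x. x \<in> Dom i \<Longrightarrow> s x \<in> {1, - 1 :: real}"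
  shows "s (coords i p) = s (reflect (coords i p))"
proof -
  obtain f where f: "f \<in> F i" "\<And>j. j \<noteq> i \<Longrightarrow> a j \<bullet> f < b j" using facet_point[of i] by blast
  have lf: "lev i f = 0" "\<And>j. j \<noteq> i \<Longrightarrow> 0 < lev j f" using f by (auto simp: F_eq lev_def)
  define \<gamma> where "\<gamma> t = coords i ((1 - t) *\<^sub>R p + t *\<^sub>R f)" for t
  have lev: "lev j ((1 - t) *\<^sub>R p + t *\<^sub>R f) = (1 - t) * lev j p + t * lev j f" for j t
    by (simp add: lev_def inner_add_right algebra_simps)
  have \<gamma>: "\<gamma> t \<in> Dom i" if "t \<in> {0..1}" for t
  proof -
    have "0 < (1 - t) * lev j p + t * lev j f" if "j \<noteq> i" for j
    proof (cases "t = 1")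
      case False
      then have "0 < (1 - t) * lev j p" using \<open>t \<in> _\<close> p[of j] by simp
      moreover have "0 \<le> t * lev j f" using \<open>t \<in> _\<close> lf(2)[OF that] by simp
      ultimately show ?thesis by linarith
    qed (use lf that in simp)
    moreover have "0 \<le> (1 - t) * lev i p + t * lev i f" using that p[of i] lf(1) by simp
    ultimately show ?thesis unfolding \<gamma>_def by (subst coords_in_Dom) (simp_all add: lev)
  qed
  have cont: "continuous_on {0..1} \<gamma>"
    unfolding \<gamma>_def by (intro continuous_on_compose2[OF continuous_coords[of UNIV]] continuous_intros) auto
  have const: "s (h (\<gamma> 0)) = s (h (\<gamma> 1))"
    if h: "continuous_on UNIV h" "\<And>x. x \<in> Dom i \<Longrightarrow> h x \<in> Dom i" for h
  proof -
    have "continuous_on {0..1} (\<lambda>t. s (h (\<gamma> t)))"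
      using h(2) \<gamma> by (intro continuous_on_compose2[OF s(1) continuous_on_compose2[OF h(1) cont]]) auto
    moreover have "(\<lambda>t. s (h (\<gamma> t))) ` {0..1} \<subseteq> {1, - 1}" using s(2) h(2) \<gamma> by blast
    ultimately have "(\<lambda>t. s (h (\<gamma> t))) constant_on {0..1::real}"
      by (intro continuous_finite_range_constant) (auto intro: finite_subset)
    then show ?thesis unfolding constant_on_def by (metis atLeastAtMost_iff order.refl zero_le_one)
  qed
  have "reflect (\<gamma> 1) = \<gamma> 1"
    using lf(1) by (simp add: \<gamma>_def reflect_def vec_eq_iff coords_k0)
  then have "s (\<gamma> 0) = s (reflect (\<gamma> 0))"
    using const[of "\<lambda>x. x"] const[of reflect] continuous_reflect by simp
  then show ?thesis by (simp add: \<gamma>_def)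
qed

lemma chart_shift: "lam h = 0 \<Longrightarrow> chart (h + g) i = chart g i"
proof -
  assume h: "lam h = 0"
  have "psi (h + g) i ` Dom i = psi g i ` Dom i" using psi_shift[OF h] by (intro image_cong) auto
  moreover have "inv_into (Dom i) (psi (h + g) i) = inv_into (Dom i) (psi g i)"
    unfolding inv_into_def using psi_shift[OF h] by (intro ext arg_cong[of _ _ Eps]) auto
  ultimately show ?thesis by (simp add: chart_def)
qed

text \<open>
  The sign \<open>\<sigma> g i\<close> is taken over one fixed interior point of \<open>P\<close>, in the chart that straddles the
  chambers \<open>g\<close> and \<open>g + e\<^sub>i\<close>. It does not depend on \<open>i\<close> by \<open>transition_in_cell\<close>. The charts for \<open>g\<close>
  and \<open>g + e\<^sub>i\<close> differ by a reflection, so the sign changes from \<open>g\<close> to \<open>g + e\<^sub>i\<close>. As it only depends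
  on the class of \<open>g\<close> modulo the kernel, kernel elements have even weight.
\<close>

theorem even_kernel_if_sign_field:
  assumes s: "sign_field (small_cover_charts P F lam) s" and h: "lam h = 0"
  shows "parity h = 0"
proof -
  obtain p where "\<forall>j. a j \<bullet> p < b j" using interior_point by blast
  then have p: "0 < lev j p" for j by (simp add: lev_def)
  have image: "snd (chart g i) ` fst (chart g i) = Dom i" for g i
    by (simp only: chart_def fst_conv snd_conv phi_image)
  note sf = s[unfolded sign_field_def, rule_format, OF chart_in_atlas]
  have cont: "continuous_on (Dom i) (s (chart g i))" for g i
    using conjunct1[OF sf] unfolding image .
  have val: "s (chart g i) x \<in> {1, - 1}" if "x \<in> Dom i" for g i x
    using conjunct1[OF conjunct2[OF sf], of g i] that unfolding image by blast
  have trans: "s (chart g i) x = sgn (det (jac (chart g i) (chart g' j) x)) *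
      s (chart g' j) (transition_map (chart g i) (chart g' j) x)"
    if "x \<in> transition_domain (chart g i) (chart g' j)" for g i g' j x
    using conjunct2[OF conjunct2[OF sf], rule_format, OF chart_in_atlas that] .
  have D: "coords i p \<in> Dom i" "0 < coords i p $ k\<^sub>0" "pt i (coords i p) = p" for i
    using p by (simp_all add: coords_in_Dom coords_k0 pt_coords less_imp_le)
  define \<sigma> where "\<sigma> g i = s (chart g i) (coords i p)" for g i
  have val\<sigma>: "\<sigma> g i \<in> {1, - 1}" for g i using val[OF D(1)] by (simp add: \<sigma>_def)
  have cross: "\<sigma> (g + axis i 1) i = - \<sigma> g i" for g i
    using trans[OF transition_reflectection(1)[OF D(1)], of g i]
      sign_field_crossing[OF p cont val, of i "g + axis i 1"]
    by (simp add: \<sigma>_def transition_reflectection[OF D(1)])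
  have same: "\<sigma> g i = \<sigma> g j" for g i j
    using trans[OF transition_in_cell(1)[OF D(1,2)], of g i j] transition_in_cell(3)[OF D(1,2), of g i j]
    by (simp add: \<sigma>_def transition_in_cell(2)[OF D(1,2)] D(3))
  define ind :: "'m set \<Rightarrow> bit ^ 'm" where "ind J = (\<chi> l. if l \<in> J then 1 else 0)" for J
  have "\<forall>i. \<sigma> (ind J) i = (if parity (ind J) = 0 then 1 else - 1) * \<sigma> 0 i" if "finite J" for J
    using that
  proof (induction J)
    case empty
    have "ind {} = 0" by (simp add: ind_def vec_eq_iff)
    then show ?case by (simp add: parity_zero)
  next
    case (insert j J)
    have ind: "ind (insert j J) = ind J + axis j 1"
      using insert(2) by (auto simp: ind_def vec_eq_iff axis_def)
    have "parity (ind (insert j J)) = parity (ind J) + 1"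
      unfolding ind parity_add parity_axis ..
    moreover have "\<sigma> (ind (insert j J)) i = - \<sigma> (ind J) i" for i
      unfolding ind using cross[of "ind J" j] same[of _ i j] by simp
    ultimately show ?case using insert(3) by (cases "parity (ind J)") simp_all
  qed
  from this[of "{l. h $ l = 1}"]
  have "\<sigma> (ind {l. h $ l = 1}) i = (if parity (ind {l. h $ l = 1}) = 0 then 1 else - 1) * \<sigma> 0 i" for i by simp
  moreover have "ind {l. h $ l = 1} = h"
    by (simp add: ind_def vec_eq_iff)
  ultimately have "\<sigma> h i = (if parity h = 0 then 1 else - 1) * \<sigma> 0 i" for i by simp
  moreover have "\<sigma> h i = \<sigma> 0 i" for i using chart_shift[OF h, of 0 i] by (simp add: \<sigma>_def)
  ultimately show ?thesis using val\<sigma>[of 0] by (cases "parity h") auto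
qed

end

section \<open>Polytopes and their facets\<close>

lemma infdist_hyperplane:
  fixes a p :: "'a::euclidean_space"
  assumes "norm a = 1" "a \<bullet> p \<le> b"
  shows "infdist p {x. a \<bullet> x = b} = b - a \<bullet> p"
proof (rule antisym)
  have aa: "a \<bullet> a = 1" using assms(1) by (simp add: dot_square_norm)
  have w: "p + (b - a \<bullet> p) *\<^sub>R a \<in> {x. a \<bullet> x = b}" by (simp add: inner_add_right aa)
  have "infdist p {x. a \<bullet> x = b} \<le> dist p (p + (b - a \<bullet> p) *\<^sub>R a)" by (rule infdist_le[OF w])
  also have "\<dots> = b - a \<bullet> p" using assms by (simp add: dist_norm)
  finally show "infdist p {x. a \<bullet> x = b} \<le> b - a \<bullet> p" .
  have ne: "{x. a \<bullet> x = b} \<noteq> {}" using w by blast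
  have "b - a \<bullet> p \<le> dist p y" if "a \<bullet> y = b" for y
  proof -
    have "b - a \<bullet> p = a \<bullet> (y - p)" using that by (simp add: inner_diff_right)
    also have "\<dots> \<le> norm a * norm (y - p)" by (rule norm_cauchy_schwarz)
    finally show ?thesis using assms(1) by (simp add: dist_norm norm_minus_commute)
  qed
  then show "b - a \<bullet> p \<le> infdist p {x. a \<bullet> x = b}"
    unfolding infdist_notempty[OF ne] by (intro cINF_greatest[OF ne]) simp
qed

lemma affine_hull_facet:
  fixes P :: "'a::euclidean_space set"
  assumes "aff_dim P = DIM('a)" "C facet_of P" "a \<noteq> 0" "C \<subseteq> {x. a \<bullet> x = b}"
  shows "affine hull C = {x. a \<bullet> x = b}"
proof (rule affine_dim_equal)
  show "affine hull C \<subseteq> {x. a \<bullet> x = b}" using assms(4) by (intro hull_minimal affine_hyperplane)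
  show "aff_dim (affine hull C) = aff_dim {x. a \<bullet> x = b}"
    using assms(1-3) by (simp add: facet_of_def)
qed (use assms(2) in \<open>auto simp: affine_hyperplane facet_of_def\<close>)

text \<open>
  The normals and offsets come from supporting hyperplanes of the facets. They describe \<open>P\<close>, as the segment from
  an interior point to a point outside \<open>P\<close> meets the boundary in a point of a facet, whose
  inequality is violated from there on.
\<close>

lemma polytope_facet_description:
  fixes P :: "'a::euclidean_space set" and F :: "'m::finite \<Rightarrow> 'a set"
  assumes P: "polytope P" "aff_dim P = DIM('a)" and F: "facet_enumeration P F"
  obtains a b where
    "\<And>i. norm (a i) = 1"
    "P = {p. \<forall>i. a i \<bullet> p \<le> b i}"
    "\<And>i. F i = {p \<in> P. a i \<bullet> p = b i}"
    "\<And>i p. p \<in> P \<Longrightarrow> infdist p (affine hull F i) = b i - a i \<bullet> p"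
    "\<And>i. \<exists>p\<in>F i. \<forall>j. j \<noteq> i \<longrightarrow> a j \<bullet> p < b j"
    "\<exists>p. \<forall>j. a j \<bullet> p < b j"
    "\<forall>w. (\<forall>i. a i \<bullet> w = 0) \<longrightarrow> w = 0"
proof -
  have facet: "F i facet_of P" for i
    using F by (auto simp: facet_enumeration_def bij_betw_def)
  have facet_ex: "\<exists>i. C = F i" if "C facet_of P" for C
    using F that by (auto simp: facet_enumeration_def bij_betw_def)
  have injF: "inj F" using F by (simp add: facet_enumeration_def bij_betw_def)
  have poly: "polyhedron P" using P(1) by (rule polytope_imp_polyhedron)
  have convP: "convex P" and clP: "closed P" using P(1) by (simp_all add: polytope_imp_convex polytope_imp_closed)
  have "\<exists>a b. norm a = 1 \<and> P \<subseteq> {x. a \<bullet> x \<le> b} \<and> F i = P \<inter> {x. a \<bullet> x = b}" for i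
  proof -
    obtain a b where ab: "a \<noteq> 0" "P \<subseteq> {x. a \<bullet> x \<le> b}" "F i = P \<inter> {x. a \<bullet> x = b}"
      using facet_of_polyhedron[OF poly facet[of i]] by metis
    have "norm (a /\<^sub>R norm a) = 1" using ab(1) by simp
    moreover have "(a /\<^sub>R norm a) \<bullet> x \<le> b / norm a \<longleftrightarrow> a \<bullet> x \<le> b" for x
      using ab(1) by (simp add: field_simps)
    moreover have "(a /\<^sub>R norm a) \<bullet> x = b / norm a \<longleftrightarrow> a \<bullet> x = b" for x
      using ab(1) by (simp add: field_simps)
    ultimately show ?thesis using ab(2,3)
      by (intro exI[of _ "a /\<^sub>R norm a"] exI[of _ "b / norm a"]) (simp only: simp_thms)
  qed
  then obtain a b where na: "\<And>i. norm (a i) = 1" and sub: "\<And>i. P \<subseteq> {x. a i \<bullet> x \<le> b i}"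
    and Fi: "\<And>i. F i = P \<inter> {x. a i \<bullet> x = b i}" by metis
  have a0: "a i \<noteq> 0" for i using na[of i] by auto
  have relint: "rel_interior P = interior P" "interior P \<noteq> {}"
  proof -
    have "interior P = rel_interior P" using P(2) by (simp add: interior_rel_interior_gen)
    moreover have "P \<noteq> {}" using P(2) by auto
    ultimately show "rel_interior P = interior P" "interior P \<noteq> {}"
      using rel_interior_eq_empty[OF convP] by auto
  qed
  have int: "a i \<bullet> p < b i" if "p \<in> interior P" for i p
    using interior_mono[OF sub[of i]] that a0[of i] by auto
  obtain p\<^sub>0 where p0: "p\<^sub>0 \<in> interior P" using relint by blast
  have P_eq: "P = {p. \<forall>i. a i \<bullet> p \<le> b i}"
  proof (intro equalityI subsetI)
    fix x assume x: "x \<in> {p. \<forall>i. a i \<bullet> p \<le> b i}"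
    show "x \<in> P"
    proof (rule ccontr)
      assume "x \<notin> P"
      then have "closed_segment p\<^sub>0 x \<inter> frontier P \<noteq> {}"
        using p0 interior_subset by (intro connected_Int_frontier) auto
      then obtain y where y: "y \<in> closed_segment p\<^sub>0 x" "y \<in> frontier P" by blast
      have "frontier P = rel_frontier P" by (simp add: rel_frontier_def frontier_def relint(1))
      then obtain C where "C facet_of P" "y \<in> C" using y(2) rel_frontier_of_polyhedron[OF poly] by blast
      then obtain i where i: "a i \<bullet> y = b i" using facet_ex Fi by blast
      obtain t where t: "0 \<le> t" "t \<le> 1" "y = (1 - t) *\<^sub>R p\<^sub>0 + t *\<^sub>R x"
        using y(1) by (auto simp: in_segment)
      have "y \<in> P" using y(2) clP frontier_subset_closed by blast
      then have "t \<noteq> 1" using t(3) \<open>x \<notin> P\<close> by auto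
      then have "(1 - t) * (a i \<bullet> p\<^sub>0) < (1 - t) * b i" using t(2) int[OF p0, of i] by simp
      moreover have "t * (a i \<bullet> x) \<le> t * b i" using x t(1) by (intro mult_left_mono) auto
      moreover have "a i \<bullet> y = (1 - t) * (a i \<bullet> p\<^sub>0) + t * (a i \<bullet> x)"
        using t(3) by (simp add: inner_add_right)
      moreover have "(1 - t) * b i + t * b i = b i" by (simp add: algebra_simps)
      ultimately have "a i \<bullet> y < b i" by linarith
      then show False using i by simp
    qed
  qed (use sub in blast)
  have F_eq: "F i = {p \<in> P. a i \<bullet> p = b i}" for i using Fi by blast
  have hull: "affine hull F i = {x. a i \<bullet> x = b i}" for i
    by (rule affine_hull_facet[OF P(2) facet a0]) (use Fi in blast)
  have "infdist p (affine hull F i) = b i - a i \<bullet> p" if "p \<in> P" for i p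
    unfolding hull using sub that by (intro infdist_hyperplane na) blast
  moreover have "\<exists>p\<in>F i. \<forall>j. j \<noteq> i \<longrightarrow> a j \<bullet> p < b j" for i
  proof -
    have "convex (F i)" "F i \<noteq> {}"
      using facet[of i] face_of_imp_convex by (auto simp: facet_of_def)
    then obtain p where p: "p \<in> rel_interior (F i)" using rel_interior_eq_empty by blast
    then have pF: "p \<in> F i" using rel_interior_subset by blast
    have "a j \<bullet> p < b j" if "j \<noteq> i" for j
    proof -
      have pP: "p \<in> P" using pF F_eq by blast
      have "p \<notin> F j"
      proof
        assume "p \<in> F j"
        then have "F i \<subseteq> F j"
          using p by (intro subset_of_face_of[OF facet_of_imp_face_of[OF facet[of j]]
                facet_of_imp_subset[OF facet[of i]]]) blast
        then have "F i = F j" by (rule facet_eq_if_subset[OF P(1) facet facet])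
        then show False using injF that by (auto dest: injD)
      qed
      then show ?thesis using sub[of j] pP F_eq[of j] by force
    qed
    then show ?thesis using pF by blast
  qed
  moreover have "\<exists>p. \<forall>j. a j \<bullet> p < b j" using int[OF p0] by blast
  moreover have "\<forall>w. (\<forall>i. a i \<bullet> w = 0) \<longrightarrow> w = 0"
  proof (intro allI impI, rule ccontr)
    fix w assume w: "\<forall>i. a i \<bullet> w = 0"
    assume "w \<noteq> 0"
    obtain B where B: "\<And>x. x \<in> P \<Longrightarrow> norm x \<le> B"
      using polytope_imp_bounded[OF P(1)] bounded_iff by metis
    define t where "t = (B + norm p\<^sub>0 + 1) / norm w"
    have "p\<^sub>0 + t *\<^sub>R w \<in> P"
      using int[OF p0] w unfolding P_eq by (simp add: inner_add_right less_imp_le)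
    then have 1: "norm (p\<^sub>0 + t *\<^sub>R w) \<le> B" by (rule B)
    have "norm (t *\<^sub>R w) \<le> norm (p\<^sub>0 + t *\<^sub>R w) + norm p\<^sub>0"
      using norm_triangle_ineq4[of "p\<^sub>0 + t *\<^sub>R w" p\<^sub>0] by simp
    moreover have "norm (t *\<^sub>R w) = \<bar>B + norm p\<^sub>0 + 1\<bar>" using \<open>w \<noteq> 0\<close> by (simp add: t_def)
    ultimately show False using 1 by linarith
  qed
  ultimately show ?thesis using that[of a b, OF na P_eq F_eq] by blast
qed

text \<open>
  Transport everything to \<open>real ^ 'k\<close> by an isometry and rotate each normal to the negative of
  the basis vector \<open>k\<^sub>0\<close>. In dimension at least 2 this can be done with determinant 1.
\<close>

lemma rotated_isometries:
  fixes a :: "'m \<Rightarrow> 'a::euclidean_space" and k\<^sub>0 :: "'k::finite"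
  assumes dim: "DIM('a) = CARD('k)" "2 \<le> CARD('k)" and na: "\<And>i. norm (a i) = 1"
  obtains L :: "'m \<Rightarrow> 'a \<Rightarrow> real ^ 'k" and L' where
    "\<And>i. linear (L i)" "\<And>i. linear (L' i)" "\<And>i z. L i (L' i z) = z" "\<And>i p. L' i (L i p) = p"
    "\<And>i p. L i p $ k\<^sub>0 = - (a i \<bullet> p)" "\<And>i j. det (matrix (L j \<circ> L' i)) = 1"
proof -
  have "DIM('a) = DIM(real ^ 'k)" using dim(1) by simp
  then obtain f :: "'a \<Rightarrow> real ^ 'k" and g where f: "linear f" "linear g"
    and nf: "\<And>x. norm (f x) = norm x" and "\<And>y. norm (g y) = norm y"
    and fg: "\<And>x. g (f x) = x" "\<And>y. f (g y) = y"
    using isomorphisms_UNIV_UNIV[where 'M = 'a and 'N = "real ^ 'k"] by blast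
  have inner_f: "f x \<bullet> f y = x \<bullet> y" for x y
    by (simp add: dot_norm nf linear_add[OF f(1), symmetric])
  have "\<exists>T. orthogonal_transformation T \<and> det (matrix T) = 1 \<and> T (f (a i)) = - axis k\<^sub>0 1" for i
    using rotation_exists[OF dim(2), of "f (a i)" "- axis k\<^sub>0 1"] by (metis na nf norm_axis_1 norm_minus_cancel)
  then obtain T where T: "\<And>i. orthogonal_transformation (T i)" "\<And>i. det (matrix (T i)) = 1"
    "\<And>i. T i (f (a i)) = - axis k\<^sub>0 1" by metis
  have linT: "linear (T i)" for i using T(1) orthogonal_transformation_linear by blast
  have bijT: "bij (T i)" for i using T(1) orthogonal_transformation_bij by blast
  define T' where "T' i = inv (T i)" for i
  have TT': "T i (T' i z) = z" "T' i (T i z) = z" for i z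
    using bijT[of i] by (simp_all add: T'_def bij_is_surj surj_f_inv_f bij_is_inj)
  have linT': "linear (T' i)" for i
    using orthogonal_transformation_linear[OF orthogonal_transformation_inv[OF T(1)]] by (simp add: T'_def)
  have detT': "det (matrix (T' i)) = 1" for i
  proof -
    have "T i \<circ> T' i = id" by (auto simp: TT')
    then have "det (matrix (T i)) * det (matrix (T' i)) = 1"
      using matrix_compose[OF linT'[of i] linT[of i]] det_mul matrix_id by metis
    then show ?thesis using T(2) by simp
  qed
  show ?thesis
  proof (rule that[of "\<lambda>i p. T i (f p)" "\<lambda>i z. g (T' i z)"])
    show "linear (\<lambda>p. T i (f p))" "linear (\<lambda>z. g (T' i z))" for i
      using linear_compose[OF f(1) linT[of i]] linear_compose[OF linT'[of i] f(2)] by (simp_all add: o_def)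
    show "T i (f (g (T' i z))) = z" for i z by (simp add: fg TT')
    show "g (T' i (T i (f p))) = p" for i p by (simp add: fg TT')
    show "T i (f p) $ k\<^sub>0 = - (a i \<bullet> p)" for i p
    proof -
      have "T i (f p) \<bullet> T i (f (a i)) = p \<bullet> a i"
        using T(1)[of i] inner_f by (simp add: orthogonal_transformation_def)
      then show ?thesis unfolding T(3) by (simp add: inner_axis inner_commute[of p])
    qed
    show "det (matrix ((\<lambda>p. T j (f p)) \<circ> (\<lambda>z. g (T' i z)))) = 1" for i j
    proof -
      have "(\<lambda>p. T j (f p)) \<circ> (\<lambda>z. g (T' i z)) = T j \<circ> T' i" by (auto simp: fg)
      then show ?thesis using matrix_compose[OF linT'[of i] linT[of j]] detT' T(2) by (simp add: det_mul)
    qed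
  qed
qed

text \<open>
  A kernel vector supported on facets through \<open>p\<close> would be a linear relation between the values of
  \<open>lam\<close> on these facets.
\<close>

lemma char_map_free:
  assumes "mod2_characteristic_map P F lam" and h: "lam h = 0" "h \<noteq> 0"
  shows "\<exists>j. h $ j = 1 \<and> p \<notin> F j"
proof (rule ccontr)
  assume "\<nexists>j. h $ j = 1 \<and> p \<notin> F j"
  then have all: "p \<in> F j" if "h $ j = 1" for j using that by blast
  define I where "I = {j. h $ j = 1}"
  interpret lam: Vector_Spaces.linear "(*s)" "(*s)" lam
    using assms(1) by (simp add: mod2_characteristic_map_def)
  obtain j where j: "j \<in> I" using h(2) by (auto simp: I_def vec_eq_iff)
  have "(\<Inter>i\<in>I. F i) \<noteq> {}" using all by (auto simp: I_def)
  then have inj: "inj_on (\<lambda>i. lam (axis i 1)) I" and ind: "vec.independent ((\<lambda>i. lam (axis i 1)) ` I)"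
    using assms(1) j unfolding mod2_characteristic_map_def by blast+
  have "h = (\<Sum>i\<in>UNIV. h $ i *s axis i 1)" by (simp add: basis_expansion)
  also have "\<dots> = (\<Sum>i\<in>I. h $ i *s axis i 1)"
    by (rule sum.mono_neutral_right) (auto simp: I_def)
  also have "\<dots> = (\<Sum>i\<in>I. axis i 1)"
    by (rule sum.cong) (auto simp: I_def)
  finally have "lam h = (\<Sum>i\<in>I. lam (axis i 1))" using lam.sum by metis
  also have "\<dots> = (\<Sum>v\<in>(\<lambda>i. lam (axis i 1)) ` I. 1 *s v)"
    by (subst sum.reindex[OF inj]) simp
  finally have "(1 :: bit) = 0"
    using vec.independentD[OF ind _ order.refl, of "\<lambda>_. 1" "lam (axis j 1)"] h(1) j by simp
  then show False by simp
qed

theorem even_kernel_if_orientable_or_symplectic: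
  fixes P :: "'a::euclidean_space set" and F :: "'m::finite \<Rightarrow> 'a set"
    and lam :: "bit ^ 'm \<Rightarrow> bit ^ 'k::finite" and \<iota> :: "'n::finite \<times> bool \<Rightarrow> 'k"
  assumes P: "polytope P" "aff_dim P = DIM('a)" and F: "facet_enumeration P F"
    and lam: "mod2_characteristic_map P F lam" and \<iota>: "bij \<iota>"
    and or: "orientable_manifold (small_cover_topology P F lam) (small_cover_charts P F lam) \<or>
      symplectic_manifold (small_cover_charts P F lam)"
    and h: "lam h = 0"
  shows "parity h = 0"
proof -
  have card: "CARD('k) = 2 * CARD('n)"
    using bij_betw_same_card[OF \<iota>] by (simp add: card_prod UNIV_Times_UNIV[symmetric] del: UNIV_Times_UNIV)
  then have dim: "DIM('a) = CARD('k)" "2 \<le> CARD('k)"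
    using P(2) lam by (auto simp: mod2_characteristic_map_def Suc_le_eq)
  obtain a b where ab: "\<And>i. norm (a i) = 1" "P = {p. \<forall>i. a i \<bullet> p \<le> b i}"
    "\<And>i. F i = {p \<in> P. a i \<bullet> p = b i}"
    "\<And>i p. p \<in> P \<Longrightarrow> infdist p (affine hull F i) = b i - a i \<bullet> p"
    "\<And>i. \<exists>p\<in>F i. \<forall>j. j \<noteq> i \<longrightarrow> a j \<bullet> p < b j"
    "\<exists>p. \<forall>j. a j \<bullet> p < b j" "\<forall>w. (\<forall>i. a i \<bullet> w = 0) \<longrightarrow> w = 0"
    by (rule polytope_facet_description[OF P F]) (rule that)
  obtain L :: "'m \<Rightarrow> 'a \<Rightarrow> real ^ 'k" and L' where L:
    "\<And>i. linear (L i)" "\<And>i. linear (L' i)" "\<And>i z. L i (L' i z) = z" "\<And>i p. L' i (L i p) = p"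
    "\<And>i p. L i p $ undefined = - (a i \<bullet> p)" "\<And>i j. det (matrix (L j \<circ> L' i)) = 1"
    by (rule rotated_isometries[OF dim ab(1)]) (rule that)
  have facet: "F i facet_of P" for i
    using F by (auto simp: facet_enumeration_def bij_betw_def)
  interpret facet_charts P F lam a b L L' undefined
  proof (intro facet_charts.intro small_cover.intro facet_charts_axioms.intro)
    show "Vector_Spaces.linear (*s) (*s) lam" using lam by (simp add: mod2_characteristic_map_def)
    show "\<exists>j. h $ j = 1 \<and> p \<notin> F j" if "p \<in> P" "lam h = 0" "h \<noteq> 0" for p h
      using char_map_free[OF lam that(2,3)] .
    show "closed (F i)" for i
      using face_of_polytope_polytope[OF P(1) facet_of_imp_face_of[OF facet]] polytope_imp_closed by blast
    show "w = 0" if "\<And>i. a i \<bullet> w = 0" for w using ab(7) that by blast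
  qed (fact ab(2-6) L)+
  from or have "\<exists>s. sign_field (small_cover_charts P F lam) s"
    using sign_field_if_orientable[OF regular_atlas_small_cover]
      sign_field_if_symplectic[OF regular_atlas_small_cover \<iota>] by (elim disjE) simp_all
  then obtain s where "sign_field (small_cover_charts P F lam) s" ..
  then show ?thesis using h by (rule even_kernel_if_sign_field)
qed

section \<open>Products of polygons\<close>

lemma polyhedron_coordinate_preimage:
  fixes Q :: "'a::euclidean_space set"
  assumes "polyhedron Q"
  shows "polyhedron {x :: 'a ^ 'n::finite. x $ j \<in> Q}"
proof -
  obtain H where H: "finite H" "Q = \<Inter>H" "\<And>h. h \<in> H \<Longrightarrow> \<exists>a b. a \<noteq> 0 \<and> h = {x. a \<bullet> x \<le> b}"
    using assms unfolding polyhedron_def by metis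
  have eq: "{x :: 'a ^ 'n. x $ j \<in> Q} = \<Inter>((\<lambda>h. {x. x $ j \<in> h}) ` H)"
    using H(2) by auto
  have "polyhedron {x :: 'a ^ 'n. x $ j \<in> h}" if hH: "h \<in> H" for h
  proof -
    obtain a b where h: "h = {x. a \<bullet> x \<le> b}" using H(3)[OF hH] by blast
    have "{x :: 'a ^ 'n. x $ j \<in> h} = {x. axis j a \<bullet> x \<le> b}" by (simp add: h inner_axis')
    then show ?thesis by (simp add: polyhedron_halfspace_le)
  qed
  then show ?thesis unfolding eq using H(1) by (intro polyhedron_Inter) auto
qed

lemma polygon_interior_points:
  assumes "\<And>j. polygon (m j) (Q j)"
  obtains f where "\<And>j. f j \<in> interior (Q j)" "\<And>j. f j \<in> Q j"
proof -
  have "\<forall>j. \<exists>y. y \<in> interior (Q j)"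
  proof
    fix j
    have "convex (Q j)" "Q j \<noteq> {}" "interior (Q j) = rel_interior (Q j)"
      using assms[of j] interior_rel_interior_gen[of "Q j"]
      by (auto simp: polygon_def polytope_imp_convex)
    then show "\<exists>y. y \<in> interior (Q j)" using rel_interior_eq_empty by blast
  qed
  then obtain f where "\<And>j. f j \<in> interior (Q j)" by metis
  then show ?thesis using that interior_subset by blast
qed

lemma polytope_polygon_product:
  fixes Q :: "'n::finite \<Rightarrow> (real ^ 2) set"
  assumes "\<And>j. polygon (m j) (Q j)"
  shows "polytope (polygon_product Q)"
proof -
  have Q: "polytope (Q j)" for j using assms by (auto simp: polygon_def)
  have eq: "polygon_product Q = \<Inter>(range (\<lambda>j. {x. x $ j \<in> Q j}))" by (auto simp: polygon_product_def)
  have "polyhedron (polygon_product Q)"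
    unfolding eq using Q by (intro polyhedron_Inter) (auto intro: polyhedron_coordinate_preimage polytope_imp_polyhedron)
  moreover have "bounded (polygon_product Q)"
  proof -
    have "\<exists>B. \<forall>x\<in>Q j. norm x \<le> B" for j
      using polytope_imp_bounded[OF Q[of j]] by (simp add: bounded_iff)
    then obtain B where B: "\<And>j x. x \<in> Q j \<Longrightarrow> norm x \<le> B j" by metis
    have "norm x \<le> (\<Sum>j\<in>UNIV. B j)" if "x \<in> polygon_product Q" for x
    proof -
      have "norm x \<le> (\<Sum>j\<in>UNIV. norm (x $ j))"
        unfolding norm_vec_def by (rule L2_set_le_sum) simp
      also have "\<dots> \<le> (\<Sum>j\<in>UNIV. B j)"
        using that B by (intro sum_mono) (auto simp: polygon_product_def)
      finally show ?thesis .
    qed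
    then show ?thesis unfolding bounded_iff by blast
  qed
  ultimately show ?thesis by (simp add: polytope_eq_bounded_polyhedron)
qed

lemma aff_dim_polygon_product:
  fixes Q :: "'n::finite \<Rightarrow> (real ^ 2) set"
  assumes "\<And>j. polygon (m j) (Q j)"
  shows "aff_dim (polygon_product Q) = DIM((real ^ 2) ^ 'n)"
proof (rule aff_dim_nonempty_interior)
  obtain f where f: "\<And>j. f j \<in> interior (Q j)" "\<And>j. f j \<in> Q j"
    by (rule polygon_interior_points[OF assms]) (rule that)
  have op: "open {x. \<forall>j. x $ j \<in> interior (Q j)}" by (intro open_vector_box) simp
  have "{x. \<forall>j. x $ j \<in> interior (Q j)} \<subseteq> polygon_product Q"
    using interior_subset by (auto simp: polygon_product_def)
  note interior_maximal[OF this op]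
  moreover have "(\<chi> j. f j) \<in> {x. \<forall>j. x $ j \<in> interior (Q j)}" using f by simp
  ultimately show "interior (polygon_product Q) \<noteq> {}" by blast
qed

text \<open>
  The set is a face, and it contains a nonempty relatively open subset of its supporting hyperplane, which
  determines its dimension.
\<close>

lemma facet_of_polygon_product:
  fixes Q :: "'n::finite \<Rightarrow> (real ^ 2) set"
  assumes Q: "\<And>j. polygon (m j) (Q j)" and E: "E facet_of Q j"
  shows "{x \<in> polygon_product Q. x $ j \<in> E} facet_of polygon_product Q"
proof -
  let ?P = "polygon_product Q" and ?C = "{x \<in> polygon_product Q. x $ j \<in> E}"
  have poly: "polyhedron (Q j)" using Q[of j] by (auto simp: polygon_def polytope_imp_polyhedron)
  obtain a b where ab: "a \<noteq> 0" "Q j \<subseteq> {x. a \<bullet> x \<le> b}" "E = Q j \<inter> {x. a \<bullet> x = b}"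
    using facet_of_polyhedron[OF poly E] by metis
  have C: "?C = ?P \<inter> {x. axis j a \<bullet> x = b}"
    using ab(3) by (auto simp: polygon_product_def inner_axis')
  have face: "?C face_of ?P"
    unfolding C
  proof (rule face_of_Int_supporting_hyperplane_le)
    show "convex ?P" using polytope_polygon_product[OF Q] by (rule polytope_imp_convex)
    show "axis j a \<bullet> x \<le> b" if "x \<in> ?P" for x
      using that ab(2) by (auto simp: polygon_product_def inner_axis')
  qed
  have hull: "affine hull E = {x. a \<bullet> x = b}"
    using Q[of j] ab by (intro affine_hull_facet[OF _ E ab(1)]) (auto simp: polygon_def)
  have "convex E" "E \<noteq> {}" using E face_of_imp_convex by (auto simp: facet_of_def)
  then have ne: "rel_interior E \<noteq> {}" by (simp add: rel_interior_eq_empty)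
  have "openin (top_of_set (affine hull E)) (rel_interior E)" by (rule openin_rel_interior)
  then obtain U where U: "open U" "rel_interior E = U \<inter> {x. a \<bullet> x = b}"
    unfolding hull openin_open by blast
  obtain f where f: "\<And>i. f i \<in> interior (Q i)" "\<And>i. f i \<in> Q i"
    by (rule polygon_interior_points[OF Q]) (rule that)
  obtain e where e: "e \<in> rel_interior E" using ne by blast
  define B where "B i = (if i = j then U else interior (Q i))" for i
  define N where "N = {x. axis j a \<bullet> x = b} \<inter> {x. \<forall>i. x $ i \<in> B i}"
  have "open {x. \<forall>i. x $ i \<in> B i}" using U(1) by (intro open_vector_box) (auto simp: B_def)
  then have op: "openin (top_of_set {x. axis j a \<bullet> x = b}) N" unfolding N_def by auto
  have "(\<chi> i. if i = j then e else f i) \<in> N"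
    using e f U(2) by (auto simp: N_def B_def inner_axis')
  then have "N \<noteq> {}" by blast
  then have dimN: "aff_dim N = aff_dim {x. axis j a \<bullet> x = b}"
    by (intro aff_dim_openin[OF op] affine_hyperplane)
  have "N \<subseteq> ?C"
  proof
    fix x assume "x \<in> N"
    then have x: "a \<bullet> x $ j = b" "\<And>i. x $ i \<in> B i" by (auto simp: N_def inner_axis')
    then have "x $ j \<in> E" using U(2) rel_interior_subset[of E] x(2)[of j] by (auto simp: B_def)
    moreover have "x $ i \<in> Q i" for i
      using x(2)[of i] interior_subset[of "Q i"] \<open>x $ j \<in> E\<close> ab(3) by (cases "i = j") (auto simp: B_def)
    ultimately show "x \<in> ?C" by (simp add: polygon_product_def)
  qed
  then have "aff_dim N \<le> aff_dim ?C" by (rule aff_dim_subset)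
  moreover have "aff_dim ?C \<le> aff_dim {x. axis j a \<bullet> x = b}" unfolding C by (intro aff_dim_subset) simp
  moreover have "aff_dim {x. axis j a \<bullet> x = b} = DIM((real ^ 2) ^ 'n) - 1"
    using ab(1) by (intro aff_dim_hyperplane) (simp add: axis_eq_0_iff)
  moreover have "int (DIM((real ^ 2) ^ 'n) - 1) = int (DIM((real ^ 2) ^ 'n)) - 1"
    using DIM_positive[where 'a = "(real ^ 2) ^ 'n"] by linarith
  ultimately have "aff_dim ?C = aff_dim ?P - 1"
    using dimN unfolding aff_dim_polygon_product[OF Q] by linarith
  moreover have "?C \<noteq> {}" using \<open>N \<noteq> {}\<close> \<open>N \<subseteq> ?C\<close> by blast
  ultimately show ?thesis using face by (simp add: facet_of_def)
qed

lemma facet_of_polygon_product_inject: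
  fixes Q :: "'n::finite \<Rightarrow> (real ^ 2) set"
  assumes Q: "\<And>j. polygon (m j) (Q j)" and E: "E facet_of Q j" and E': "E' facet_of Q j'"
    and eq: "{x \<in> polygon_product Q. x $ j \<in> E} = {x \<in> polygon_product Q. x $ j' \<in> E'}"
  shows "j = j' \<and> E = E'"
proof -
  have sub: "E \<subseteq> Q j" "E' \<subseteq> Q j'" using E E' facet_of_imp_subset by blast+
  obtain f where "\<And>i. f i \<in> interior (Q i)" and f: "\<And>i. f i \<in> Q i"
    by (rule polygon_interior_points[OF Q]) (rule that)
  have in_P: "(\<chi> i. if i = l then y else g i) \<in> polygon_product Q" if "y \<in> Q l" "\<And>i. g i \<in> Q i" for l y g
    using that by (simp add: polygon_product_def)
  have "j = j'"
  proof (rule ccontr)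
    assume ne: "j \<noteq> j'"
    have "E \<noteq> {}" using E by (simp add: facet_of_def)
    then obtain e where e: "e \<in> E" by blast
    have "E' \<noteq> Q j'" using E' by auto
    then obtain e' where e': "e' \<in> Q j'" "e' \<notin> E'" using sub by blast
    define x where "x = (\<chi> i. if i = j then e else (f(j' := e')) i)"
    have "x \<in> polygon_product Q" unfolding x_def using e e' f sub by (intro in_P) auto
    moreover have "x $ j \<in> E" "x $ j' \<notin> E'" using e e' ne by (simp_all add: x_def)
    ultimately show False using eq by blast
  qed
  moreover have "y \<in> E \<longleftrightarrow> y \<in> E'" for y
  proof (cases "y \<in> Q j")
    case True
    define x where "x = (\<chi> i. if i = j then y else f i)"
    have "x \<in> polygon_product Q" unfolding x_def using True f by (intro in_P)
    then have "x $ j \<in> E \<longleftrightarrow> x $ j' \<in> E'" using eq by blast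
    then show ?thesis using \<open>j = j'\<close> by (simp add: x_def)
  qed (use sub \<open>j = j'\<close> in blast)
  ultimately show ?thesis by blast
qed

theorem odd_kernel_vector_polygon_product:
  fixes m :: "'n::finite \<Rightarrow> nat" and Q :: "'n \<Rightarrow> (real ^ 2) set"
    and F :: "'m::finite \<Rightarrow> ((real ^ 2) ^ 'n) set" and lam :: "bit ^ 'm \<Rightarrow> bit ^ 'k::finite"
  assumes Q: "\<And>j. polygon (m j) (Q j)" and odd: "\<And>j. odd (m j)"
    and F: "facet_enumeration (polygon_product Q) F"
    and lam: "mod2_characteristic_map (polygon_product Q) F lam"
    and \<iota>: "bij (\<iota> :: 'n \<times> bool \<Rightarrow> 'k)"
  shows "\<exists>h. lam h = 0 \<and> parity h = 1"
proof -
  define R where "R j e \<longleftrightarrow>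
      (\<forall>x. x extreme_point_of Q j \<longrightarrow> e False x \<noteq> e True x \<and>
        {E. E facet_of Q j \<and> x \<in> E} = {e False x, e True x}) \<and>
      (\<forall>f. (\<Sum>x | x extreme_point_of Q j. f (e False x) + f (e True x)) = (0::bit))" for j e
  have "\<exists>e. R j e" for j
  proof -
    obtain e\<^sub>0 e\<^sub>1 where e:
      "\<And>x. x extreme_point_of Q j \<Longrightarrow> e\<^sub>0 x \<noteq> e\<^sub>1 x \<and> {E. E facet_of Q j \<and> x \<in> E} = {e\<^sub>0 x, e\<^sub>1 x}"
      "card {x. x extreme_point_of Q j} = m j"
      "\<And>f. (\<Sum>x | x extreme_point_of Q j. f (e\<^sub>0 x) + f (e\<^sub>1 x)) = (0::bit)"
      by (rule polygon_incidence[OF Q[of j]]) (rule that)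
    then show ?thesis by (intro exI[of _ "\<lambda>c. if c then e\<^sub>1 else e\<^sub>0"]) (simp add: R_def)
  qed
  then obtain e where Re: "\<And>j. R j (e j)" by metis
  have e: "e j False x \<noteq> e j True x \<and> {E. E facet_of Q j \<and> x \<in> E} = {e j False x, e j True x}"
    if "x extreme_point_of Q j" for j x
    using Re[of j] that unfolding R_def by blast
  have even: "(\<Sum>x | x extreme_point_of Q j. f (e j False x) + f (e j True x)) = (0::bit)" for j f
    using Re[of j] unfolding R_def by blast
  have cardV: "card {x. x extreme_point_of Q j} = m j" for j
    by (rule polygon_incidence[OF Q[of j]])
  define V where "V j = {x. x extreme_point_of Q j}" for j
  define C where "C j E = {x \<in> polygon_product Q. x $ j \<in> E}" for j E
  define i where "i j E = inv F (C j E)" for j E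
  have edge: "e j c x facet_of Q j" "x \<in> e j c x" if "x \<in> V j" for j c x
    using e[of x j] that by (cases c; auto simp: V_def)+
  have bijF: "bij_betw F UNIV {S. S facet_of polygon_product Q}"
    using F by (simp add: facet_enumeration_def)
  have Fi: "F (i j E) = C j E" if "E facet_of Q j" for j E
    using facet_of_polygon_product[of m Q, OF Q that] bijF
    unfolding i_def C_def bij_betw_def by (intro f_inv_into_f) blast
  have "inj (\<lambda>(j, c). lam (axis (i j (e j c (v j))) 1)) \<and>
      vec.independent (range (\<lambda>(j, c). lam (axis (i j (e j c (v j))) 1)))"
    if v: "v \<in> Pi\<^sub>E UNIV V" for v
  proof -
    define \<kappa> where "\<kappa> = (\<lambda>(j, c). i j (e j c (v j)))"
    have vj: "v j \<in> V j" for j using v by auto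
    have F\<kappa>: "F (\<kappa> (j, c)) = C j (e j c (v j))" for j c
      unfolding \<kappa>_def prod.case by (rule Fi[OF edge(1)[OF vj]])
    have "(\<chi> j. v j) \<in> F (\<kappa> (j, c))" for j c
    proof -
      have "v l \<in> Q l" for l using vj[of l] by (auto simp: V_def extreme_point_of_def)
      then show ?thesis unfolding F\<kappa> C_def using edge(2)[OF vj] by (simp add: polygon_product_def)
    qed
    then have "(\<chi> j. v j) \<in> (\<Inter>l\<in>range \<kappa>. F l)" by auto
    then have "inj_on (\<lambda>l. lam (axis l 1)) (range \<kappa>)" and
      ind: "vec.independent ((\<lambda>l. lam (axis l 1)) ` range \<kappa>)"
      using lam unfolding mod2_characteristic_map_def by blast+
    moreover have "inj \<kappa>"
    proof (rule injI, clarify)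
      fix j c j' c' assume "\<kappa> (j, c) = \<kappa> (j', c')"
      then have "C j (e j c (v j)) = C j' (e j' c' (v j'))" using F\<kappa> by metis
      then have *: "j = j' \<and> e j c (v j) = e j' c' (v j')"
        unfolding C_def by (rule facet_of_polygon_product_inject[of m Q, OF Q edge(1)[OF vj] edge(1)[OF vj]])
      then show "j = j' \<and> c = c'"
        using e[of "v j" j] vj[of j] by (cases c; cases c') (auto simp: V_def)
    qed
    ultimately have "inj ((\<lambda>l. lam (axis l 1)) \<circ> \<kappa>)" by (intro comp_inj_on)
    moreover have "(\<lambda>(j, c). lam (axis (i j (e j c (v j))) 1)) = (\<lambda>l. lam (axis l 1)) \<circ> \<kappa>"
      by (auto simp: \<kappa>_def)
    ultimately show ?thesis using ind by (simp only: image_comp simp_thms)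
  qed
  moreover have "Vector_Spaces.linear (*s) (*s) lam" using lam by (simp add: mod2_characteristic_map_def)
  moreover have oddV: "odd (card (V j))" for j
    using odd[of j] cardV[of j] by (simp add: V_def)
  moreover have "finite (V j)" for j
    by (rule ccontr) (use oddV[of j] in simp)
  moreover have "bij (inv \<iota>)" using \<iota> by (rule bij_imp_bij_inv)
  ultimately show ?thesis
    using even by (intro exists_odd_kernel_vector[where V = V and e = e and i = i and \<beta> = "inv \<iota>"]) (auto simp: V_def)
qed

theorem proposition4p2:
  fixes m :: "'n::finite \<Rightarrow> nat"
    and Q :: "'n \<Rightarrow> (real ^ 2) set"
    and P :: "((real ^ 2) ^ 'n) set"
    and F :: "'m::finite \<Rightarrow> ((real ^ 2) ^ 'n) set"
    and lam :: "bit ^ 'm \<Rightarrow> bit ^ 'k::finite"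
  assumes "\<And>j. polygon (m j) (Q j)"
    and "P = polygon_product Q"
    and "\<And>j. odd (m j)"
    and "facet_enumeration P F"
    and "mod2_characteristic_map P F lam"
  shows "\<not> orientable_manifold (small_cover_topology P F lam) (small_cover_charts P F lam) \<and>
         \<not> symplectic_manifold (small_cover_charts P F lam)"
proof (rule ccontr)
  assume contra: "\<not> ?thesis"
  have P: "polytope P" "aff_dim P = DIM((real ^ 2) ^ 'n)"
    unfolding assms(2)
    by (rule polytope_polygon_product[of m Q, OF assms(1)], rule aff_dim_polygon_product[of m Q, OF assms(1)])
  have "card (UNIV :: ('n \<times> bool) set) = card (UNIV :: 'k set)"
    using P(2) assms(5) by (simp add: mod2_characteristic_map_def card_prod UNIV_Times_UNIV[symmetric] del: UNIV_Times_UNIV)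
  from finite_same_card_bij[OF finite finite this]
  obtain \<iota> :: "'n \<times> bool \<Rightarrow> 'k" where \<iota>: "bij \<iota>" by blast
  obtain h where "lam h = 0" "parity h = 1"
    using odd_kernel_vector_polygon_product[OF assms(1,3) assms(4,5)[unfolded assms(2)] \<iota>] by blast
  moreover have "parity h = 0" if "lam h = 0" for h
    using even_kernel_if_orientable_or_symplectic[OF P assms(4,5) \<iota> _ that] contra by blast
  ultimately show False by force
qed

end
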